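(* Let $P^*\succeq0$ be the unique stabilizing solution of the generalized algebraic Riccati equation $$PA+A^\top P+A_1^\top PA_1-PBR^{-1}B^\top P+\gamma^{-2}PEE^\top P+Q=0,$$ and assume that $(A,A_1|C)$ and $(A+\gamma^{-2}EE^\top P^*,A_1|C)$ are exactly detectable and that the system $dx=(Ax+Bu+Ev)\,dt+A_1x\,dW$ is internally stabilizable. Assume the rank condition: there is a positive integer $S$ such that for all numbers $s\ge S$ of data intervals $$\operatorname{rank}\big[\mathcal I_{\tilde x},\mathcal I_{xu},\mathcal I_{xv}\big]=\frac{n(n+1)}2+nm+np .$$ Let data be collected over $s\ge S$ intervals, let $P^0\in\mathcal P_0$, $L^0=R^{-1}B^\top P^0$, $F^0=-\gamma^{-2}E^\top P^0$, and let $\{P^i\}$ be generated by the model-free off-policy algorithm: for $i=0,1,2,\dots$, solve (in the least-squares sense) $$\Phi^i\,\Xi^{i+1}=\Upsilon^i,\qquad \Xi^{i+1}=\big[\operatorname{vecs}(\Theta_1^{i+1})^\top,\operatorname{vec}(\Theta_2^{i+1})^\top,\operatorname{vec}(\Theta_3^{i+1})^\top\big]^\top,$$ with $\Theta_1^{i+1}\in\mathcal S^n$, $\Theta_2^{i+1}\in\mathbb R^{m\times n}$, $\Theta_3^{i+1}\in\mathbb R^{p\times n}$, and set $P^{i+1}=\Theta_1^{i+1}$, $L^{i+1}=R^{-1}\Theta_2^{i+1}$, $F^{i+1}=-\gamma^{-2}\Theta_3^{i+1}$. Then $P^i\to P^*$ as $i\to\infty$.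
   Context: $\mathcal S^n$ ($\mathcal S^n_+$): real symmetric (positive semidefinite) $n\times n$ matrices; $\|\cdot\|_F$: Frobenius norm; $\otimes$: Kronecker product; $\operatorname{vec}$: column stacking. For $H=(h_{ik})\in\mathcal S^n$, $\operatorname{vecs}(H)=[h_{11},\sqrt2h_{12},\dots,\sqrt2h_{1n},h_{22},\sqrt2h_{23},\dots,\sqrt2h_{n-1,n},h_{nn}]^\top$; for $x\in\mathbb R^n$, $\tilde x=\operatorname{vecs}(xx^\top)$. System: $dx=(Ax+Bu+Ev)\,dt+A_1x\,dW$ with $x(0)=x_0$ deterministic, $W$ a one-dimensional standard Brownian motion with filtration $\mathcal F_t=\sigma(W(s):0\le s\le t)$; $A,A_1\in\mathbb R^{n\times n}$, $B\in\mathbb R^{n\times m}$, $E\in\mathbb R^{n\times p}$, $C$, $D$ constant real matrices, $D$ of full column rank, $Q=C^\top C$, $R=D^\top D$, $\gamma>0$. Stabilizing solution: $P\succeq0$ solving the Riccati equation such that $dx=\mathscr A(P)x\,dt+A_1x\,dW$ is asymptotically mean square stable ($\mathbb E\|x(t)\|^2\to0$ for all deterministic $x(0)$), $\mathscr A(P)=A-BR^{-1}B^\top P+\gamma^{-2}EE^\top P$. Internally stabilizable: some feedback $u=-Lx$ makes $dx=(A-BL)x\,dt+A_1x\,dW$ satisfy $\mathbb E\|x(t)\|^2\to0$ for all $x(0)$. $(A,A_1|C)$ exactly detectable: for $dx=Ax\,dt+A_1x\,dW$, if $Cx(t)=0$ almost surely for all $t\ge0$ then $\mathbb E\|x(t)\|^2\to0$.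 Initial set: let $\mathscr F(P)=PA+A^\top P+A_1^\top PA_1-PBR^{-1}B^\top P+\gamma^{-2}PEE^\top P+Q$ on $\mathcal S^n$, with Fréchet derivative $\mathscr F'(P)\Delta=\Delta\mathscr A(P)+\mathscr A(P)^\top\Delta+A_1^\top\Delta A_1$; let $c_0>0$ be a Lipschitz constant of $P\mapsto\mathscr F'(P)$ (operator norm induced by $\|\cdot\|_F$) and $a_0>0$ with $\|(\mathscr F'(P^* ))^{-1}\|\le a_0$. Then $\mathcal P_0=\{P\in\mathcal S^n_+:\|P-P^*\|_F\le\frac{2-\sqrt2}{2c_0a_0}\}$. Data: the behavior inputs $u,v$ applied to the system are adapted, square integrable on $\Omega\times[0,T]$ for every $T<\infty$, of the form admissible linear state feedback ($-Lx$, respectively $-Fx$) plus exploration noise. For times $0\le t_1<t_1+\Delta t\le t_2<\dots<t_s+\Delta t<\infty$ with $\Delta t>0$, define the matrices with $j$-th rows ($j=1,\dots,s$) $$\Delta_{\tilde x}:\ \big(\mathbb E[\tilde x(t_j+\Delta t)|\mathcal F_{t_j}]-\tilde x(t_j)\big)^\top,\quad \mathcal I_{\tilde x}:\ \mathbb E\Big[\int_{t_j}^{t_j+\Delta t}\tilde x\,d\tau\Big|\mathcal F_{t_j}\Big]^\top,\quad \mathcal I_{xx}:\ \mathbb E\Big[\int_{t_j}^{t_j+\Delta t}x\otimes x\,d\tau\Big|\mathcal F_{t_j}\Big]^\top,$$ $$\mathcal I_{xu}:\ \mathbb E\Big[\int_{t_j}^{t_j+\Delta t}x\otimes u\,d\tau\Big|\mathcal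 F_{t_j}\Big]^\top,\quad \mathcal I_{xv}:\ \mathbb E\Big[\int_{t_j}^{t_j+\Delta t}x\otimes v\,d\tau\Big|\mathcal F_{t_j}\Big]^\top,$$ and $$\Phi^i=\big[\Delta_{\tilde x},\ -2\mathcal I_{xx}(I_n\otimes(L^i)^\top)-2\mathcal I_{xu},\ -2\mathcal I_{xx}(I_n\otimes(F^i)^\top)-2\mathcal I_{xv}\big],$$ $$\Upsilon^i=\mathcal I_{\tilde x}\operatorname{vecs}\big(\gamma^2(F^i)^\top F^i-Q-(L^i)^\top RL^i\big).$$ The data matrices are taken exactly (no sampling or numerical error); statements involving conditional expectations (rank condition, conclusion) are understood almost surely. *)

theory Defs
  imports "HOL-Probability.Probability"
begin

section \<open>Symmetric matrices, half-vectorization, Kronecker products\<close>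

text \<open>
  The norm of \<^typ>\<open>real^'n^'m\<close> is the Frobenius norm, so \<^const>\<open>norm\<close> and convergence of
  matrices are used directly.
\<close>

definition sym_mats :: "(real^'n^'n) set" where
  "sym_mats = {P. transpose P = P}"

definition psd_mats :: "(real^'n^'n) set" where
  "psd_mats = {P \<in> sym_mats. \<forall>x. 0 \<le> x \<bullet> (P *v x)}"

text \<open>The index set of the half-vectorization; it has \<open>n(n+1)/2\<close> elements.\<close>

typedef (overloaded) ('n::linorder) upper_pair = "{(i :: 'n, k). i \<le> k}"
  by auto

instance upper_pair :: ("{finite, linorder}") finite
proof
  have "inj (Rep_upper_pair :: 'a upper_pair \<Rightarrow> 'a \<times> 'a)"
    by (simp add: inj_def Rep_upper_pair_inject)
  then show "finite (UNIV :: 'a upper_pair set)"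
    by (rule finite_imageD[rotated]) simp
qed

definition vecs :: "real^('n::{finite, linorder})^('n::{finite, linorder}) \<Rightarrow> real^('n upper_pair)" where
  "vecs H = (\<chi> e. case Rep_upper_pair e of (i, k) \<Rightarrow> if i = k then H$i$k else sqrt 2 * H$i$k)"

text \<open>
  An entry of a Kronecker product is indexed by the pair (outer index, inner index), standing for
  its position in lexicographic order. Column stacking of a matrix accordingly puts the column
  index first, so that the columns of \<open>x \<otimes> u\<close> data match the entries of \<open>vec \<Theta>\<close>.
\<close>

definition vec_mat :: "real^'n^'m \<Rightarrow> real^('n \<times> 'm)" where
  "vec_mat X = (\<chi> e. case e of (j, i) \<Rightarrow> X$i$j)"

definition kron_vec :: "real^'a \<Rightarrow> real^'b \<Rightarrow> real^('a \<times> 'b)" where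
  "kron_vec x y = (\<chi> e. case e of (i, k) \<Rightarrow> x$i * y$k)"

definition kron :: "real^'b^'a \<Rightarrow> real^'d^'c \<Rightarrow> real^('b \<times> 'd)^('a \<times> 'c)" where
  "kron A B = (\<chi> e f. case (e, f) of ((i, k), (j, l)) \<Rightarrow> A$i$j * B$k$l)"

definition outer :: "real^'n \<Rightarrow> real^'n^'n" where
  "outer x = (\<chi> i k. x$i * x$k)"

definition xtilde :: "real^('n::{finite, linorder}) \<Rightarrow> real^('n upper_pair)" where
  "xtilde x = vecs (outer x)"

definition block3 :: "real^'a \<Rightarrow> real^'b \<Rightarrow> real^'c \<Rightarrow> real^('a + ('b + 'c))" where
  "block3 a b c = (\<chi> e. case e of Inl i \<Rightarrow> a$i | Inr (Inl j) \<Rightarrow> b$j | Inr (Inr k) \<Rightarrow> c$k)"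

text \<open>
  A matrix with a variable number \<open>s\<close> of rows is given by its rows \<open>X 1, \<dots>, X s\<close>. Its rank is,
  as for \<^const>\<open>rank\<close> (see \<open>row_rank_def\<close>), the dimension of the set of rows.
\<close>

definition row_data_rank :: "nat \<Rightarrow> (nat \<Rightarrow> real^'c) \<Rightarrow> nat" where
  "row_data_rank s X = dim (X ` {1..s})"

definition least_squares_solution ::
    "nat \<Rightarrow> (nat \<Rightarrow> real^'c) \<Rightarrow> (nat \<Rightarrow> real) \<Rightarrow> real^'c \<Rightarrow> bool" where
  "least_squares_solution s \<Phi> \<Upsilon> \<xi> \<longleftrightarrow>
     (\<forall>\<eta>. (\<Sum>j=1..s. (\<Phi> j \<bullet> \<xi> - \<Upsilon> j)\<^sup>2) \<le> (\<Sum>j=1..s. (\<Phi> j \<bullet> \<eta> - \<Upsilon> j)\<^sup>2))"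

text \<open>Operator norm on a set, in analogy to \<^const>\<open>onorm\<close>.\<close>

definition onorm_on :: "'a::real_normed_vector set \<Rightarrow> ('a \<Rightarrow> 'b::real_normed_vector) \<Rightarrow> real" where
  "onorm_on S f = (SUP x\<in>S. norm (f x) / norm x)"


section \<open>Brownian motion, Ito integrals, stochastic differential equations\<close>

definition nat_filt :: "'w measure \<Rightarrow> (real \<Rightarrow> 'w \<Rightarrow> real) \<Rightarrow> real \<Rightarrow> 'w measure" where
  "nat_filt M W t = sigma (space M) (\<Union>s\<in>{0..t}. {W s -` U \<inter> space M | U. U \<in> sets borel})"

definition brownian_motion :: "'w measure \<Rightarrow> (real \<Rightarrow> 'w \<Rightarrow> real) \<Rightarrow> bool" where
  "brownian_motion M W \<longleftrightarrow>
     prob_space M \<and>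
     (\<forall>t\<ge>0. W t \<in> borel_measurable M) \<and>
     (AE \<omega> in M. W 0 \<omega> = 0) \<and>
     (AE \<omega> in M. continuous_on {0..} (\<lambda>t. W t \<omega>)) \<and>
     (\<forall>s t. 0 \<le> s \<and> s < t \<longrightarrow>
        distributed M lborel (\<lambda>\<omega>. W t \<omega> - W s \<omega>) (normal_density 0 (sqrt (t - s))) \<and>
        prob_space.indep_set M (sets (nat_filt M W s))
          {(\<lambda>\<omega>. W t \<omega> - W s \<omega>) -` U \<inter> space M | U. U \<in> sets borel})"

definition horizon :: "'w measure \<Rightarrow> real \<Rightarrow> ('w \<times> real) measure" where
  "horizon M T = M \<Otimes>\<^sub>M restrict_space lborel {0..T}"

text \<open>
  Adapted processes that are square integrable on \<open>\<Omega> \<times> [0,T]\<close> for every \<open>T\<close>. Processes are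
  functions on all of \<^typ>\<open>real\<close>; their values at negative times are irrelevant.
\<close>

definition l2_adapted ::
    "'w measure \<Rightarrow> (real \<Rightarrow> 'w \<Rightarrow> real) \<Rightarrow> (real \<Rightarrow> 'w \<Rightarrow> real^'d) \<Rightarrow> bool" where
  "l2_adapted M W f \<longleftrightarrow>
     (\<forall>t\<ge>0. f t \<in> borel_measurable (nat_filt M W t)) \<and>
     (\<forall>T\<ge>0. (\<lambda>(\<omega>, t). f t \<omega>) \<in> borel_measurable (horizon M T) \<and>
             integrable (horizon M T) (\<lambda>(\<omega>, t). (norm (f t \<omega>))\<^sup>2))"

text \<open>
  Bounded simple adapted integrands on \<open>[0,T]\<close>, with value \<open>\<xi> k\<close> on \<open>(\<tau> k, \<tau> (k+1)]\<close> for \<open>k < N\<close>.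
\<close>

definition simple_integrand ::
    "'w measure \<Rightarrow> (real \<Rightarrow> 'w \<Rightarrow> real) \<Rightarrow> real \<Rightarrow> nat \<Rightarrow> (nat \<Rightarrow> real) \<Rightarrow> (nat \<Rightarrow> 'w \<Rightarrow> real) \<Rightarrow> bool"
  where
  "simple_integrand M W T N \<tau> \<xi> \<longleftrightarrow>
     0 \<le> \<tau> 0 \<and> \<tau> N \<le> T \<and>
     (\<forall>k<N. \<tau> k \<le> \<tau> (Suc k) \<and> \<xi> k \<in> borel_measurable (nat_filt M W (\<tau> k)) \<and>
            (\<exists>K. \<forall>\<omega>\<in>space M. \<bar>\<xi> k \<omega>\<bar> \<le> K))"

definition simple_process ::
    "nat \<Rightarrow> (nat \<Rightarrow> real) \<Rightarrow> (nat \<Rightarrow> 'w \<Rightarrow> real) \<Rightarrow> real \<Rightarrow> 'w \<Rightarrow> real" where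
  "simple_process N \<tau> \<xi> t \<omega> = (\<Sum>k<N. \<xi> k \<omega> * indicator {\<tau> k<..\<tau> (Suc k)} t)"

definition simple_ito ::
    "(real \<Rightarrow> 'w \<Rightarrow> real) \<Rightarrow> nat \<Rightarrow> (nat \<Rightarrow> real) \<Rightarrow> (nat \<Rightarrow> 'w \<Rightarrow> real) \<Rightarrow> 'w \<Rightarrow> real" where
  "simple_ito W N \<tau> \<xi> \<omega> = (\<Sum>k<N. \<xi> k \<omega> * (W (\<tau> (Suc k)) \<omega> - W (\<tau> k) \<omega>))"

text \<open>
  \<open>I\<close> is (a version of) the Ito integral of \<open>f\<close> over \<open>[0,T]\<close>: the mean square limit of the
  integrals of simple integrands converging to \<open>f\<close> in mean square on \<open>\<Omega> \<times> [0,T]\<close>.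
\<close>

definition has_ito_integral ::
    "'w measure \<Rightarrow> (real \<Rightarrow> 'w \<Rightarrow> real) \<Rightarrow> (real \<Rightarrow> 'w \<Rightarrow> real) \<Rightarrow> real \<Rightarrow> ('w \<Rightarrow> real) \<Rightarrow> bool" where
  "has_ito_integral M W f T I \<longleftrightarrow>
     (\<lambda>(\<omega>, t). f t \<omega>) \<in> borel_measurable (horizon M T) \<and>
     I \<in> borel_measurable M \<and>
     (\<exists>N \<tau> \<xi>.
        (\<forall>l. simple_integrand M W T (N l) (\<tau> l) (\<xi> l)) \<and>
        (\<lambda>l. \<integral>\<^sup>+(\<omega>, t). ennreal ((f t \<omega> - simple_process (N l) (\<tau> l) (\<xi> l) t \<omega>)\<^sup>2) \<partial>horizon M T)
          \<longlonglongrightarrow> 0 \<and>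
        (\<lambda>l. \<integral>\<^sup>+\<omega>. ennreal ((I \<omega> - simple_ito W (N l) (\<tau> l) (\<xi> l) \<omega>)\<^sup>2) \<partial>M) \<longlonglongrightarrow> 0)"

text \<open>\<open>dx = b dt + g dW\<close> with \<open>x(0) = x0\<close>, where \<open>W\<close> is one-dimensional.\<close>

definition sde_solution ::
    "'w measure \<Rightarrow> (real \<Rightarrow> 'w \<Rightarrow> real) \<Rightarrow> (real \<Rightarrow> 'w \<Rightarrow> real^'n) \<Rightarrow> (real \<Rightarrow> 'w \<Rightarrow> real^'n) \<Rightarrow>
     real^'n \<Rightarrow> (real \<Rightarrow> 'w \<Rightarrow> real^'n) \<Rightarrow> bool" where
  "sde_solution M W b g x0 x \<longleftrightarrow>
     l2_adapted M W x \<and>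
     (AE \<omega> in M. continuous_on {0..} (\<lambda>t. x t \<omega>)) \<and>
     (\<forall>t\<ge>0. \<exists>J.
        (\<forall>i. has_ito_integral M W (\<lambda>\<tau> \<omega>. g \<tau> \<omega> $ i) t (\<lambda>\<omega>. J \<omega> $ i)) \<and>
        (AE \<omega> in M. x t \<omega> = x0 + (LINT \<tau>:{0..t}|lborel. b \<tau> \<omega>) + J \<omega>))"

definition lin_solution ::
    "'w measure \<Rightarrow> (real \<Rightarrow> 'w \<Rightarrow> real) \<Rightarrow> real^'n^'n \<Rightarrow> real^'n^'n \<Rightarrow>
     real^'n \<Rightarrow> (real \<Rightarrow> 'w \<Rightarrow> real^'n) \<Rightarrow> bool" where
  "lin_solution M W A A1 x0 x \<longleftrightarrow>
     sde_solution M W (\<lambda>t \<omega>. A *v x t \<omega>) (\<lambda>t \<omega>. A1 *v x t \<omega>) x0 x"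

definition ms_vanishing :: "'w measure \<Rightarrow> (real \<Rightarrow> 'w \<Rightarrow> real^'n) \<Rightarrow> bool" where
  "ms_vanishing M x \<longleftrightarrow>
     ((\<lambda>t. \<integral>\<^sup>+\<omega>. ennreal ((norm (x t \<omega>))\<^sup>2) \<partial>M) \<longlongrightarrow> 0) at_top"

definition ms_stable ::
    "'w measure \<Rightarrow> (real \<Rightarrow> 'w \<Rightarrow> real) \<Rightarrow> real^'n^'n \<Rightarrow> real^'n^'n \<Rightarrow> bool" where
  "ms_stable M W A A1 \<longleftrightarrow> (\<forall>x0 x. lin_solution M W A A1 x0 x \<longrightarrow> ms_vanishing M x)"

definition internally_stabilizable ::
    "'w measure \<Rightarrow> (real \<Rightarrow> 'w \<Rightarrow> real) \<Rightarrow> real^'n^'n \<Rightarrow> real^'m^'n \<Rightarrow> real^'n^'n \<Rightarrow> bool" where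
  "internally_stabilizable M W A B A1 \<longleftrightarrow> (\<exists>L :: real^'n^'m. ms_stable M W (A - B ** L) A1)"

definition exactly_detectable ::
    "'w measure \<Rightarrow> (real \<Rightarrow> 'w \<Rightarrow> real) \<Rightarrow> real^'n^'n \<Rightarrow> real^'n^'n \<Rightarrow> real^'n^'q \<Rightarrow> bool" where
  "exactly_detectable M W A A1 C \<longleftrightarrow>
     (\<forall>x0 x. lin_solution M W A A1 x0 x \<and> (\<forall>t\<ge>0. AE \<omega> in M. C *v x t \<omega> = 0) \<longrightarrow> ms_vanishing M x)"


section \<open>The Riccati equation\<close>

definition closed_loop ::
    "real^'n^'n \<Rightarrow> real^'m^'n \<Rightarrow> real^'p^'n \<Rightarrow> real^'m^'m \<Rightarrow> real \<Rightarrow> real^'n^'n \<Rightarrow> real^'n^'n" where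
  "closed_loop A B E R \<gamma> P =
     A - B ** matrix_inv R ** transpose B ** P + (1 / \<gamma>\<^sup>2) *\<^sub>R (E ** transpose E ** P)"

definition riccati ::
    "real^'n^'n \<Rightarrow> real^'n^'n \<Rightarrow> real^'m^'n \<Rightarrow> real^'p^'n \<Rightarrow> real^'n^'n \<Rightarrow> real^'m^'m \<Rightarrow> real \<Rightarrow>
     real^'n^'n \<Rightarrow> real^'n^'n" where
  "riccati A A1 B E Q R \<gamma> P =
     P ** A + transpose A ** P + transpose A1 ** P ** A1
     - P ** B ** matrix_inv R ** transpose B ** P
     + (1 / \<gamma>\<^sup>2) *\<^sub>R (P ** E ** transpose E ** P) + Q"

text \<open>The Frechet derivative of \<^const>\<open>riccati\<close> on the symmetric matrices.\<close>

definition riccati_deriv ::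
    "real^'n^'n \<Rightarrow> real^'n^'n \<Rightarrow> real^'m^'n \<Rightarrow> real^'p^'n \<Rightarrow> real^'m^'m \<Rightarrow> real \<Rightarrow>
     real^'n^'n \<Rightarrow> real^'n^'n \<Rightarrow> real^'n^'n" where
  "riccati_deriv A A1 B E R \<gamma> P \<Delta> =
     \<Delta> ** closed_loop A B E R \<gamma> P + transpose (closed_loop A B E R \<gamma> P) ** \<Delta>
     + transpose A1 ** \<Delta> ** A1"

definition stabilizing_solution ::
    "'w measure \<Rightarrow> (real \<Rightarrow> 'w \<Rightarrow> real) \<Rightarrow>
     real^'n^'n \<Rightarrow> real^'n^'n \<Rightarrow> real^'m^'n \<Rightarrow> real^'p^'n \<Rightarrow> real^'n^'n \<Rightarrow> real^'m^'m \<Rightarrow> real \<Rightarrow>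
     real^'n^'n \<Rightarrow> bool" where
  "stabilizing_solution M W A A1 B E Q R \<gamma> P \<longleftrightarrow>
     P \<in> psd_mats \<and> riccati A A1 B E Q R \<gamma> P = 0 \<and> ms_stable M W (closed_loop A B E R \<gamma> P) A1"

text \<open>
  The constants of the initial set: \<open>c0\<close> is a Lipschitz constant of the derivative on the symmetric
  matrices, and \<open>a0\<close> bounds the norm of the inverse of the derivative at \<open>Pstar\<close>.
\<close>

definition deriv_lipschitz ::
    "real^'n^'n \<Rightarrow> real^'n^'n \<Rightarrow> real^'m^'n \<Rightarrow> real^'p^'n \<Rightarrow> real^'m^'m \<Rightarrow> real \<Rightarrow> real \<Rightarrow> bool" where
  "deriv_lipschitz A A1 B E R \<gamma> c0 \<longleftrightarrow>
     (\<forall>P\<in>sym_mats. \<forall>P'\<in>sym_mats.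
        onorm_on sym_mats (\<lambda>\<Delta>. riccati_deriv A A1 B E R \<gamma> P \<Delta> - riccati_deriv A A1 B E R \<gamma> P' \<Delta>)
          \<le> c0 * norm (P - P'))"

definition deriv_inverse_bound ::
    "real^'n^'n \<Rightarrow> real^'n^'n \<Rightarrow> real^'m^'n \<Rightarrow> real^'p^'n \<Rightarrow> real^'m^'m \<Rightarrow> real \<Rightarrow>
     real^'n^'n \<Rightarrow> real \<Rightarrow> bool" where
  "deriv_inverse_bound A A1 B E R \<gamma> Pstar a0 \<longleftrightarrow>
     bij_betw (riccati_deriv A A1 B E R \<gamma> Pstar) sym_mats sym_mats \<and>
     onorm_on sym_mats (the_inv_into sym_mats (riccati_deriv A A1 B E R \<gamma> Pstar)) \<le> a0"

definition initial_set :: "real^'n^'n \<Rightarrow> real \<Rightarrow> real \<Rightarrow> (real^'n^'n) set" where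
  "initial_set Pstar c0 a0 = {P \<in> psd_mats. norm (P - Pstar) \<le> (2 - sqrt 2) / (2 * c0 * a0)}"


section \<open>Data and the off-policy algorithm\<close>

definition cond_exp_vec ::
    "'w measure \<Rightarrow> 'w measure \<Rightarrow> ('w \<Rightarrow> real^'c) \<Rightarrow> 'w \<Rightarrow> real^'c" where
  "cond_exp_vec M G Z \<omega> = (\<chi> i. real_cond_exp M G (\<lambda>\<omega>'. Z \<omega>' $ i) \<omega>)"

text \<open>
  Row \<open>j\<close> of the data matrices at the sample point \<open>\<omega>\<close>, for the interval \<open>[tm j, tm j + dt]\<close>.
\<close>

definition increment_row ::
    "'w measure \<Rightarrow> (real \<Rightarrow> 'w \<Rightarrow> real) \<Rightarrow> (nat \<Rightarrow> real) \<Rightarrow> real \<Rightarrow>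
     (real \<Rightarrow> 'w \<Rightarrow> real^'c) \<Rightarrow> 'w \<Rightarrow> nat \<Rightarrow> real^'c" where
  "increment_row M W tm dt z \<omega> j =
     cond_exp_vec M (nat_filt M W (tm j)) (z (tm j + dt)) \<omega> - z (tm j) \<omega>"

definition integral_row ::
    "'w measure \<Rightarrow> (real \<Rightarrow> 'w \<Rightarrow> real) \<Rightarrow> (nat \<Rightarrow> real) \<Rightarrow> real \<Rightarrow>
     (real \<Rightarrow> 'w \<Rightarrow> real^'c) \<Rightarrow> 'w \<Rightarrow> nat \<Rightarrow> real^'c" where
  "integral_row M W tm dt z \<omega> j =
     cond_exp_vec M (nat_filt M W (tm j))
       (\<lambda>\<omega>'. LINT \<tau>:{tm j..tm j + dt}|lborel. z \<tau> \<omega>') \<omega>"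

definition Phi_row ::
    "real^('n upper_pair) \<Rightarrow> real^('n \<times> 'n) \<Rightarrow> real^('n \<times> 'm) \<Rightarrow>
     real^('n \<times> 'p) \<Rightarrow> real^('n::{finite, linorder})^'m \<Rightarrow> real^('n::{finite, linorder})^'p \<Rightarrow>
     real^('n upper_pair + ('n \<times> 'm + 'n \<times> 'p))" where
  "Phi_row dx ixx ixu ixv L F =
     block3 dx
       (- 2 *\<^sub>R (ixx v* kron (mat 1) (transpose L)) - 2 *\<^sub>R ixu)
       (- 2 *\<^sub>R (ixx v* kron (mat 1) (transpose F)) - 2 *\<^sub>R ixv)"

definition Upsilon_entry ::
    "real^('n upper_pair) \<Rightarrow> real^('n::{finite, linorder})^('n::{finite, linorder}) \<Rightarrow> real^'m^'m \<Rightarrow> real \<Rightarrow>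
     real^('n::{finite, linorder})^'m \<Rightarrow> real^('n::{finite, linorder})^'p \<Rightarrow> real" where
  "Upsilon_entry ixt Q R \<gamma> L F =
     ixt \<bullet> vecs (\<gamma>\<^sup>2 *\<^sub>R (transpose F ** F) - Q - transpose L ** R ** L)"

text \<open>
  The sequences \<open>P\<close>, \<open>L\<close>, \<open>F\<close> produced by the algorithm from \<open>s\<close> rows of (deterministic) data.
\<close>

definition off_policy_iterates ::
    "nat \<Rightarrow> (nat \<Rightarrow> real^('n upper_pair)) \<Rightarrow> (nat \<Rightarrow> real^('n upper_pair)) \<Rightarrow>
     (nat \<Rightarrow> real^('n \<times> 'n)) \<Rightarrow> (nat \<Rightarrow> real^('n \<times> 'm)) \<Rightarrow> (nat \<Rightarrow> real^('n \<times> 'p)) \<Rightarrow>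
     real^'m^('n::{finite, linorder}) \<Rightarrow> real^'p^('n::{finite, linorder}) \<Rightarrow>
     real^('n::{finite, linorder})^('n::{finite, linorder}) \<Rightarrow> real^'m^'m \<Rightarrow> real \<Rightarrow>
     real^('n::{finite, linorder})^('n::{finite, linorder}) \<Rightarrow>
     (nat \<Rightarrow> real^('n::{finite, linorder})^('n::{finite, linorder})) \<Rightarrow>
     (nat \<Rightarrow> real^('n::{finite, linorder})^'m) \<Rightarrow> (nat \<Rightarrow> real^('n::{finite, linorder})^'p) \<Rightarrow> bool" where
  "off_policy_iterates s dx ixt ixx ixu ixv B E Q R \<gamma> P0 P L F \<longleftrightarrow>
     P 0 = P0 \<and>
     L 0 = matrix_inv R ** transpose B ** P0 \<and>
     F 0 = - (1 / \<gamma>\<^sup>2) *\<^sub>R (transpose E ** P0) \<and>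
     (\<forall>i. \<exists>\<Theta>1 \<Theta>2 \<Theta>3.
        \<Theta>1 \<in> sym_mats \<and>
        least_squares_solution s
          (\<lambda>j. Phi_row (dx j) (ixx j) (ixu j) (ixv j) (L i) (F i))
          (\<lambda>j. Upsilon_entry (ixt j) Q R \<gamma> (L i) (F i))
          (block3 (vecs \<Theta>1) (vec_mat \<Theta>2) (vec_mat \<Theta>3)) \<and>
        P (Suc i) = \<Theta>1 \<and>
        L (Suc i) = matrix_inv R ** \<Theta>2 \<and>
        F (Suc i) = - (1 / \<gamma>\<^sup>2) *\<^sub>R \<Theta>3)"

end

theory Submission
  imports Defs
begin

text \<open>
  The algorithm is Newton's method for the Riccati equation, carried out with data instead of the
  system matrices.

  Let \<open>X\<close>, \<open>U\<close>, \<open>V\<close> be the integrals of \<open>x x\<^sup>T\<close>, \<open>u x\<^sup>T\<close>, \<open>v x\<^sup>T\<close> over one data interval, conditionally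
  expected given its beginning. By the product rule for Ito processes the conditional increment of
  \<open>x x\<^sup>T\<close> over the interval is the linear expression
  \<open>A X + B U + E V + (A X + B U + E V)\<^sup>T + A1 X A1\<^sup>T\<close> in these moments (\<open>conditional_moment_increment\<close>).
  Substituting it into a row of the least-squares problem at step \<open>i\<close> turns the residual of the row
  into \<open>X \<bullet> H + 2 U \<bullet> (B\<^sup>T \<Theta>1 - \<Theta>2) + 2 V \<bullet> (E\<^sup>T \<Theta>1 - \<Theta>3)\<close> with a symmetric matrix \<open>H\<close> that depends on the
  unknowns but not on the row (\<open>row_residual\<close>). The rank condition says exactly that such a functional
  vanishes on all rows only if its three coefficients are zero. Two of these equations say
  \<open>\<Theta>2 = B\<^sup>T \<Theta>1\<close> and \<open>\<Theta>3 = E\<^sup>T \<Theta>1\<close>, so the new gains are those of \<open>\<Theta>1\<close>; and since the old gains are those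
  of \<open>P i\<close>, the third equation \<open>H = 0\<close> is the Newton equation for \<open>\<Theta>1\<close> at \<open>P i\<close>
  (\<open>newton_equation_residual\<close>).

  Near \<open>Pstar\<close> the Newton equation is solvable, because the derivative is close to its invertible value
  at \<open>Pstar\<close> (\<open>newton_step_exists\<close>). Hence the least-squares problem has an exact solution, every least
  squares solution is exact, and every exact solution is a Newton step. As the Riccati map is quadratic,
  its second-order part is controlled by the Lipschitz constant of the derivative, and on the initial
  set a Newton step at least halves the distance to \<open>Pstar\<close> (\<open>newton_step_contracts\<close>).

  The product rule (\<open>ito_product_conditional_mean\<close>) concerns conditional means of products of two
  processes. It follows from three facts about Ito integrals, obtained first for
  finite sums of weighted increments of the Brownian motion and then in the mean square limit: the
  isometry, the orthogonality of increments to the past, and the fact that an increment weighted by a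
  known variable is again an Ito integral (\<open>ito_increment\<close>). The drift enters through Fubini's theorem.
\<close>


section \<open>Matrix algebra\<close>

lemma matrix_add_rdistrib:
  fixes A B :: "real^'n^'m" and C :: "real^'p^'n"
  shows "(A + B) ** C = A ** C + B ** C"
  by (vector matrix_matrix_mult_def sum.distrib[symmetric] field_simps)

lemma matrix_diff_ldistrib:
  fixes A :: "real^'n^'m" and B C :: "real^'p^'n"
  shows "A ** (B - C) = A ** B - A ** C"
  by (simp add: vec_eq_iff matrix_matrix_mult_def sum_subtractf[symmetric] algebra_simps)

lemma matrix_diff_rdistrib:
  fixes A B :: "real^'n^'m" and C :: "real^'p^'n"
  shows "(A - B) ** C = A ** C - B ** C"
  by (simp add: vec_eq_iff matrix_matrix_mult_def sum_subtractf[symmetric] algebra_simps)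

lemma transpose_add: "transpose (A + B) = transpose A + transpose (B :: real^'n^'m)"
  by (simp add: vec_eq_iff transpose_def)

lemma transpose_diff: "transpose (A - B) = transpose A - transpose (B :: real^'n^'m)"
  by (simp add: vec_eq_iff transpose_def)

lemma transpose_minus: "transpose (- A) = - transpose (A :: real^'n^'m)"
  by (simp add: vec_eq_iff transpose_def)

lemma matrix_minus_left: "(- A) ** C = - ((A :: real^'n^'m) ** (C :: real^'p^'n))"
  by (simp add: vec_eq_iff matrix_matrix_mult_def sum_negf)

lemma matrix_minus_right: "A ** (- C) = - ((A :: real^'n^'m) ** (C :: real^'p^'n))"
  by (simp add: vec_eq_iff matrix_matrix_mult_def sum_negf)

lemmas matrix_ring = matrix_add_ldistrib matrix_add_rdistrib scalar_matrix_assoc[symmetric]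
  matrix_scalar_ac matrix_diff_ldistrib matrix_diff_rdistrib matrix_minus_left
  matrix_minus_right matrix_mul_assoc matrix_transpose_mul transpose_add transpose_diff
  transpose_scalar transpose_minus

text \<open>
  The inner product of matrices is the Frobenius one, so a factor moves to the other side as its
  transpose. This is how linear functionals of the data moments are turned into matrix equations.
\<close>

lemma inner_matrix_eq_sum:
  fixes X Y :: "real^'n^'m"
  shows "X \<bullet> Y = (\<Sum>i\<in>UNIV. \<Sum>j\<in>UNIV. X$i$j * Y$i$j)"
  by (simp add: inner_vec_def)

lemma inner_transpose:
  fixes X Y :: "real^'n^'m"
  shows "transpose X \<bullet> transpose Y = X \<bullet> Y"
  unfolding inner_matrix_eq_sum transpose_def by simp (rule sum.swap)

lemma inner_matrix_mult_left:
  fixes A :: "real^'n^'m" and X :: "real^'p^'n" and Y :: "real^'p^'m"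
  shows "(A ** X) \<bullet> Y = X \<bullet> (transpose A ** Y)"
proof -
  have "(A ** X) \<bullet> Y = (\<Sum>i\<in>UNIV. \<Sum>j\<in>UNIV. \<Sum>k\<in>UNIV. A$i$k * X$k$j * Y$i$j)"
    by (simp add: inner_matrix_eq_sum matrix_matrix_mult_def sum_distrib_right)
  also have "\<dots> = (\<Sum>i\<in>UNIV. \<Sum>k\<in>UNIV. \<Sum>j\<in>UNIV. A$i$k * X$k$j * Y$i$j)"
    by (intro sum.cong refl sum.swap)
  also have "\<dots> = (\<Sum>k\<in>UNIV. \<Sum>i\<in>UNIV. \<Sum>j\<in>UNIV. A$i$k * X$k$j * Y$i$j)"
    by (rule sum.swap)
  also have "\<dots> = (\<Sum>k\<in>UNIV. \<Sum>j\<in>UNIV. \<Sum>i\<in>UNIV. A$i$k * X$k$j * Y$i$j)"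
    by (intro sum.cong refl sum.swap)
  also have "\<dots> = X \<bullet> (transpose A ** Y)"
    by (simp add: inner_matrix_eq_sum matrix_matrix_mult_def sum_distrib_left transpose_def
        mult.assoc mult.left_commute)
  finally show ?thesis .
qed

lemma inner_matrix_mult_right:
  fixes X :: "real^'n^'m" and A :: "real^'p^'n" and Y :: "real^'p^'m"
  shows "(X ** A) \<bullet> Y = X \<bullet> (Y ** transpose A)"
  using inner_matrix_mult_left[of "transpose A" "transpose X" "transpose Y"]
    inner_transpose[of "X ** A" Y] inner_transpose[of X "Y ** transpose A"]
  by (simp add: matrix_transpose_mul)

lemma subspace_sym_mats: "subspace (sym_mats :: (real^'n^'n) set)"
  by (simp add: subspace_def sym_mats_def transpose_add transpose_scalar)
     (simp add: vec_eq_iff transpose_def)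

section \<open>Half-vectorization is an isometry on symmetric matrices\<close>

text \<open>
  A symmetric function on pairs takes each off-diagonal value twice; the weight 2 makes up for
  visiting only one of the two positions.
\<close>

lemma sum_upper_pair:
  fixes f :: "'n::{finite,linorder} \<Rightarrow> 'n \<Rightarrow> real"
  assumes sym: "\<And>i k. f i k = f k i"
  shows "(\<Sum>e\<in>UNIV. case Rep_upper_pair e of (i, k) \<Rightarrow> (if i = k then 1 else 2) * f i k)
       = (\<Sum>i\<in>UNIV. \<Sum>k\<in>UNIV. f i k)"
proof -
  let ?U = "{(i :: 'n, k). i \<le> k}" and ?S = "{(i :: 'n, k). i < k}" and ?D = "{(i :: 'n, k). i = k}"
    and ?L = "{(i :: 'n, k). k < i}"
  have img: "range (Rep_upper_pair :: 'n upper_pair \<Rightarrow> _) = ?U"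
    using type_definition.Rep_range[OF type_definition_upper_pair] by simp
  have inj: "inj (Rep_upper_pair :: 'n upper_pair \<Rightarrow> _)"
    by (simp add: inj_def Rep_upper_pair_inject)
  have "(\<Sum>e\<in>UNIV. case Rep_upper_pair e of (i, k) \<Rightarrow> (if i = k then 1 else 2) * f i k)
      = (\<Sum>(i, k)\<in>?U. (if i = k then 1 else 2) * f i k)"
    unfolding img[symmetric] by (subst sum.reindex[OF inj]) (simp add: o_def)
  also have "?U = ?S \<union> ?D" by auto
  also have "(\<Sum>(i, k)\<in>?S \<union> ?D. (if i = k then 1 else 2) * f i k)
      = (\<Sum>(i, k)\<in>?S. 2 * f i k) + (\<Sum>(i, k)\<in>?D. f i k)"
    by (subst sum.union_disjoint) (auto intro!: arg_cong2[of _ _ _ _ "(+)"] sum.cong)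
  also have "(\<Sum>(i, k)\<in>?S. 2 * f i k) = (\<Sum>(i, k)\<in>?S. f i k) + (\<Sum>(i, k)\<in>?S. f i k)"
    by (simp add: sum.distrib[symmetric] case_prod_beta)
  also have "(\<Sum>(i, k)\<in>?S. f i k) = (\<Sum>(i, k)\<in>?L. f i k)" (is "?s = ?l")
    by (rule sum.reindex_bij_witness[of _ "\<lambda>(i, k). (k, i)" "\<lambda>(i, k). (k, i)"]) (auto simp: sym)
  hence "?s + ?s + (\<Sum>(i, k)\<in>?D. f i k) = (\<Sum>(i, k)\<in>?S \<union> ?L \<union> ?D. f i k)"
    by (subst sum.union_disjoint, simp, simp, force, subst sum.union_disjoint) auto
  also have "?S \<union> ?L \<union> ?D = UNIV \<times> UNIV"
    by auto
  finally show ?thesis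
    by (simp add: sum.cartesian_product)
qed

lemma CARD_upper_pair: "CARD('n::{finite,linorder} upper_pair) = CARD('n) * (CARD('n) + 1) div 2"
proof -
  let ?n = "CARD('n)"
  have "real (2 * CARD('n upper_pair)) = real (?n * (?n + 1))"
  proof -
    have eq: "(case Rep_upper_pair e of (i :: 'n, k) \<Rightarrow> (if i = k then 1 else 2) * (if i = k then 2 else (1 :: real))) = 2"
      for e by (simp split: prod.split)
    have "real (2 * CARD('n upper_pair))
        = (\<Sum>e\<in>UNIV. case Rep_upper_pair e of (i :: 'n, k) \<Rightarrow>
             (if i = k then 1 else 2) * (if i = k then 2 else 1))"
      by (simp only: eq) simp
    also have "\<dots> = (\<Sum>i\<in>UNIV. \<Sum>k\<in>UNIV. if (i :: 'n) = k then 2 else 1)"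
      by (rule sum_upper_pair) auto
    also have "\<dots> = (\<Sum>i\<in>(UNIV :: 'n set). \<Sum>k\<in>UNIV. 1 + (if i = k then 1 else 0))"
      by (intro sum.cong) auto
    also have "\<dots> = real (?n * (?n + 1))"
      by (simp add: sum.distrib algebra_simps)
    finally show ?thesis .
  qed
  hence "2 * CARD('n upper_pair) = ?n * (?n + 1)"
    unfolding of_nat_eq_iff .
  thus ?thesis by simp
qed

text \<open>
  The factor \<open>sqrt 2\<close> off the diagonal is chosen for this: half-vectorization loses no length.
\<close>

lemma inner_vecs:
  fixes G H :: "real^('n::{finite,linorder})^('n::{finite,linorder})"
  assumes "G \<in> sym_mats" "H \<in> sym_mats"
  shows "vecs G \<bullet> vecs H = G \<bullet> H"
proof -
  have s: "G$i$k = G$k$i" "H$i$k = H$k$i" for i k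
    using assms unfolding sym_mats_def transpose_def by (auto simp: vec_eq_iff)
  have "vecs G \<bullet> vecs H = (\<Sum>e\<in>UNIV. case Rep_upper_pair e of (i, k) \<Rightarrow>
      (if i = k then 1 else 2) * (G$i$k * H$i$k))"
    unfolding inner_vec_def vecs_def
    by (intro sum.cong refl) (auto split: prod.split simp: algebra_simps)
  also have "\<dots> = G \<bullet> H"
    unfolding inner_matrix_eq_sum by (rule sum_upper_pair) (metis s)
  finally show ?thesis .
qed

lemma inner_vec_mat: "vec_mat X \<bullet> vec_mat Y = X \<bullet> (Y :: real^'n^'m)"
proof -
  have "vec_mat X \<bullet> vec_mat Y = (\<Sum>(j, i)\<in>UNIV \<times> UNIV. X$i$j * Y$i$j)"
    unfolding inner_vec_def vec_mat_def UNIV_Times_UNIV by (intro sum.cong) auto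
  also have "\<dots> = (\<Sum>j\<in>UNIV. \<Sum>i\<in>UNIV. X$i$j * Y$i$j)"
    by (simp add: sum.cartesian_product)
  also have "\<dots> = X \<bullet> Y"
    unfolding inner_matrix_eq_sum by (rule sum.swap)
  finally show ?thesis .
qed

lemma sum_UNIV_Plus:
  fixes f :: "'a::finite + 'b::finite \<Rightarrow> real"
  shows "(\<Sum>e\<in>UNIV. f e) = (\<Sum>i\<in>UNIV. f (Inl i)) + (\<Sum>j\<in>UNIV. f (Inr j))"
  using sum.Plus[of "UNIV :: 'a set" "UNIV :: 'b set" f] by simp

lemma inner_block3: "block3 a b c \<bullet> block3 a' b' c' = a \<bullet> a' + b \<bullet> b' + c \<bullet> c'"
  unfolding inner_vec_def block3_def by (simp add: sum_UNIV_Plus)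

lemma vec_mat_kron:
  fixes X :: "real^'n^'n" and L :: "real^'n^'m"
  shows "vec_mat X v* kron (mat 1) (transpose L) = vec_mat (L ** X)"
proof -
  have "(vec_mat X v* kron (mat 1) (transpose L)) $ (j, l) = vec_mat (L ** X) $ (j, l)" for j l
  proof -
    have "(vec_mat X v* kron (mat 1) (transpose L)) $ (j, l)
        = (\<Sum>(i, k)\<in>UNIV \<times> UNIV. (if i = j then 1 else 0) * L$l$k * X$k$i)"
      unfolding vector_matrix_mult_def vec_mat_def kron_def mat_def transpose_def UNIV_Times_UNIV
      by (auto intro!: sum.cong)
    also have "\<dots> = (\<Sum>i\<in>UNIV. \<Sum>k\<in>UNIV. (if i = j then 1 else 0) * L$l$k * X$k$i)"
      by (simp add: sum.cartesian_product)
    also have "\<dots> = (\<Sum>i\<in>UNIV. if i = j then (\<Sum>k\<in>UNIV. L$l$k * X$k$i) else 0)"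
      by (intro sum.cong) auto
    finally show ?thesis
      by (simp add: vec_mat_def matrix_matrix_mult_def)
  qed
  thus ?thesis by (simp add: vec_eq_iff)
qed

section \<open>Newton's method for the Riccati equation\<close>

text \<open>
  The supremum in \<^const>\<open>onorm_on\<close> bounds its quotients once these are bounded at all, which is what
  the constant \<open>K\<close> provides.
\<close>

lemma norm_le_onorm_on:
  fixes f :: "'a::euclidean_space \<Rightarrow> 'b::real_normed_vector"
  assumes "x \<in> S" and bd: "\<And>y. y \<in> S \<Longrightarrow> norm (f y) \<le> K * norm y"
  shows "norm (f x) \<le> onorm_on S f * norm x"
proof (cases "x = 0")
  case True
  thus ?thesis using bd[OF \<open>x \<in> S\<close>] by simp
next
  case False
  have "norm (f y) / norm y \<le> max K 0" if "y \<in> S" for y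
  proof -
    have "norm (f y) \<le> max K 0 * norm y"
      using bd[OF that] mult_right_mono[of K "max K 0" "norm y"] by simp
    thus ?thesis by (cases "y = 0") (auto simp: divide_simps)
  qed
  hence "bdd_above ((\<lambda>x. norm (f x) / norm x) ` S)"
    by (auto intro!: bdd_aboveI[of _ "max K 0"])
  hence "norm (f x) / norm x \<le> onorm_on S f"
    unfolding onorm_on_def by (rule cSUP_upper2[OF _ \<open>x \<in> S\<close>]) simp
  thus ?thesis using False by (simp add: divide_simps)
qed

text \<open>
  Collecting the two feedback terms into one symmetric matrix turns the Riccati map into
  \<open>P A + A\<^sup>T P + A1\<^sup>T P A1 + P G P + Q\<close>, a polynomial of degree two whose derivative along \<open>\<Delta>\<close> is
  the Lyapunov operator of the closed loop \<open>A + G P\<close>.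
\<close>

definition feedback_weight ::
    "real^'m^'n \<Rightarrow> real^'p^'n \<Rightarrow> real^'m^'m \<Rightarrow> real \<Rightarrow> real^'n^'n" where
  "feedback_weight B E R \<gamma> = (1 / \<gamma>\<^sup>2) *\<^sub>R (E ** transpose E) - B ** matrix_inv R ** transpose B"

lemma riccati_feedback_weight:
  "riccati A A1 B E Q R \<gamma> P = P ** A + transpose A ** P + transpose A1 ** P ** A1
     + P ** feedback_weight B E R \<gamma> ** P + Q"
  unfolding riccati_def feedback_weight_def by (simp add: matrix_ring)

lemma closed_loop_feedback_weight:
  "closed_loop A B E R \<gamma> P = A + feedback_weight B E R \<gamma> ** P"
  unfolding closed_loop_def feedback_weight_def by (simp add: matrix_ring)

lemma linear_riccati_deriv: "linear (riccati_deriv A A1 B E R \<gamma> P)"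
  unfolding riccati_deriv_def
  by (rule linearI) (simp_all add: matrix_ring scaleR_add_right)

lemma riccati_deriv_sym:
  "X \<in> sym_mats \<Longrightarrow> riccati_deriv A A1 B E R \<gamma> P X \<in> sym_mats"
  unfolding riccati_deriv_def sym_mats_def by (simp add: matrix_ring add_ac)

text \<open>
  The hypotheses of the Newton-Kantorovich theorem for the Riccati map, at a known solution \<open>Ps\<close>.
\<close>

locale riccati_newton =
  fixes A A1 Q Ps :: "real^('n::{finite,linorder})^('n::{finite,linorder})" and B :: "real^'m^('n::{finite,linorder})" and E :: "real^'p^('n::{finite,linorder})"
    and R :: "real^'m^'m" and \<gamma> c0 a0 :: real
  assumes R_inv_sym: "transpose (matrix_inv R) = matrix_inv R"
    and Q_sym: "Q \<in> sym_mats"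
    and Ps: "Ps \<in> sym_mats" "riccati A A1 B E Q R \<gamma> Ps = 0"
    and c0: "0 < c0" "deriv_lipschitz A A1 B E R \<gamma> c0"
    and a0: "0 < a0" "deriv_inverse_bound A A1 B E R \<gamma> Ps a0"
begin

abbreviation "G \<equiv> feedback_weight B E R \<gamma>"
abbreviation "DF \<equiv> riccati_deriv A A1 B E R \<gamma>"
abbreviation "Ric \<equiv> riccati A A1 B E Q R \<gamma>"

lemma G_sym: "transpose G = G"
  unfolding feedback_weight_def by (simp add: matrix_ring R_inv_sym)

lemma DF_eq:
  assumes "P \<in> sym_mats"
  shows "DF P X = X ** A + transpose A ** X + X ** G ** P + P ** G ** X + transpose A1 ** X ** A1"
  using assms unfolding riccati_deriv_def closed_loop_feedback_weight sym_mats_def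
  by (simp add: matrix_ring G_sym)

lemma Ric_sym: "P \<in> sym_mats \<Longrightarrow> Ric P \<in> sym_mats"
  using Q_sym unfolding riccati_feedback_weight sym_mats_def
  by (simp add: matrix_ring G_sym add_ac)

text \<open>
  The Riccati map is quadratic with second-order part \<open>X G X\<close>, and twice this part is the change of
  the derivative from \<open>0\<close> to \<open>X\<close> applied to \<open>X\<close>; so the Lipschitz constant controls it.
\<close>

lemma norm_quadratic_part:
  assumes X: "X \<in> sym_mats"
  shows "norm (X ** G ** X) \<le> c0 / 2 * (norm X)\<^sup>2"
proof -
  let ?f = "\<lambda>Y. DF X Y - DF 0 Y"
  have z: "0 \<in> sym_mats" by (rule subspace_0[OF subspace_sym_mats])
  have lin: "linear ?f"
    by (intro linear_compose_sub linear_riccati_deriv)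
  have "norm (?f X) \<le> onorm_on sym_mats ?f * norm X"
    using onorm[of ?f] lin by (intro norm_le_onorm_on[OF X]) (auto simp: linear_linear)
  also have "\<dots> \<le> (c0 * norm (X - 0)) * norm X"
    using c0(2) X z unfolding deriv_lipschitz_def by (intro mult_right_mono norm_ge_zero) blast
  also have "?f X = 2 *\<^sub>R (X ** G ** X)"
    by (simp add: DF_eq X z scaleR_2)
  finally show ?thesis by (simp add: power2_eq_square)
qed

lemma norm_DF_diff:
  assumes "P \<in> sym_mats" "P' \<in> sym_mats" "X \<in> sym_mats"
  shows "norm (DF P X - DF P' X) \<le> c0 * norm (P - P') * norm X"
proof -
  let ?f = "\<lambda>Y. DF P Y - DF P' Y"
  have lin: "linear ?f"
    by (intro linear_compose_sub linear_riccati_deriv)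
  have "norm (?f X) \<le> onorm_on sym_mats ?f * norm X"
    using onorm[of ?f] lin by (intro norm_le_onorm_on[OF assms(3)]) (auto simp: linear_linear)
  also have "\<dots> \<le> (c0 * norm (P - P')) * norm X"
    using c0(2) assms unfolding deriv_lipschitz_def by (intro mult_right_mono) auto
  finally show ?thesis .
qed

text \<open>
  On the finite-dimensional space of symmetric matrices the injective derivative is bounded below, so
  its inverse is bounded and \<open>a0\<close> bounds it.
\<close>

lemma norm_le_DF_Ps:
  assumes X: "X \<in> sym_mats"
  shows "norm X \<le> a0 * norm (DF Ps X)"
proof -
  let ?g = "the_inv_into sym_mats (DF Ps)"
  have bij: "bij_betw (DF Ps) sym_mats sym_mats" and le: "onorm_on sym_mats ?g \<le> a0"
    using a0(2) unfolding deriv_inverse_bound_def by auto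
  have inj: "inj_on (DF Ps) sym_mats" using bij by (rule bij_betw_imp_inj_on)
  have "\<forall>x\<in>sym_mats. DF Ps x = 0 \<longrightarrow> x = 0"
    using inj linear_injective_on_subspace_0[OF linear_riccati_deriv subspace_sym_mats] by blast
  then obtain e where e: "e > 0" "\<And>x. x \<in> sym_mats \<Longrightarrow> norm (DF Ps x) \<ge> e * norm x"
    using injective_imp_isometric[of sym_mats "DF Ps"] subspace_sym_mats closed_subspace[OF subspace_sym_mats]
      linear_riccati_deriv[of A A1 B E R \<gamma> Ps] by (auto simp: linear_linear)
  have "norm (?g y) \<le> (1 / e) * norm y" if "y \<in> sym_mats" for y
  proof -
    have "?g y \<in> sym_mats" "DF Ps (?g y) = y"
      using that bij the_inv_into_into[OF inj, of y sym_mats] f_the_inv_into_f_bij_betw[OF bij]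
      by (auto simp: bij_betw_def)
    thus ?thesis using e(2)[of "?g y"] e(1) by (simp add: field_simps)
  qed
  hence "norm (?g (DF Ps X)) \<le> onorm_on sym_mats ?g * norm (DF Ps X)"
    by (intro norm_le_onorm_on riccati_deriv_sym X)
  also have "\<dots> \<le> a0 * norm (DF Ps X)"
    using le by (rule mult_right_mono) simp
  finally show ?thesis using the_inv_into_f_f[OF inj X] by simp
qed

text \<open>
  The derivative at \<open>P\<close> differs from the one at the solution by at most \<open>c0 \<parallel>P - Ps\<parallel>\<close>, which is
  smaller than \<open>1 / a0\<close>; a perturbation of that size cannot destroy invertibility.
\<close>

lemma newton_step_exists:
  assumes P: "P \<in> sym_mats" and near: "a0 * (c0 * norm (P - Ps)) < 1" and Y: "Y \<in> sym_mats"
  shows "\<exists>X\<in>sym_mats. DF P X = Y"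
proof -
  have "x = 0" if x: "x \<in> sym_mats" "DF P x = 0" for x
  proof -
    have "norm x \<le> a0 * norm (DF Ps x - DF P x)"
      using norm_le_DF_Ps[OF x(1)] x(2) by simp
    also have "\<dots> \<le> a0 * (c0 * norm (Ps - P) * norm x)"
      using norm_DF_diff[OF Ps(1) P x(1)] a0(1) by simp
    finally have "(1 - a0 * (c0 * norm (P - Ps))) * norm x \<le> 0"
      by (simp add: algebra_simps norm_minus_commute)
    thus ?thesis using near by (simp add: mult_le_0_iff)
  qed
  hence inj: "inj_on (DF P) sym_mats"
    using linear_injective_on_subspace_0[OF linear_riccati_deriv subspace_sym_mats] by blast
  have sub: "DF P ` sym_mats \<subseteq> sym_mats" using riccati_deriv_sym by blast
  have "dim (DF P ` sym_mats) = dim (sym_mats :: (real^('n::{finite,linorder})^('n::{finite,linorder})) set)"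
    by (rule dim_image_eq[OF linear_riccati_deriv])
       (use inj in \<open>simp only: span_eq_iff[THEN iffD2, OF subspace_sym_mats]\<close>)
  hence "DF P ` sym_mats = sym_mats"
    by (intro subspace_dim_equal linear_subspace_image[OF linear_riccati_deriv] subspace_sym_mats sub) simp
  thus ?thesis using Y by (metis imageE)
qed

text \<open>
  The constant \<open>(2 - sqrt 2) / (2 c0 a0)\<close> makes \<open>q = a0 c0 \<parallel>P - Ps\<parallel>\<close> at most \<open>1 - 1 / sqrt 2\<close>, so
  that the Newton error factor \<open>q / (2 (1 - q))\<close> is below one half.
\<close>

lemma newton_step_contracts:
  assumes P: "P \<in> sym_mats" and near: "norm (P - Ps) \<le> (2 - sqrt 2) / (2 * c0 * a0)"
    and X: "X \<in> sym_mats" and step: "DF P X = DF P P - Ric P"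
  shows "norm (X - Ps) \<le> norm (P - Ps) / 2"
proof -
  define e where "e = norm (P - Ps)"
  define q where "q = a0 * (c0 * e)"
  define d where "d = norm (X - Ps)"
  have s2: "sqrt 2 \<ge> 4/3" by (rule real_le_rsqrt) (simp add: power2_eq_square)
  have q: "0 \<le> q" "q \<le> 1/3"
  proof -
    show "0 \<le> q" unfolding q_def e_def using a0 c0 by simp
    have "q \<le> a0 * (c0 * ((2 - sqrt 2) / (2 * c0 * a0)))"
      unfolding q_def e_def using near a0 c0 by (intro mult_left_mono) auto
    also have "\<dots> = (2 - sqrt 2) / 2" using a0 c0 by (simp add: field_simps)
    finally show "q \<le> 1/3" using s2 by simp
  qed
  have dif: "X - Ps \<in> sym_mats" "P - Ps \<in> sym_mats"
    using subspace_diff[OF subspace_sym_mats] X P Ps by auto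
  have "DF P (X - Ps) = DF P P - Ric P - DF P Ps"
    using step by (simp add: linear_diff[OF linear_riccati_deriv])
  also have "\<dots> = Ric Ps - Ric P + DF P P - DF P Ps"
    using Ps(2) by simp
  also have "\<dots> = (P - Ps) ** G ** (P - Ps)"
    unfolding DF_eq[OF P] unfolding riccati_feedback_weight by (simp add: matrix_ring)
  finally have remainder: "DF P (X - Ps) = (P - Ps) ** G ** (P - Ps)" .
  have "d \<le> a0 * norm (DF Ps (X - Ps))"
    unfolding d_def by (rule norm_le_DF_Ps[OF dif(1)])
  also have "\<dots> \<le> a0 * (norm (DF P (X - Ps)) + norm (DF Ps (X - Ps) - DF P (X - Ps)))"
    using a0(1) norm_triangle_sub by (intro mult_left_mono) (auto simp: add.commute)
  also have "\<dots> \<le> a0 * (c0 / 2 * e\<^sup>2 + c0 * e * d)"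
    using norm_quadratic_part[OF dif(2)] norm_DF_diff[OF Ps(1) P dif(1)] a0(1) remainder
    unfolding e_def d_def by (intro mult_left_mono add_mono) (auto simp: norm_minus_commute)
  also have "\<dots> = q * e / 2 + q * d"
    unfolding q_def by (simp add: power2_eq_square algebra_simps)
  finally have "(1 - q) * d \<le> q * e / 2" by (simp add: algebra_simps)
  moreover have "2/3 * d \<le> (1 - q) * d" using q d_def by (intro mult_right_mono) auto
  moreover have "q * e / 2 \<le> 1/3 * e / 2" using q e_def by (intro divide_right_mono mult_right_mono) auto
  moreover have "0 \<le> e" unfolding e_def by simp
  ultimately have "d \<le> e / 2" by linarith
  thus ?thesis unfolding d_def e_def .
qed

end

section \<open>The least-squares problem\<close>

text \<open>
  If the system has any exact solution, the least residual is zero and every minimizer is exact.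
\<close>

lemma least_squares_solution_exact:
  assumes ls: "least_squares_solution s \<Phi> \<Upsilon> \<xi>"
    and exact: "\<And>j. j \<in> {1..s} \<Longrightarrow> \<Phi> j \<bullet> \<eta> = \<Upsilon> j" and j: "j \<in> {1..s}"
  shows "\<Phi> j \<bullet> \<xi> = \<Upsilon> j"
proof -
  have "(\<Sum>j=1..s. (\<Phi> j \<bullet> \<xi> - \<Upsilon> j)\<^sup>2) \<le> (\<Sum>j=1..s. (\<Phi> j \<bullet> \<eta> - \<Upsilon> j)\<^sup>2)"
    using ls unfolding least_squares_solution_def by blast
  also have "\<dots> = 0" using exact by simp
  finally have "(\<Sum>j=1..s. (\<Phi> j \<bullet> \<xi> - \<Upsilon> j)\<^sup>2) = 0"
    by (intro antisym sum_nonneg) auto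
  thus ?thesis using j by (subst (asm) sum_nonneg_eq_0_iff) auto
qed

text \<open>
  Rows of full rank span the whole space, so only the zero vector is orthogonal to all of them.
\<close>

lemma full_row_rank_orthogonal:
  fixes X :: "nat \<Rightarrow> real^'c"
  assumes rank: "row_data_rank s X = CARD('c)" and orth: "\<And>j. j \<in> {1..s} \<Longrightarrow> X j \<bullet> \<xi> = 0"
  shows "\<xi> = 0"
proof -
  have "span (X ` {1..s}) = UNIV"
    using rank unfolding row_data_rank_def by (intro dim_eq_full[THEN iffD1]) simp
  moreover have "orthogonal \<xi> y" if "y \<in> span (X ` {1..s})" for y
    by (rule orthogonal_to_span[OF that]) (use orth in \<open>auto simp: orthogonal_def inner_commute\<close>)
  ultimately show ?thesis by (metis UNIV_I orthogonal_self)
qed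

lemma vec_mat_eq_0_iff: "vec_mat X = 0 \<longleftrightarrow> X = 0"
  using inner_vec_mat[of X X] by (metis inner_eq_zero_iff)

lemma vecs_eq_0_iff: "H \<in> sym_mats \<Longrightarrow> vecs H = 0 \<longleftrightarrow> H = 0"
  using inner_vecs[of H H] by (metis inner_eq_zero_iff)

lemma block3_eq_0_iff: "block3 a b c = 0 \<longleftrightarrow> a = 0 \<and> b = 0 \<and> c = 0"
proof -
  have "block3 a b c = 0 \<longleftrightarrow> a \<bullet> a + b \<bullet> b + c \<bullet> c = 0"
    using inner_block3[of a b c a b c] by (metis inner_eq_zero_iff)
  also have "\<dots> \<longleftrightarrow> a = 0 \<and> b = 0 \<and> c = 0"
    by (metis add_nonneg_eq_0_iff add_nonneg_nonneg inner_eq_zero_iff inner_ge_zero)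
  finally show ?thesis .
qed

text \<open>
  The second-moment balance of one data interval: \<open>X\<close>, \<open>U\<close>, \<open>V\<close> stand for the integrals of
  \<open>x x\<^sup>T\<close>, \<open>u x\<^sup>T\<close>, \<open>v x\<^sup>T\<close> over the interval, and the value is the increment of \<open>x x\<^sup>T\<close> that the
  system prescribes, all conditionally expected.
\<close>

definition moment_increment ::
    "real^'n^'n \<Rightarrow> real^'n^'n \<Rightarrow> real^'m^'n \<Rightarrow> real^'p^'n \<Rightarrow>
     real^'n^'n \<Rightarrow> real^'n^'m \<Rightarrow> real^'n^'p \<Rightarrow> real^'n^'n" where
  "moment_increment A A1 B E X U V =
     (A ** X + B ** U + E ** V) + transpose (A ** X + B ** U + E ** V)
     + A1 ** X ** transpose A1"

lemma moment_increment_sym: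
  "X \<in> sym_mats \<Longrightarrow> moment_increment A A1 B E X U V \<in> sym_mats"
  unfolding moment_increment_def sym_mats_def by (simp add: matrix_ring add_ac)

lemma inner_sym_mult_transpose:
  assumes "X \<in> sym_mats"
  shows "X \<bullet> (transpose Y) = X \<bullet> Y"
  using assms inner_transpose[of X Y] unfolding sym_mats_def by simp

text \<open>
  The adjoint of the moment balance is the Lyapunov operator of the uncontrolled system together with
  the two gain maps \<open>B\<^sup>T T\<close> and \<open>E\<^sup>T T\<close>.
\<close>

lemma inner_moment_increment:
  assumes X: "X \<in> sym_mats" and T: "T \<in> sym_mats"
  shows "moment_increment A A1 B E X U V \<bullet> T
       = X \<bullet> (T ** A + transpose A ** T + transpose A1 ** T ** A1)
         + 2 * (U \<bullet> (transpose B ** T)) + 2 * (V \<bullet> (transpose E ** T))"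
proof -
  have tr: "transpose Y \<bullet> T = Y \<bullet> T" for Y
    using inner_sym_mult_transpose[OF T, of Y] by (simp add: inner_commute)
  have TA: "X \<bullet> (T ** A) = X \<bullet> (transpose A ** T)"
    using inner_sym_mult_transpose[OF X, of "T ** A"] T
    unfolding sym_mats_def by (simp add: matrix_transpose_mul)
  have "moment_increment A A1 B E X U V \<bullet> T
      = 2 * ((A ** X + B ** U + E ** V) \<bullet> T) + (A1 ** X ** transpose A1) \<bullet> T"
    unfolding moment_increment_def inner_add_left tr by (simp add: inner_add_left)
  also have "(A1 ** X ** transpose A1) \<bullet> T = X \<bullet> (transpose A1 ** T ** A1)"
    unfolding inner_matrix_mult_right[of "A1 ** X"] inner_matrix_mult_left[of A1 X]
    by (simp add: matrix_mul_assoc)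
  finally show ?thesis
    using TA by (simp add: inner_add_left inner_add_right inner_matrix_mult_left)
qed

context riccati_newton
begin

text \<open>
  The second-moment balance turns the residual of a data row into a functional of the moments
  \<open>X, U, V\<close> alone. Its coefficients do not depend on the row, so under full rank all residuals
  vanish only if the three coefficients do.
\<close>

lemma row_residual:
  fixes L :: "real^('n::{finite,linorder})^'m" and K :: "real^('n::{finite,linorder})^'p"
  assumes X: "X \<in> sym_mats" and T: "T1 \<in> sym_mats" and R_sym: "transpose R = R"
  shows "Phi_row (vecs (moment_increment A A1 B E X U V)) (vec_mat X) (vec_mat U) (vec_mat V) L K
           \<bullet> block3 (vecs T1) (vec_mat T2) (vec_mat T3)
         - Upsilon_entry (vecs X) Q R \<gamma> L K
       = block3 (vecs X) (vec_mat U) (vec_mat V) \<bullet>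
         block3 (vecs (T1 ** A + transpose A ** T1 + transpose A1 ** T1 ** A1
                   - (transpose L ** T2 + transpose T2 ** L)
                   - (transpose K ** T3 + transpose T3 ** K)
                   - (\<gamma>\<^sup>2 *\<^sub>R (transpose K ** K) - Q - transpose L ** R ** L)))
                (vec_mat (2 *\<^sub>R (transpose B ** T1 - T2))) (vec_mat (2 *\<^sub>R (transpose E ** T1 - T3)))"
proof -
  define Y where "Y = \<gamma>\<^sup>2 *\<^sub>R (transpose K ** K) - Q - transpose L ** R ** L"
  define H where "H = T1 ** A + transpose A ** T1 + transpose A1 ** T1 ** A1
                   - (transpose L ** T2 + transpose T2 ** L)
                   - (transpose K ** T3 + transpose T3 ** K) - Y"
  have Y: "Y \<in> sym_mats"
    using Q_sym R_sym unfolding Y_def sym_mats_def by (simp add: matrix_ring)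
  have H: "H \<in> sym_mats"
    using Y T unfolding H_def sym_mats_def by (simp add: matrix_ring add_ac)
  have dbl: "X \<bullet> (transpose N ** Z + transpose Z ** N) = 2 * ((N ** X) \<bullet> Z)"
    for N Z :: "real^('n::{finite,linorder})^'k"
    using inner_sym_mult_transpose[OF X, of "transpose N ** Z"]
    by (simp add: matrix_transpose_mul inner_add_right inner_matrix_mult_left)
  have "Phi_row (vecs (moment_increment A A1 B E X U V)) (vec_mat X) (vec_mat U) (vec_mat V) L K
           \<bullet> block3 (vecs T1) (vec_mat T2) (vec_mat T3) - Upsilon_entry (vecs X) Q R \<gamma> L K
      = moment_increment A A1 B E X U V \<bullet> T1 - 2 * ((L ** X) \<bullet> T2) - 2 * (U \<bullet> T2)
          - 2 * ((K ** X) \<bullet> T3) - 2 * (V \<bullet> T3) - X \<bullet> Y"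
    unfolding Phi_row_def Upsilon_entry_def Y_def[symmetric] inner_block3
    by (simp add: vec_mat_kron inner_vecs[OF X Y] inner_vecs[OF moment_increment_sym[OF X] T]
        inner_diff_left inner_vec_mat)
  also have "\<dots> = X \<bullet> H + U \<bullet> (2 *\<^sub>R (transpose B ** T1 - T2)) + V \<bullet> (2 *\<^sub>R (transpose E ** T1 - T3))"
    unfolding inner_moment_increment[OF X T] H_def dbl[symmetric]
    by (simp add: inner_diff_right inner_add_right algebra_simps)
  finally show ?thesis
    unfolding inner_block3 Y_def[symmetric] H_def[symmetric] inner_vecs[OF X H] inner_vec_mat .
qed

text \<open>
  With the gains of \<open>P\<close> and the consistent choice \<open>\<Theta>2 = B\<^sup>T T\<close>, \<open>\<Theta>3 = E\<^sup>T T\<close>, the first residual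
  coefficient is the defect of \<open>T\<close> in the Newton equation at \<open>P\<close>. The cross terms
  \<open>L\<^sup>T B\<^sup>T T\<close> and \<open>K\<^sup>T E\<^sup>T T\<close> turn the uncontrolled Lyapunov operator into the closed-loop one.
\<close>

lemma newton_equation_residual:
  assumes P: "P \<in> sym_mats" and T: "T \<in> sym_mats" and R_inv: "matrix_inv R ** R = mat 1"
    and L: "L = matrix_inv R ** transpose B ** P" and K: "K = - (1 / \<gamma>\<^sup>2) *\<^sub>R (transpose E ** P)"
    and \<gamma>: "\<gamma> \<noteq> 0"
  shows "T ** A + transpose A ** T + transpose A1 ** T ** A1
           - (transpose L ** (transpose B ** T) + transpose (transpose B ** T) ** L)
           - (transpose K ** (transpose E ** T) + transpose (transpose E ** T) ** K)
           - (\<gamma>\<^sup>2 *\<^sub>R (transpose K ** K) - Q - transpose L ** R ** L)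
         = DF P T - (DF P P - Ric P)"
proof -
  have Tt: "transpose T = T" and Pt: "transpose P = P"
    using P T unfolding sym_mats_def by simp_all
  have LL: "transpose L ** R ** L = P ** B ** matrix_inv R ** transpose B ** P"
  proof -
    have "transpose L ** R ** L = P ** B ** (matrix_inv R ** R) ** matrix_inv R ** transpose B ** P"
      unfolding L by (simp add: matrix_transpose_mul matrix_mul_assoc R_inv_sym Pt)
    thus ?thesis unfolding R_inv by simp
  qed
  have KK: "\<gamma>\<^sup>2 *\<^sub>R (transpose K ** K) = (1 / \<gamma>\<^sup>2) *\<^sub>R (P ** E ** transpose E ** P)"
    using \<gamma> unfolding K by (simp add: matrix_ring Pt power2_eq_square)
  show ?thesis
    unfolding DF_eq[OF P] LL KK riccati_feedback_weight unfolding L K feedback_weight_def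
    by (simp add: matrix_ring Pt Tt R_inv_sym)
qed

text \<open>
  A Newton step exists and, together with its gains, solves the row equations exactly, so the
  least-squares problem has residual zero. Every exact solution has vanishing residual
  coefficients, which make the gains consistent with \<open>\<Theta>1\<close> and \<open>\<Theta>1\<close> the Newton step from \<open>P i\<close>.
\<close>

theorem off_policy_iterates_converge:
  fixes X :: "nat \<Rightarrow> real^('n::{finite,linorder})^('n::{finite,linorder})"
    and U :: "nat \<Rightarrow> real^('n::{finite,linorder})^'m" and V :: "nat \<Rightarrow> real^('n::{finite,linorder})^'p"
    and P :: "nat \<Rightarrow> real^('n::{finite,linorder})^('n::{finite,linorder})"
    and L :: "nat \<Rightarrow> real^('n::{finite,linorder})^'m" and F :: "nat \<Rightarrow> real^('n::{finite,linorder})^'p"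
  assumes R_inv: "matrix_inv R ** R = mat 1" and R_sym: "transpose R = R" and \<gamma>: "\<gamma> \<noteq> 0"
    and X: "\<And>j. j \<in> {1..s} \<Longrightarrow> X j \<in> sym_mats"
    and ixt: "\<And>j. j \<in> {1..s} \<Longrightarrow> ixt j = vecs (X j)"
    and ixx: "\<And>j. j \<in> {1..s} \<Longrightarrow> ixx j = vec_mat (X j)"
    and ixu: "\<And>j. j \<in> {1..s} \<Longrightarrow> ixu j = vec_mat (U j)"
    and ixv: "\<And>j. j \<in> {1..s} \<Longrightarrow> ixv j = vec_mat (V j)"
    and dx: "\<And>j. j \<in> {1..s} \<Longrightarrow> dx j = vecs (moment_increment A A1 B E (X j) (U j) (V j))"
    and rank: "row_data_rank s (\<lambda>j. block3 (ixt j) (ixu j) (ixv j))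
          = CARD('n) * (CARD('n) + 1) div 2 + CARD('n) * CARD('m) + CARD('n) * CARD('p)"
    and P0: "P0 \<in> sym_mats" "norm (P0 - Ps) \<le> (2 - sqrt 2) / (2 * c0 * a0)"
    and alg: "off_policy_iterates s dx ixt ixx ixu ixv B E Q R \<gamma> P0 P L F"
  shows "P \<longlonglongrightarrow> Ps"
proof -
  let ?r = "(2 - sqrt 2) / (2 * c0 * a0)"
  have close: "a0 * (c0 * norm (N - Ps)) < 1" if "norm (N - Ps) \<le> ?r" for N
  proof -
    have "a0 * (c0 * norm (N - Ps)) \<le> a0 * (c0 * ?r)"
      using that a0 c0 by (intro mult_left_mono) auto
    also have "\<dots> = (2 - sqrt 2) / 2" using a0 c0 by (simp add: field_simps)
    also have "\<dots> < 1" by simp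
    finally show ?thesis .
  qed
  have rank': "row_data_rank s (\<lambda>j. block3 (ixt j) (ixu j) (ixv j))
      = CARD('n upper_pair + ('n \<times> 'm + 'n \<times> 'p))"
    unfolding rank by (simp add: CARD_upper_pair)
  let ?inv = "\<lambda>i. P i \<in> sym_mats \<and> L i = matrix_inv R ** transpose B ** P i
      \<and> F i = - (1 / \<gamma>\<^sup>2) *\<^sub>R (transpose E ** P i) \<and> norm (P i - Ps) \<le> ?r * (1/2) ^ i"
  have r: "?r \<ge> 0"
    using order_trans[OF norm_ge_zero P0(2)] .
  have "?inv i" for i
  proof (induction i)
    case 0
    show ?case using alg P0 unfolding off_policy_iterates_def by auto
  next
    case (Suc i)
    have Pi: "P i \<in> sym_mats" and Li: "L i = matrix_inv R ** transpose B ** P i"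
      and Fi: "F i = - (1 / \<gamma>\<^sup>2) *\<^sub>R (transpose E ** P i)" and ni: "norm (P i - Ps) \<le> ?r * (1/2) ^ i"
      using Suc.IH by auto
    have "?r * (1/2) ^ i \<le> ?r * 1" by (rule mult_left_mono[OF power_le_one r]) auto
    with ni have near: "norm (P i - Ps) \<le> ?r" by linarith
    obtain T1 T2 T3 where T1: "T1 \<in> sym_mats"
      and ls: "least_squares_solution s (\<lambda>j. Phi_row (dx j) (ixx j) (ixu j) (ixv j) (L i) (F i))
          (\<lambda>j. Upsilon_entry (ixt j) Q R \<gamma> (L i) (F i)) (block3 (vecs T1) (vec_mat T2) (vec_mat T3))"
      and upd: "P (Suc i) = T1" "L (Suc i) = matrix_inv R ** T2" "F (Suc i) = - (1 / \<gamma>\<^sup>2) *\<^sub>R T3"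
      using alg unfolding off_policy_iterates_def by blast
    define H where "H = (\<lambda>T1 T2 T3. T1 ** A + transpose A ** T1 + transpose A1 ** T1 ** A1
                   - (transpose (L i) ** T2 + transpose T2 ** (L i))
                   - (transpose (F i) ** T3 + transpose T3 ** (F i))
                   - (\<gamma>\<^sup>2 *\<^sub>R (transpose (F i) ** (F i)) - Q - transpose (L i) ** R ** (L i)))"
    have H_newton: "H T (transpose B ** T) (transpose E ** T) = DF (P i) T - (DF (P i) (P i) - Ric (P i))"
      if "T \<in> sym_mats" for T
      using newton_equation_residual[OF Pi that R_inv Li Fi \<gamma>] unfolding H_def .
    have H_sym: "H T1 T2 T3 \<in> sym_mats"
      using T1 Q_sym R_sym unfolding H_def sym_mats_def by (simp add: matrix_ring add_ac)
    have residual: "Phi_row (dx j) (ixx j) (ixu j) (ixv j) (L i) (F i)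
           \<bullet> block3 (vecs T1) (vec_mat T2) (vec_mat T3) - Upsilon_entry (ixt j) Q R \<gamma> (L i) (F i)
         = block3 (ixt j) (ixu j) (ixv j) \<bullet> block3 (vecs (H T1 T2 T3))
             (vec_mat (2 *\<^sub>R (transpose B ** T1 - T2))) (vec_mat (2 *\<^sub>R (transpose E ** T1 - T3)))"
      if "j \<in> {1..s}" "T1 \<in> sym_mats" for j T1 T2 T3
      unfolding ixt[OF that(1)] ixx[OF that(1)] ixu[OF that(1)] ixv[OF that(1)] dx[OF that(1)] H_def
      by (rule row_residual[OF X[OF that(1)] that(2) R_sym])
    (* The Newton step N is an exact solution, so the least-squares residual is zero. *)
    obtain N where N: "N \<in> sym_mats" "DF (P i) N = DF (P i) (P i) - Ric (P i)"
      using newton_step_exists[OF Pi close[OF near], of "DF (P i) (P i) - Ric (P i)"]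
        subspace_diff[OF subspace_sym_mats riccati_deriv_sym[OF Pi] Ric_sym[OF Pi]] by blast
    have exact: "Phi_row (dx j) (ixx j) (ixu j) (ixv j) (L i) (F i)
           \<bullet> block3 (vecs N) (vec_mat (transpose B ** N)) (vec_mat (transpose E ** N))
         = Upsilon_entry (ixt j) Q R \<gamma> (L i) (F i)" if j: "j \<in> {1..s}" for j
    proof -
      have "H N (transpose B ** N) (transpose E ** N) = 0"
        using H_newton[OF N(1)] N(2) by simp
      hence "block3 (vecs (H N (transpose B ** N) (transpose E ** N)))
          (vec_mat (2 *\<^sub>R (transpose B ** N - transpose B ** N)))
          (vec_mat (2 *\<^sub>R (transpose E ** N - transpose E ** N))) = 0"
        using vecs_eq_0_iff[OF subspace_0[OF subspace_sym_mats]] by (simp add: block3_eq_0_iff vec_mat_eq_0_iff)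
      thus ?thesis
        using residual[OF j N(1), of "transpose B ** N" "transpose E ** N"] by simp
    qed
    have "block3 (ixt j) (ixu j) (ixv j) \<bullet> block3 (vecs (H T1 T2 T3))
             (vec_mat (2 *\<^sub>R (transpose B ** T1 - T2))) (vec_mat (2 *\<^sub>R (transpose E ** T1 - T3))) = 0"
      if "j \<in> {1..s}" for j
      using least_squares_solution_exact[OF ls exact that] residual[OF that T1, of T2 T3] by simp
    hence "block3 (vecs (H T1 T2 T3)) (vec_mat (2 *\<^sub>R (transpose B ** T1 - T2)))
             (vec_mat (2 *\<^sub>R (transpose E ** T1 - T3))) = 0"
      by (rule full_row_rank_orthogonal[OF rank'])
    hence z: "H T1 T2 T3 = 0" "T2 = transpose B ** T1" "T3 = transpose E ** T1"
      using vecs_eq_0_iff[OF H_sym] by (auto simp: block3_eq_0_iff vec_mat_eq_0_iff)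
    hence "DF (P i) T1 = DF (P i) (P i) - Ric (P i)"
      using H_newton[OF T1] by simp
    hence "norm (T1 - Ps) \<le> norm (P i - Ps) / 2"
      by (rule newton_step_contracts[OF Pi near T1])
    hence "norm (T1 - Ps) \<le> ?r * (1/2) ^ Suc i" using ni by simp
    thus ?case using upd z T1 by (simp add: matrix_mul_assoc)
  qed
  hence bound: "norm (P i - Ps) \<le> ?r * (1/2) ^ i" for i by blast
  have "(\<lambda>i. ?r * (1/2) ^ i) \<longlonglongrightarrow> ?r * 0"
    by (intro tendsto_mult_left LIMSEQ_power_zero) simp
  hence "(\<lambda>i. P i - Ps) \<longlonglongrightarrow> 0"
    by (intro Lim_null_comparison[of "\<lambda>i. P i - Ps" "\<lambda>i. ?r * (1/2) ^ i"]) (use bound in auto)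
  thus ?thesis by (simp add: LIM_zero_iff)
qed

end

text \<open>
  Full column rank makes \<open>D\<close> injective, and \<open>x \<bullet> D\<^sup>T D x\<close> is the squared length of \<open>D x\<close>.
\<close>

lemma gram_matrix_inverse:
  fixes D :: "real^'m^'r"
  assumes D: "rank D = CARD('m)" and R: "R = transpose D ** D"
  shows "matrix_inv R ** R = mat 1" "transpose R = R" "transpose (matrix_inv R) = matrix_inv R"
proof -
  have ker: "x = 0" if "R *v x = 0" for x
  proof -
    have "(D *v x) \<bullet> (D *v x) = x \<bullet> (R *v x)"
      using dot_lmul_matrix[of "D *v x" D x] unfolding R
      by (simp add: matrix_vector_mul_assoc[symmetric] inner_commute)
    hence "D *v x = D *v 0" using that by simp
    moreover have "inj ((*v) D)" using D full_rank_injective by blast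
    ultimately show ?thesis by (metis injD)
  qed
  have "invertible R"
    using ker by (metis invertible_left_inverse matrix_left_invertible_ker)
  hence inv: "matrix_inv R ** R = mat 1" "R ** matrix_inv R = mat 1"
    unfolding invertible_def matrix_inv_def by (metis (mono_tags, lifting) someI_ex)+
  show "matrix_inv R ** R = mat 1" by (rule inv)
  show sym: "transpose R = R" unfolding R by (simp add: matrix_transpose_mul)
  have "transpose (matrix_inv R) = transpose (matrix_inv R) ** (R ** matrix_inv R)"
    unfolding inv by simp
  also have "\<dots> = transpose (R ** matrix_inv R) ** matrix_inv R"
    by (simp add: matrix_transpose_mul sym matrix_mul_assoc)
  also have "\<dots> = matrix_inv R" unfolding inv by simp
  finally show "transpose (matrix_inv R) = matrix_inv R" .
qed

section \<open>Mean square convergence\<close>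

definition sq_int :: "'a measure \<Rightarrow> ('a \<Rightarrow> real) \<Rightarrow> bool" where
  "sq_int M f \<longleftrightarrow> f \<in> borel_measurable M \<and> integrable M (\<lambda>x. (f x)\<^sup>2)"

lemma sq_int_mult_integrable:
  assumes f: "sq_int M f" and g: "sq_int M g"
  shows "integrable M (\<lambda>x. f x * g x)"
proof (rule Bochner_Integration.integrable_bound)
  show "integrable M (\<lambda>x. (f x)\<^sup>2 + (g x)\<^sup>2)"
    using f g by (simp add: sq_int_def)
  show "(\<lambda>x. f x * g x) \<in> borel_measurable M"
    using f g unfolding sq_int_def by (intro borel_measurable_times) auto
  have "\<bar>a * b\<bar> \<le> a\<^sup>2 + b\<^sup>2" for a b :: real
    using sum_squares_bound[of "\<bar>a\<bar>" "\<bar>b\<bar>"] mult_nonneg_nonneg[OF abs_ge_zero[of a] abs_ge_zero[of b]]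
    unfolding abs_mult power2_abs by linarith
  thus "AE x in M. norm (f x * g x) \<le> norm ((f x)\<^sup>2 + (g x)\<^sup>2)" by simp
qed

lemma sq_int_add:
  assumes f: "sq_int M f" and g: "sq_int M g"
  shows "sq_int M (\<lambda>x. f x + g x)"
proof -
  have "(\<lambda>x. (f x + g x)\<^sup>2) = (\<lambda>x. (f x)\<^sup>2 + (g x)\<^sup>2 + 2 * (f x * g x))"
    by (simp add: fun_eq_iff power2_sum)
  thus ?thesis
    using f g sq_int_mult_integrable[OF f g] by (auto simp: sq_int_def intro!: borel_measurable_add)
qed

lemma sq_int_cmult: "sq_int M f \<Longrightarrow> sq_int M (\<lambda>x. c * f x)"
  by (auto simp: sq_int_def power_mult_distrib intro!: borel_measurable_times)

lemma sq_int_diff: "sq_int M f \<Longrightarrow> sq_int M g \<Longrightarrow> sq_int M (\<lambda>x. f x - g x)"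
  using sq_int_add[of M f "\<lambda>x. -1 * g x"] sq_int_cmult[of M g "-1"] by simp

lemma sq_int_zero: "sq_int M (\<lambda>x. 0)"
  by (simp add: sq_int_def)

lemma sq_int_dominated:
  assumes f: "sq_int M f" and g: "g \<in> borel_measurable M" and le: "AE x in M. \<bar>g x\<bar> \<le> \<bar>f x\<bar>"
  shows "sq_int M g"
  unfolding sq_int_def
proof
  show "integrable M (\<lambda>x. (g x)\<^sup>2)"
  proof (rule Bochner_Integration.integrable_bound)
    show "integrable M (\<lambda>x. (f x)\<^sup>2)" using f by (simp add: sq_int_def)
    show "AE x in M. norm ((g x)\<^sup>2) \<le> norm ((f x)\<^sup>2)"
      using le by eventually_elim (simp add: abs_le_square_iff)
  qed (use g in simp)
qed fact

lemma (in finite_measure) sq_int_bounded: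
  assumes "f \<in> borel_measurable M" and bd: "\<And>x. x \<in> space M \<Longrightarrow> \<bar>f x\<bar> \<le> K"
  shows "sq_int M f"
proof (rule sq_int_dominated)
  show "sq_int M (\<lambda>x. K)" by (simp add: sq_int_def)
  show "AE x in M. \<bar>f x\<bar> \<le> \<bar>K\<bar>" using bd by (intro AE_I2) force
qed fact

lemma (in finite_measure) sq_int_integrable: "sq_int M f \<Longrightarrow> integrable M f"
  by (auto simp: sq_int_def intro: square_integrable_imp_integrable)

lemma L2_Cauchy_Schwarz:
  assumes f: "sq_int M f" and g: "sq_int M g"
  shows "\<bar>\<integral>x. f x * g x \<partial>M\<bar> \<le> sqrt (\<integral>x. (f x)\<^sup>2 \<partial>M) * sqrt (\<integral>x. (g x)\<^sup>2 \<partial>M)"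
proof -
  define a where "a = (\<integral>x. (f x)\<^sup>2 \<partial>M)"
  define b where "b = (\<integral>x. f x * g x \<partial>M)"
  define c where "c = (\<integral>x. (g x)\<^sup>2 \<partial>M)"
  have quad: "0 \<le> a - 2 * t * b + t\<^sup>2 * c" for t
  proof -
    have "0 \<le> (\<integral>x. (f x - t * g x)\<^sup>2 \<partial>M)" by simp
    also have "(\<lambda>x. (f x - t * g x)\<^sup>2) = (\<lambda>x. (f x)\<^sup>2 - 2 * t * (f x * g x) + t\<^sup>2 * (g x)\<^sup>2)"
      by (simp add: fun_eq_iff power2_eq_square algebra_simps)
    also have "(\<integral>x. (f x)\<^sup>2 - 2 * t * (f x * g x) + t\<^sup>2 * (g x)\<^sup>2 \<partial>M) = a - 2 * t * b + t\<^sup>2 * c"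
      using f g sq_int_mult_integrable[OF f g] unfolding sq_int_def a_def b_def c_def by simp
    finally show ?thesis .
  qed
  have nonneg: "0 \<le> a" "0 \<le> c" by (simp_all add: a_def c_def)
  have "b\<^sup>2 \<le> a * c"
  proof (cases "c = 0")
    case True
    have "b = 0"
      using quad[of "(a + 1) / (2 * b)"] nonneg True by (cases "b = 0") (auto simp: field_simps)
    thus ?thesis using True by simp
  next
    case False
    hence "0 \<le> (a - 2 * (b / c) * b + (b / c)\<^sup>2 * c) * c"
      using quad[of "b / c"] nonneg by (intro mult_nonneg_nonneg) auto
    also have "\<dots> = a * c - b\<^sup>2" using False by (simp add: field_simps power2_eq_square)
    finally show ?thesis by simp
  qed
  hence "\<bar>b\<bar> \<le> sqrt (a * c)" by (simp add: real_le_rsqrt)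
  thus ?thesis unfolding a_def b_def c_def by (simp add: real_sqrt_mult)
qed

text \<open>
  Inner products are continuous under mean square convergence. Applied on the probability space and
  on its product with a time interval, this carries the isometry from elementary integrands to limits.
\<close>

lemma L2_inner_tendsto:
  assumes f: "sq_int M f" "\<And>l. sq_int M (fl l)" "(\<lambda>l. \<integral>x. (f x - fl l x)\<^sup>2 \<partial>M) \<longlonglongrightarrow> 0"
    and g: "sq_int M g" "\<And>l. sq_int M (gl l)" "(\<lambda>l. \<integral>x. (g x - gl l x)\<^sup>2 \<partial>M) \<longlonglongrightarrow> 0"
  shows "(\<lambda>l. \<integral>x. fl l x * gl l x \<partial>M) \<longlonglongrightarrow> (\<integral>x. f x * g x \<partial>M)"
proof -
  let ?n = "\<lambda>h. sqrt (\<integral>x. (h x)\<^sup>2 \<partial>M)"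
  let ?df = "\<lambda>l x. f x - fl l x" and ?dg = "\<lambda>l x. g x - gl l x"
  have d: "sq_int M (?df l)" "sq_int M (?dg l)" for l
    using f g by (auto intro: sq_int_diff)
  have bound: "norm ((\<integral>x. fl l x * gl l x \<partial>M) - (\<integral>x. f x * g x \<partial>M))
      \<le> ?n (?df l) * ?n g + ?n f * ?n (?dg l) + ?n (?df l) * ?n (?dg l)" for l
  proof -
    have "(\<lambda>x. f x * g x) = (\<lambda>x. fl l x * gl l x + ?df l x * g x + f x * ?dg l x - ?df l x * ?dg l x)"
      by (simp add: fun_eq_iff algebra_simps)
    hence "(\<integral>x. f x * g x \<partial>M) = (\<integral>x. fl l x * gl l x + ?df l x * g x + f x * ?dg l x - ?df l x * ?dg l x \<partial>M)"
      by (rule arg_cong)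
    also have "\<dots> = (\<integral>x. fl l x * gl l x \<partial>M) + (\<integral>x. ?df l x * g x \<partial>M)
        + (\<integral>x. f x * ?dg l x \<partial>M) - (\<integral>x. ?df l x * ?dg l x \<partial>M)"
      using sq_int_mult_integrable[OF f(2) g(2), of l l] sq_int_mult_integrable[OF d(1) g(1), of l]
        sq_int_mult_integrable[OF f(1) d(2), of l] sq_int_mult_integrable[OF d(1) d(2), of l l]
      by simp
    finally show ?thesis
      using L2_Cauchy_Schwarz[OF d(1) g(1), of l] L2_Cauchy_Schwarz[OF f(1) d(2), of l]
        L2_Cauchy_Schwarz[OF d(1) d(2), of l l]
      by (simp add: abs_le_iff)
  qed
  have lim: "(\<lambda>l. ?n (?df l) * ?n g + ?n f * ?n (?dg l) + ?n (?df l) * ?n (?dg l)) \<longlonglongrightarrow> 0"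
    using tendsto_add[OF tendsto_add[OF tendsto_mult[OF tendsto_real_sqrt[OF f(3)] tendsto_const[of "?n g"]]
        tendsto_mult[OF tendsto_const[of "?n f"] tendsto_real_sqrt[OF g(3)]]]
        tendsto_mult[OF tendsto_real_sqrt[OF f(3)] tendsto_real_sqrt[OF g(3)]]]
    by simp
  have "(\<lambda>l. (\<integral>x. fl l x * gl l x \<partial>M) - (\<integral>x. f x * g x \<partial>M)) \<longlonglongrightarrow> 0"
    by (rule Lim_null_comparison[OF always_eventually lim]) (intro allI bound)
  thus ?thesis by (simp add: LIM_zero_iff)
qed

lemma nn_integral_sq_int:
  assumes "sq_int M f"
  shows "(\<integral>\<^sup>+x. ennreal ((f x)\<^sup>2) \<partial>M) = ennreal (\<integral>x. (f x)\<^sup>2 \<partial>M)"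
  using assms by (intro nn_integral_eq_integral) (auto simp: sq_int_def)

text \<open>
  A mean square limit in the extended sense is itself square integrable, since it is at finite
  distance from a square integrable function.
\<close>

lemma sq_int_limit:
  assumes f[measurable]: "f \<in> borel_measurable M" and fl: "\<And>l. sq_int M (fl l)"
    and lim: "(\<lambda>l. \<integral>\<^sup>+x. ennreal ((f x - fl l x)\<^sup>2) \<partial>M) \<longlonglongrightarrow> 0"
  shows "sq_int M f" "(\<lambda>l. \<integral>x. (f x - fl l x)\<^sup>2 \<partial>M) \<longlonglongrightarrow> 0"
proof -
  have [measurable]: "fl l \<in> borel_measurable M" for l using fl by (simp add: sq_int_def)
  have "\<forall>\<^sub>F l in sequentially. (\<integral>\<^sup>+x. ennreal ((f x - fl l x)\<^sup>2) \<partial>M) < 1"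
    using lim by (rule order_tendstoD) simp
  then obtain l where "(\<integral>\<^sup>+x. ennreal ((f x - fl l x)\<^sup>2) \<partial>M) < 1"
    by (auto simp: eventually_sequentially)
  hence "sq_int M (\<lambda>x. f x - fl l x)"
    by (auto simp: sq_int_def integrable_iff_bounded intro: less_trans)
  from sq_int_add[OF this fl[of l]] show 1: "sq_int M f" by simp
  have "(\<lambda>l. ennreal (\<integral>x. (f x - fl l x)\<^sup>2 \<partial>M)) \<longlonglongrightarrow> ennreal 0"
    using lim nn_integral_sq_int[OF sq_int_diff[OF 1 fl]] by simp
  thus "(\<lambda>l. \<integral>x. (f x - fl l x)\<^sup>2 \<partial>M) \<longlonglongrightarrow> 0"
    by (subst (asm) tendsto_ennreal_iff) auto
qed

lemma L2_sum_tendsto_0: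
  assumes a: "\<And>l. sq_int M (a l)" "(\<lambda>l. \<integral>x. (a l x)\<^sup>2 \<partial>M) \<longlonglongrightarrow> 0"
    and b: "\<And>l. sq_int M (b l)" "(\<lambda>l. \<integral>x. (b l x)\<^sup>2 \<partial>M) \<longlonglongrightarrow> 0"
  shows "(\<lambda>l. \<integral>x. (a l x + b l x)\<^sup>2 \<partial>M) \<longlonglongrightarrow> 0"
proof (rule Lim_null_comparison[OF always_eventually])
  show "\<forall>l. norm (\<integral>x. (a l x + b l x)\<^sup>2 \<partial>M) \<le> 2 * (\<integral>x. (a l x)\<^sup>2 \<partial>M) + 2 * (\<integral>x. (b l x)\<^sup>2 \<partial>M)"
  proof
    fix l
    have "norm (\<integral>x. (a l x + b l x)\<^sup>2 \<partial>M) = (\<integral>x. (a l x + b l x)\<^sup>2 \<partial>M)" by simp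
    also have "\<dots> \<le> (\<integral>x. 2 * (a l x)\<^sup>2 + 2 * (b l x)\<^sup>2 \<partial>M)"
    proof (rule integral_mono)
      fix x
      have "0 \<le> (a l x - b l x)\<^sup>2" by simp
      thus "(a l x + b l x)\<^sup>2 \<le> 2 * (a l x)\<^sup>2 + 2 * (b l x)\<^sup>2"
        by (simp add: power2_sum power2_diff)
    qed (use sq_int_add[OF a(1) b(1), of l l] a(1)[of l] b(1)[of l] in \<open>simp_all add: sq_int_def\<close>)
    also have "\<dots> = 2 * (\<integral>x. (a l x)\<^sup>2 \<partial>M) + 2 * (\<integral>x. (b l x)\<^sup>2 \<partial>M)"
      using a(1)[of l] b(1)[of l] by (simp add: sq_int_def)
    finally show "norm (\<integral>x. (a l x + b l x)\<^sup>2 \<partial>M) \<le> \<dots>" .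
  qed
  show "(\<lambda>l. 2 * (\<integral>x. (a l x)\<^sup>2 \<partial>M) + 2 * (\<integral>x. (b l x)\<^sup>2 \<partial>M)) \<longlonglongrightarrow> 0"
    using tendsto_add[OF tendsto_mult[OF tendsto_const[of 2] a(2)] tendsto_mult[OF tendsto_const[of 2] b(2)]]
    by simp
qed

section \<open>Brownian increments\<close>

abbreviation time_window :: "real \<Rightarrow> real measure" where
  "time_window T \<equiv> restrict_space lborel {0..T}"

lemma finite_time_window: "finite_measure (time_window T)"
proof
  show "emeasure (time_window T) (space (time_window T)) \<noteq> \<infinity>"
    by (simp add: emeasure_restrict_space emeasure_lborel_Icc_eq space_restrict_space)
qed

locale brownian =
  fixes M :: "'w measure" and W :: "real \<Rightarrow> 'w \<Rightarrow> real"
  assumes bm: "brownian_motion M W"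

sublocale brownian \<subseteq> prob_space M
  using bm by (simp add: brownian_motion_def)

context brownian
begin

abbreviation "FF \<equiv> nat_filt M W"

lemma W_measurable[measurable]: "0 \<le> t \<Longrightarrow> W t \<in> borel_measurable M"
  using bm by (simp add: brownian_motion_def)

lemma space_FF[simp]: "space (FF t) = space M"
  by (simp add: nat_filt_def space_measure_of_conv)

lemma FF_gen: "(\<Union>s\<in>{0..t}. {W s -` U \<inter> space M | U. U \<in> sets borel}) \<subseteq> Pow (space M)"
  by auto

lemma subalgebra_FF: "subalgebra M (FF t)"
proof -
  have "(\<Union>s\<in>{0..t}. {W s -` U \<inter> space M | U. U \<in> sets borel}) \<subseteq> sets M"
    using W_measurable by (auto intro: measurable_sets)
  thus ?thesis
    unfolding subalgebra_def nat_filt_def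
    by (simp add: space_measure_of_conv sets_measure_of_conv FF_gen sets.sigma_sets_subset)
qed

lemma sets_FF_mono: "s \<le> t \<Longrightarrow> sets (FF s) \<subseteq> sets (FF t)"
proof -
  assume st: "s \<le> t"
  let ?G = "\<lambda>t. \<Union>s\<in>{0..t}. {W s -` U \<inter> space M | U. U \<in> sets borel}"
  have "?G s \<subseteq> ?G t" using st by (intro UN_mono) auto
  hence "sigma_sets (space M) (?G s) \<subseteq> sigma_sets (space M) (?G t)" by (rule sigma_sets_mono')
  thus ?thesis unfolding nat_filt_def by (simp only: sets_measure_of[OF FF_gen])
qed

lemma W_FF: "0 \<le> s \<Longrightarrow> s \<le> t \<Longrightarrow> W s \<in> borel_measurable (FF t)"
proof (rule measurableI)
  fix U :: "real set" assume s: "0 \<le> s" "s \<le> t" and U: "U \<in> sets borel"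
  have "W s -` U \<inter> space M \<in> (\<Union>s\<in>{0..t}. {W s -` U \<inter> space M | U. U \<in> sets borel})"
    using s U by (intro UN_I[of s]) auto
  thus "W s -` U \<inter> space (FF t) \<in> sets (FF t)"
    unfolding space_FF unfolding nat_filt_def by (auto simp: sets_measure_of_conv FF_gen)
qed simp

lemma FF_mono_measurable: "f \<in> borel_measurable (FF s) \<Longrightarrow> s \<le> t \<Longrightarrow> f \<in> borel_measurable (FF t)"
  by (rule measurable_from_subalg[of "FF t" "FF s"]) (auto simp: subalgebra_def dest: sets_FF_mono)

lemma FF_M_measurable: "f \<in> borel_measurable (FF s) \<Longrightarrow> f \<in> borel_measurable M"
  by (rule measurable_from_subalg[OF subalgebra_FF])

lemma increment_moments:
  assumes "0 \<le> s" "s \<le> t"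
  shows "integrable M (\<lambda>\<omega>. W t \<omega> - W s \<omega>)" "(\<integral>\<omega>. W t \<omega> - W s \<omega> \<partial>M) = 0"
    "sq_int M (\<lambda>\<omega>. W t \<omega> - W s \<omega>)" "(\<integral>\<omega>. (W t \<omega> - W s \<omega>)\<^sup>2 \<partial>M) = t - s"
proof -
  let ?X = "\<lambda>\<omega>. W t \<omega> - W s \<omega>"
  have all: "integrable M ?X \<and> (\<integral>\<omega>. ?X \<omega> \<partial>M) = 0 \<and> integrable M (\<lambda>\<omega>. (?X \<omega>)\<^sup>2)
      \<and> (\<integral>\<omega>. (?X \<omega>)\<^sup>2 \<partial>M) = t - s"
  proof (cases "s = t")
    case False
    let ?\<sigma> = "sqrt (t - s)"
    have pos: "0 < ?\<sigma>" using False assms by simp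
    have D: "distributed M lborel ?X (normal_density 0 ?\<sigma>)"
      using bm assms False by (simp add: brownian_motion_def)
    have "integrable lborel (\<lambda>x. normal_density 0 ?\<sigma> x * x)"
      using integrable_normal_moment[OF pos, of 0 1] by simp
    hence 1: "integrable M ?X"
      using distributed_integrable[OF D, of "\<lambda>x. x"] by simp
    have "integrable lborel (\<lambda>x. normal_density 0 ?\<sigma> x * x\<^sup>2)"
      using integrable_normal_moment[OF pos, of 0 2] by simp
    hence 2: "integrable M (\<lambda>\<omega>. (?X \<omega>)\<^sup>2)"
      using distributed_integrable[OF D, of "\<lambda>x. x\<^sup>2"] by simp
    have 3: "(\<integral>\<omega>. ?X \<omega> \<partial>M) = 0"
      by (rule normal_distributed_expectation[OF pos D])
    have "variance ?X = ?\<sigma>\<^sup>2"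
      by (rule normal_distributed_variance[OF pos D])
    hence "(\<integral>\<omega>. (?X \<omega>)\<^sup>2 \<partial>M) = t - s" unfolding 3 using assms by simp
    with 1 2 3 show ?thesis by blast
  qed simp
  from all show "integrable M ?X" "(\<integral>\<omega>. ?X \<omega> \<partial>M) = 0" "(\<integral>\<omega>. (?X \<omega>)\<^sup>2 \<partial>M) = t - s" by auto
  show "sq_int M ?X" using all assms unfolding sq_int_def by (auto intro!: borel_measurable_diff)
qed

text \<open>
  Independence is given for the sets that the increment generates; these are stable under
  intersection, so it extends to the generated sigma-algebras.
\<close>

lemma increment_indep:
  assumes st: "0 \<le> s" "s < t" and X: "X \<in> borel_measurable (FF s)"
  shows "indep_var borel X borel (\<lambda>\<omega>. W t \<omega> - W s \<omega>)"
proof -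
  let ?I = "\<lambda>Y :: 'w \<Rightarrow> real. {Y -` U \<inter> space M | U. U \<in> sets borel}"
  let ?D = "\<lambda>\<omega>. W t \<omega> - W s \<omega>"
  have stable: "Int_stable (?I Y)" for Y
  proof (rule Int_stableI)
    fix a b assume "a \<in> ?I Y" "b \<in> ?I Y"
    then obtain U V where "U \<in> sets borel" "V \<in> sets borel" "a = Y -` U \<inter> space M" "b = Y -` V \<inter> space M"
      by blast
    thus "a \<inter> b \<in> ?I Y" by (intro CollectI exI[of _ "U \<inter> V"]) auto
  qed
  have "indep_set (sets (FF s)) (?I ?D)"
    using bm st by (simp add: brownian_motion_def)
  moreover have "?I X \<subseteq> sets (FF s)"
    using measurable_sets[OF X] by auto
  ultimately have "indep_set (?I X) (?I ?D)"
    unfolding indep_sets2_eq by blast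
  hence "indep_set (sigma_sets (space M) (?I X)) (sigma_sets (space M) (?I ?D))"
    by (rule indep_set_sigma_sets[OF _ stable stable])
  thus ?thesis
    unfolding indep_var_eq using st FF_M_measurable[OF X] by auto
qed

lemma increment_mult:
  assumes st: "0 \<le> s" "s \<le> t" and X: "X \<in> borel_measurable (FF s)" "integrable M X"
  shows "integrable M (\<lambda>\<omega>. X \<omega> * (W t \<omega> - W s \<omega>))" "(\<integral>\<omega>. X \<omega> * (W t \<omega> - W s \<omega>) \<partial>M) = 0"
    "integrable M (\<lambda>\<omega>. X \<omega> * (W t \<omega> - W s \<omega>)\<^sup>2)"
    "(\<integral>\<omega>. X \<omega> * (W t \<omega> - W s \<omega>)\<^sup>2 \<partial>M) = (\<integral>\<omega>. X \<omega> \<partial>M) * (t - s)"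
proof -
  have "integrable M (\<lambda>\<omega>. X \<omega> * (W t \<omega> - W s \<omega>)) \<and> (\<integral>\<omega>. X \<omega> * (W t \<omega> - W s \<omega>) \<partial>M) = 0 \<and>
    integrable M (\<lambda>\<omega>. X \<omega> * (W t \<omega> - W s \<omega>)\<^sup>2) \<and>
    (\<integral>\<omega>. X \<omega> * (W t \<omega> - W s \<omega>)\<^sup>2 \<partial>M) = (\<integral>\<omega>. X \<omega> \<partial>M) * (t - s)"
  proof (cases "s = t")
    case False
    with st have st': "s < t" by simp
    note ind = increment_indep[OF st(1) st' X(1)]
    note m = increment_moments[OF st]
    have ind2: "indep_var borel X borel (\<lambda>\<omega>. (W t \<omega> - W s \<omega>)\<^sup>2)"
      using indep_var_compose[OF ind, of "\<lambda>x. x" borel "\<lambda>x. x\<^sup>2" borel] by (simp add: o_def)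
    have i2: "integrable M (\<lambda>\<omega>. (W t \<omega> - W s \<omega>)\<^sup>2)" using m(3) by (simp add: sq_int_def)
    show ?thesis
      using indep_var_integrable[OF ind X(2) m(1)] indep_var_lebesgue_integral[OF ind X(2) m(1)]
        indep_var_integrable[OF ind2 X(2) i2] indep_var_lebesgue_integral[OF ind2 X(2) i2] m
      by simp
  qed simp
  thus "integrable M (\<lambda>\<omega>. X \<omega> * (W t \<omega> - W s \<omega>))" "(\<integral>\<omega>. X \<omega> * (W t \<omega> - W s \<omega>) \<partial>M) = 0"
    "integrable M (\<lambda>\<omega>. X \<omega> * (W t \<omega> - W s \<omega>)\<^sup>2)"
    "(\<integral>\<omega>. X \<omega> * (W t \<omega> - W s \<omega>)\<^sup>2 \<partial>M) = (\<integral>\<omega>. X \<omega> \<partial>M) * (t - s)" by auto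
qed

definition bdd_meas :: "real \<Rightarrow> ('w \<Rightarrow> real) \<Rightarrow> bool" where
  "bdd_meas s \<xi> \<longleftrightarrow> \<xi> \<in> borel_measurable (FF s) \<and> (\<exists>K. \<forall>\<omega>\<in>space M. \<bar>\<xi> \<omega>\<bar> \<le> K)"

lemma bdd_meas_mult: 
  assumes "bdd_meas s \<xi>" "bdd_meas s \<eta>" shows "bdd_meas s (\<lambda>\<omega>. \<xi> \<omega> * \<eta> \<omega>)"
proof -
  obtain K L where "\<And>\<omega>. \<omega> \<in> space M \<Longrightarrow> \<bar>\<xi> \<omega>\<bar> \<le> K" "\<And>\<omega>. \<omega> \<in> space M \<Longrightarrow> \<bar>\<eta> \<omega>\<bar> \<le> L"
    using assms unfolding bdd_meas_def by blast
  hence "\<bar>\<xi> \<omega> * \<eta> \<omega>\<bar> \<le> K * L" if "\<omega> \<in> space M" for \<omega>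
    unfolding abs_mult using that by (intro mult_mono) (auto intro: order_trans[OF abs_ge_zero])
  thus ?thesis using assms unfolding bdd_meas_def by (auto intro!: borel_measurable_times)
qed

lemma bdd_meas_mono: "bdd_meas s \<xi> \<Longrightarrow> s \<le> t \<Longrightarrow> bdd_meas t \<xi>"
  unfolding bdd_meas_def using FF_mono_measurable by blast

lemma bdd_meas_integrable:
  assumes "bdd_meas s \<xi>" shows "integrable M \<xi>" "sq_int M \<xi>"
proof -
  show "sq_int M \<xi>"
    using assms unfolding bdd_meas_def by (auto intro!: sq_int_bounded FF_M_measurable)
  thus "integrable M \<xi>" by (rule sq_int_integrable)
qed

lemma bdd_meas_sq_int:
  assumes \<xi>: "bdd_meas s \<xi>" and f: "sq_int M f"
  shows "sq_int M (\<lambda>\<omega>. \<xi> \<omega> * f \<omega>)"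
proof -
  obtain K where K: "\<And>\<omega>. \<omega> \<in> space M \<Longrightarrow> \<bar>\<xi> \<omega>\<bar> \<le> K"
    using \<xi> unfolding bdd_meas_def by blast
  show ?thesis
  proof (rule sq_int_dominated[OF sq_int_cmult[OF f, of K]])
    show "(\<lambda>\<omega>. \<xi> \<omega> * f \<omega>) \<in> borel_measurable M"
      using \<xi> f unfolding bdd_meas_def sq_int_def by (intro borel_measurable_times FF_M_measurable[of \<xi>]) auto
    show "AE \<omega> in M. \<bar>\<xi> \<omega> * f \<omega>\<bar> \<le> \<bar>K * f \<omega>\<bar>"
      using order_trans[OF K abs_ge_self] by (intro AE_I2) (auto simp: abs_mult intro!: mult_right_mono)
  qed
qed

text \<open>
  For \<open>b \<le> d\<close> the longer increment is the shorter one plus an increment after \<open>b\<close>, which is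
  independent of all that comes before and has mean zero.
\<close>

lemma increment_product_same_start:
  assumes c: "0 \<le> c" "c \<le> b" "c \<le> d" and Z: "bdd_meas c Z"
  shows "(\<integral>\<omega>. Z \<omega> * ((W b \<omega> - W c \<omega>) * (W d \<omega> - W c \<omega>)) \<partial>M) = (\<integral>\<omega>. Z \<omega> \<partial>M) * (min b d - c)"
  using c
proof (induction b d rule: linorder_wlog)
  case (le b d)
  have Zm: "Z \<in> borel_measurable (FF c)" using Z by (simp add: bdd_meas_def)
  let ?X = "\<lambda>\<omega>. Z \<omega> * (W b \<omega> - W c \<omega>)"
  have X: "?X \<in> borel_measurable (FF b)"
    using le FF_mono_measurable[OF Zm] by (intro borel_measurable_times borel_measurable_diff W_FF) auto
  have "(\<integral>\<omega>. Z \<omega> * ((W b \<omega> - W c \<omega>) * (W d \<omega> - W c \<omega>)) \<partial>M)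
      = (\<integral>\<omega>. Z \<omega> * (W b \<omega> - W c \<omega>)\<^sup>2 + ?X \<omega> * (W d \<omega> - W b \<omega>) \<partial>M)"
    by (intro Bochner_Integration.integral_cong) (auto simp: power2_eq_square algebra_simps)
  also have "\<dots> = (\<integral>\<omega>. Z \<omega> \<partial>M) * (b - c)"
    using increment_mult(3,4)[of c b Z] increment_mult(1,2)[of b d ?X] increment_mult(1)[of c b Z]
      le Zm X bdd_meas_integrable[OF Z] by simp
  finally show ?case using le by simp
next
  case (sym b d)
  thus ?case by (simp add: mult.commute min.commute)
qed

text \<open>
  Overlapping increments \<open>(a,b]\<close> and \<open>(c,d]\<close> with \<open>a \<le> c\<close> are correlated only through the overlap,
  because everything before \<open>c\<close> is independent of what follows.
\<close>

lemma increment_product: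
  assumes a: "0 \<le> a" "a \<le> b" and c: "0 \<le> c" "c \<le> d"
    and \<xi>: "bdd_meas a \<xi>" and \<eta>: "bdd_meas c \<eta>"
  shows "(\<integral>\<omega>. (\<xi> \<omega> * (W b \<omega> - W a \<omega>)) * (\<eta> \<omega> * (W d \<omega> - W c \<omega>)) \<partial>M)
       = (\<integral>\<omega>. \<xi> \<omega> * \<eta> \<omega> \<partial>M) * max 0 (min b d - max a c)"
  using assms
proof (induction a c arbitrary: b d \<xi> \<eta> rule: linorder_wlog)
  case (le a c)
  have Z: "bdd_meas c (\<lambda>\<omega>. \<xi> \<omega> * \<eta> \<omega>)"
    using le by (intro bdd_meas_mult) (auto intro: bdd_meas_mono)
  have Zm: "(\<lambda>\<omega>. \<xi> \<omega> * \<eta> \<omega>) \<in> borel_measurable (FF c)"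
    using Z by (simp add: bdd_meas_def)
  show ?case
  proof (cases "b \<le> c")
    case True
    let ?X = "\<lambda>\<omega>. \<xi> \<omega> * \<eta> \<omega> * (W b \<omega> - W a \<omega>)"
    have "?X \<in> borel_measurable (FF c)"
      using le True Zm by (intro borel_measurable_times[of "\<lambda>\<omega>. \<xi> \<omega> * \<eta> \<omega>"] borel_measurable_diff W_FF) auto
    moreover have "integrable M ?X"
      using bdd_meas_sq_int[OF Z increment_moments(3)] le by (intro sq_int_integrable) auto
    ultimately have "(\<integral>\<omega>. ?X \<omega> * (W d \<omega> - W c \<omega>) \<partial>M) = 0"
      using le by (intro increment_mult(2)[where X = ?X]) auto
    thus ?thesis using True le by (simp add: mult_ac)
  next
    case False
    let ?X = "\<lambda>\<omega>. \<xi> \<omega> * \<eta> \<omega> * (W c \<omega> - W a \<omega>)"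
    have X: "?X \<in> borel_measurable (FF c)"
      using le False Zm by (intro borel_measurable_times[of "\<lambda>\<omega>. \<xi> \<omega> * \<eta> \<omega>"] borel_measurable_diff W_FF) auto
    have Xi: "integrable M ?X"
      using bdd_meas_sq_int[OF Z increment_moments(3)] le by (intro sq_int_integrable) auto
    have "(\<integral>\<omega>. (\<xi> \<omega> * (W b \<omega> - W a \<omega>)) * (\<eta> \<omega> * (W d \<omega> - W c \<omega>)) \<partial>M)
        = (\<integral>\<omega>. \<xi> \<omega> * \<eta> \<omega> * ((W b \<omega> - W c \<omega>) * (W d \<omega> - W c \<omega>)) + ?X \<omega> * (W d \<omega> - W c \<omega>) \<partial>M)"
      by (intro Bochner_Integration.integral_cong) (auto simp: algebra_simps)
    also have "\<dots> = (\<integral>\<omega>. \<xi> \<omega> * \<eta> \<omega> \<partial>M) * (min b d - c)"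
    proof -
      have "integrable M (\<lambda>\<omega>. \<xi> \<omega> * \<eta> \<omega> * ((W b \<omega> - W c \<omega>) * (W d \<omega> - W c \<omega>)))"
        using sq_int_mult_integrable[OF bdd_meas_sq_int[OF Z increment_moments(3)] increment_moments(3), of c b c d] le False
        by (simp add: mult.assoc)
      thus ?thesis
        using increment_product_same_start[OF _ _ _ Z, of b d] increment_mult(1,2)[OF _ _ X Xi, of d] le False
        by simp
    qed
    finally show ?thesis using le False by simp
  qed
next
  case (sym c a)
  from sym.IH[OF sym.prems(3,4,1,2,6,5)]
  show ?case by (simp add: mult.commute min.commute max.commute)
qed

end

section \<open>The Ito isometry\<close>

context brownian
begin

lemma pair_sigma_finite_horizon: "pair_sigma_finite M (time_window T)"
  by (intro pair_sigma_finite.intro finite_measure.axioms(1) finite_time_window) unfold_locales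

lemma finite_horizon: "finite_measure (horizon M T)"
  unfolding horizon_def by (intro finite_measure_pair_measure finite_time_window) unfold_locales

lemma space_horizon: "space (horizon M T) = space M \<times> {0..T}"
  by (simp add: horizon_def space_pair_measure space_restrict_space)

lemma horizon_measurable_state:
  "f \<in> borel_measurable M \<Longrightarrow> (\<lambda>(\<omega>, t). f \<omega>) \<in> borel_measurable (horizon M T)"
  unfolding horizon_def case_prod_beta' by (rule measurable_compose[OF measurable_fst])

lemma horizon_measurable_time:
  assumes "f \<in> borel_measurable borel"
  shows "(\<lambda>(\<omega>, t). f t) \<in> borel_measurable (horizon M T)"
proof -
  have [measurable]: "f \<in> borel_measurable (time_window T)"
    using assms by (intro measurable_restrict_space1) simp
  show ?thesis unfolding horizon_def by measurable
qed

lemma horizon_integral_product: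
  assumes f: "sq_int M f" and g: "g \<in> borel_measurable borel" "\<And>t. \<bar>g t\<bar> \<le> K"
  shows "sq_int (horizon M T) (\<lambda>(\<omega>, t). f \<omega> * g t)"
    "(\<integral>(\<omega>, t). f \<omega> * g t \<partial>horizon M T) = (\<integral>\<omega>. f \<omega> \<partial>M) * (\<integral>t. g t \<partial>time_window T)"
proof -
  interpret H: finite_measure "horizon M T" by (rule finite_horizon)
  interpret P: pair_sigma_finite M "time_window T" by (rule pair_sigma_finite_horizon)
  have fm: "f \<in> borel_measurable M" using f by (simp add: sq_int_def)
  have "integrable M (\<lambda>\<omega>. (f \<omega>)\<^sup>2)" using f by (simp add: sq_int_def)
  hence "integrable (horizon M T) (\<lambda>(\<omega>, t). (f \<omega>)\<^sup>2)"
    unfolding horizon_def using fm finite_time_window[of T]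
    by (intro P.Fubini_integrable) (auto simp: finite_measure.integrable_const)
  hence "sq_int (horizon M T) (\<lambda>(\<omega>, t). f \<omega>)"
    using horizon_measurable_state[OF fm] by (simp add: sq_int_def case_prod_beta')
  thus sq: "sq_int (horizon M T) (\<lambda>(\<omega>, t). f \<omega> * g t)"
  proof (rule sq_int_dominated[OF sq_int_cmult[where c = K]])
    have "(\<lambda>p. (case p of (\<omega>, t) \<Rightarrow> f \<omega>) * (case p of (\<omega>, t) \<Rightarrow> g t)) \<in> borel_measurable (horizon M T)"
      by (intro borel_measurable_times horizon_measurable_state[OF fm] horizon_measurable_time[OF g(1)])
    thus "(\<lambda>(\<omega>, t). f \<omega> * g t) \<in> borel_measurable (horizon M T)"
      by (simp add: case_prod_beta')
    show "AE x in horizon M T. \<bar>case x of (\<omega>, t) \<Rightarrow> f \<omega> * g t\<bar> \<le> \<bar>K * (case x of (\<omega>, t) \<Rightarrow> f \<omega>)\<bar>"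
      using order_trans[OF g(2) abs_ge_self]
      by (intro AE_I2) (auto simp: abs_mult mult.commute[of "\<bar>K\<bar>"] intro!: mult_left_mono)
  qed
  have "(\<integral>(\<omega>, t). f \<omega> * g t \<partial>horizon M T) = (\<integral>\<omega>. (\<integral>t. f \<omega> * g t \<partial>time_window T) \<partial>M)"
    using H.sq_int_integrable[OF sq] unfolding horizon_def by (rule P.integral_fst[symmetric])
  thus "(\<integral>(\<omega>, t). f \<omega> * g t \<partial>horizon M T) = (\<integral>\<omega>. f \<omega> \<partial>M) * (\<integral>t. g t \<partial>time_window T)"
    by simp
qed

text \<open>
  Finite sums of products of a coefficient known at time \<open>a\<close> with the increment over \<open>(a, b]\<close>. The
  intervals may overlap, so sums, differences and truncations of simple integrands need no common
  refinement of their partitions.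
\<close>

inductive elementary :: "real \<Rightarrow> (real \<Rightarrow> 'w \<Rightarrow> real) \<Rightarrow> ('w \<Rightarrow> real) \<Rightarrow> bool" for T where
  zero: "elementary T (\<lambda>t \<omega>. 0) (\<lambda>\<omega>. 0)"
| piece: "0 \<le> a \<Longrightarrow> a \<le> b \<Longrightarrow> b \<le> T \<Longrightarrow> bdd_meas a \<xi> \<Longrightarrow>
    elementary T (\<lambda>t \<omega>. \<xi> \<omega> * indicator {a<..b} t) (\<lambda>\<omega>. \<xi> \<omega> * (W b \<omega> - W a \<omega>))"
| add: "elementary T f X \<Longrightarrow> elementary T g Y \<Longrightarrow>
    elementary T (\<lambda>t \<omega>. f t \<omega> + g t \<omega>) (\<lambda>\<omega>. X \<omega> + Y \<omega>)"

lemma elementary_uminus: "elementary T f X \<Longrightarrow> elementary T (\<lambda>t \<omega>. - f t \<omega>) (\<lambda>\<omega>. - X \<omega>)"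
proof (induction rule: elementary.induct)
  case zero
  thus ?case using elementary.zero by simp
next
  case (piece a b \<xi>)
  moreover from piece have "bdd_meas a (\<lambda>\<omega>. - \<xi> \<omega>)" by (auto simp: bdd_meas_def)
  ultimately show ?case using elementary.piece[of a b T "\<lambda>\<omega>. - \<xi> \<omega>"] by simp
next
  case (add f X g Y)
  from elementary.add[OF add.IH] show ?case by simp
qed

lemma elementary_diff:
  "elementary T f X \<Longrightarrow> elementary T g Y \<Longrightarrow> elementary T (\<lambda>t \<omega>. f t \<omega> - g t \<omega>) (\<lambda>\<omega>. X \<omega> - Y \<omega>)"
  using elementary.add[of T f X "\<lambda>t \<omega>. - g t \<omega>" "\<lambda>\<omega>. - Y \<omega>"] elementary_uminus[of T g Y] by simp

lemma elementary_sum: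
  "(\<And>k. k < (N :: nat) \<Longrightarrow> elementary T (f k) (X k)) \<Longrightarrow>
    elementary T (\<lambda>t \<omega>. \<Sum>k<N. f k t \<omega>) (\<lambda>\<omega>. \<Sum>k<N. X k \<omega>)"
  by (induction N) (auto intro: elementary.intros)

lemma elementary_mono: "elementary s f X \<Longrightarrow> s \<le> T \<Longrightarrow> elementary T f X"
  by (induction rule: elementary.induct) (auto intro: elementary.intros)

lemma elementary_eq_0_after: "elementary s f X \<Longrightarrow> s < t \<Longrightarrow> f t \<omega> = 0"
  by (induction rule: elementary.induct) auto

lemma elementary_sq_int:
  assumes "elementary T f X"
  shows "sq_int (horizon M T) (\<lambda>(\<omega>, t). f t \<omega>)" "sq_int M X" "(\<integral>\<omega>. X \<omega> \<partial>M) = 0"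
proof -
  have "sq_int (horizon M T) (\<lambda>(\<omega>, t). f t \<omega>) \<and> sq_int M X \<and> (\<integral>\<omega>. X \<omega> \<partial>M) = 0"
    using assms
  proof (induction rule: elementary.induct)
    case (piece a b \<xi>)
    have "sq_int (horizon M T) (\<lambda>(\<omega>, t). \<xi> \<omega> * indicator {a<..b} t)"
      by (rule horizon_integral_product(1)[OF bdd_meas_integrable(2)[OF piece(4)], of _ 1])
         (auto split: split_indicator)
    thus ?case
      using piece increment_mult(2)[of a b \<xi>] bdd_meas_integrable[OF piece(4)]
        bdd_meas_sq_int[OF piece(4) increment_moments(3)] by (auto simp: bdd_meas_def)
  next
    case (add f X g Y)
    thus ?case
      using sq_int_add[of "horizon M T" "\<lambda>(\<omega>, t). f t \<omega>" "\<lambda>(\<omega>, t). g t \<omega>"] sq_int_add[of M X Y]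
        sq_int_integrable[of X] sq_int_integrable[of Y]
      by (simp add: case_prod_beta')
  qed (simp add: sq_int_zero case_prod_beta')
  thus "sq_int (horizon M T) (\<lambda>(\<omega>, t). f t \<omega>)" "sq_int M X" "(\<integral>\<omega>. X \<omega> \<partial>M) = 0" by auto
qed

lemma integral_time_window_indicator:
  assumes "0 \<le> a" "b \<le> T"
  shows "(\<integral>t. indicator {a<..b} t \<partial>time_window T) = (max 0 (b - a) :: real)"
proof -
  have "(\<integral>t. indicator {a<..b} t \<partial>time_window T :: real) = (\<integral>t. indicator {0..T} t *\<^sub>R indicator {a<..b} t \<partial>lborel)"
    by (rule integral_restrict_space) simp
  also have "\<dots> = (\<integral>t. indicator {a<..b} t \<partial>lborel)"
    using assms by (intro Bochner_Integration.integral_cong) (auto split: split_indicator)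
  also have "\<dots> = max 0 (b - a)"
    by (cases "a \<le> b") (simp_all add: measure_def)
  finally show ?thesis .
qed

text \<open>
  Both sides are bilinear, so the case of two intervals \<open>(a,b]\<close> and \<open>(c,d]\<close> decides: there both are
  the mean of the product of the coefficients times the length of the overlap.
\<close>

lemma elementary_isometry:
  assumes "elementary T f X" "elementary T g Y"
  shows "(\<integral>\<omega>. X \<omega> * Y \<omega> \<partial>M) = (\<integral>(\<omega>, t). f t \<omega> * g t \<omega> \<partial>horizon M T)"
  using assms
proof (induction rule: elementary.induct)
  case (piece a b \<xi>)
  note p = piece
  from piece.prems show ?case
  proof (induction rule: elementary.induct)
    case (piece c d \<eta>)
    let ?Z = "\<lambda>\<omega>. \<xi> \<omega> * \<eta> \<omega>"
    have Z: "bdd_meas (max a c) ?Z"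
      using p piece by (intro bdd_meas_mult) (auto intro: bdd_meas_mono)
    have "(\<integral>(\<omega>, t). (\<xi> \<omega> * indicator {a<..b} t) * (\<eta> \<omega> * indicator {c<..d} t) \<partial>horizon M T)
        = (\<integral>(\<omega>, t). ?Z \<omega> * indicator {max a c<..min b d} t \<partial>horizon M T)"
      by (intro Bochner_Integration.integral_cong) (auto split: split_indicator)
    also have "\<dots> = (\<integral>\<omega>. ?Z \<omega> \<partial>M) * (\<integral>t. indicator {max a c<..min b d} t \<partial>time_window T)"
      by (rule horizon_integral_product(2)[OF bdd_meas_integrable(2)[OF Z], of _ 1])
         (auto split: split_indicator)
    also have "\<dots> = (\<integral>\<omega>. ?Z \<omega> \<partial>M) * max 0 (min b d - max a c)"
      using p piece by (subst integral_time_window_indicator) auto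
    also have "\<dots> = (\<integral>\<omega>. (\<xi> \<omega> * (W b \<omega> - W a \<omega>)) * (\<eta> \<omega> * (W d \<omega> - W c \<omega>)) \<partial>M)"
      using p piece by (intro increment_product[symmetric]) auto
    finally show ?case ..
  next
    case (add g Y h Z)
    note e = elementary_sq_int[OF elementary.piece[OF p(1-4)]]
    note g = elementary_sq_int[OF add(1)] and h = elementary_sq_int[OF add(2)]
    show ?case
      using add.IH sq_int_mult_integrable[OF e(1) g(1)] sq_int_mult_integrable[OF e(1) h(1)]
        sq_int_mult_integrable[OF e(2) g(2)] sq_int_mult_integrable[OF e(2) h(2)]
      by (simp add: case_prod_beta' distrib_left)
  qed (simp add: case_prod_beta')
next
  case (add f X h Z)
  note g = elementary_sq_int[OF add.prems]
    and f = elementary_sq_int[OF add(1)] and h = elementary_sq_int[OF add(2)]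
  show ?case
    using add.IH[OF add.prems] sq_int_mult_integrable[OF f(1) g(1)] sq_int_mult_integrable[OF h(1) g(1)]
      sq_int_mult_integrable[OF f(2) g(2)] sq_int_mult_integrable[OF h(2) g(2)]
    by (simp add: case_prod_beta' distrib_right)
qed (simp add: case_prod_beta')

text \<open>
  Cutting an integrand off before \<open>s\<close> and multiplying it with a variable \<open>Z\<close> known at \<open>s\<close> keeps it
  elementary. The integral after \<open>s\<close>, called \<open>Y\<close>, is the same for all \<open>Z\<close>.
\<close>

lemma elementary_after:
  assumes "elementary T f X" "0 \<le> s" "s \<le> T"
  shows "\<exists>Y. \<forall>Z. bdd_meas s Z \<longrightarrow>
    elementary T (\<lambda>t \<omega>. Z \<omega> * (indicator {s<..} t * f t \<omega>)) (\<lambda>\<omega>. Z \<omega> * Y \<omega>)"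
  using assms
proof (induction rule: elementary.induct)
  case (piece a b \<xi>)
  have "elementary T (\<lambda>t \<omega>. Z \<omega> * (indicator {s<..} t * (\<xi> \<omega> * indicator {a<..b} t)))
      (\<lambda>\<omega>. Z \<omega> * (\<xi> \<omega> * (W (max s b) \<omega> - W (max s a) \<omega>)))" if Z: "bdd_meas s Z" for Z
  proof -
    have "bdd_meas (max s a) (\<lambda>\<omega>. Z \<omega> * \<xi> \<omega>)"
      using Z piece by (intro bdd_meas_mult) (auto intro: bdd_meas_mono)
    hence "elementary T (\<lambda>t \<omega>. (Z \<omega> * \<xi> \<omega>) * indicator {max s a<..max s b} t)
        (\<lambda>\<omega>. (Z \<omega> * \<xi> \<omega>) * (W (max s b) \<omega> - W (max s a) \<omega>))"
      using piece by (intro elementary.piece) auto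
    moreover have "(\<lambda>t \<omega>. (Z \<omega> * \<xi> \<omega>) * indicator {max s a<..max s b} t)
        = (\<lambda>t \<omega>. Z \<omega> * (indicator {s<..} t * (\<xi> \<omega> * indicator {a<..b} t)))"
      by (intro ext) (auto split: split_indicator)
    ultimately show ?thesis by (simp only: mult.assoc)
  qed
  thus ?case by (intro exI[of _ "\<lambda>\<omega>. \<xi> \<omega> * (W (max s b) \<omega> - W (max s a) \<omega>)"] allI impI)
next
  case (add f X g Y)
  then obtain F G where "\<And>Z. bdd_meas s Z \<Longrightarrow>
      elementary T (\<lambda>t \<omega>. Z \<omega> * (indicator {s<..} t * f t \<omega>)) (\<lambda>\<omega>. Z \<omega> * F \<omega>)"
    "\<And>Z. bdd_meas s Z \<Longrightarrow>
      elementary T (\<lambda>t \<omega>. Z \<omega> * (indicator {s<..} t * g t \<omega>)) (\<lambda>\<omega>. Z \<omega> * G \<omega>)"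
    by blast
  hence "elementary T (\<lambda>t \<omega>. Z \<omega> * (indicator {s<..} t * (f t \<omega> + g t \<omega>))) (\<lambda>\<omega>. Z \<omega> * (F \<omega> + G \<omega>))"
    if "bdd_meas s Z" for Z
    using elementary.add that by (simp add: distrib_left)
  thus ?case by (intro exI[of _ "\<lambda>\<omega>. F \<omega> + G \<omega>"] allI impI)
next
  case zero
  show ?case by (rule exI[of _ "\<lambda>\<omega>. 0"]) (simp add: elementary.zero)
qed

lemma simple_integrand_elementary:
  assumes "simple_integrand M W T N \<tau> \<xi>"
  shows "elementary T (simple_process N \<tau> \<xi>) (simple_ito W N \<tau> \<xi>)"
proof -
  have st: "\<And>k. k < N \<Longrightarrow> \<tau> k \<le> \<tau> (Suc k)" and ends: "0 \<le> \<tau> 0" "\<tau> N \<le> T"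
    and \<xi>: "\<And>k. k < N \<Longrightarrow> bdd_meas (\<tau> k) (\<xi> k)"
    using assms by (auto simp: simple_integrand_def bdd_meas_def)
  have mono: "\<tau> i \<le> \<tau> j" if "i \<le> j" "j \<le> N" for i j
    using that by (induction j rule: dec_induct) (auto intro: order_trans[OF _ st])
  have "elementary T (\<lambda>t \<omega>. \<xi> k \<omega> * indicator {\<tau> k<..\<tau> (Suc k)} t) (\<lambda>\<omega>. \<xi> k \<omega> * (W (\<tau> (Suc k)) \<omega> - W (\<tau> k) \<omega>))"
    if "k < N" for k
    using that ends mono[of 0 k] mono[of "Suc k" N] by (intro elementary.piece st \<xi>) auto
  from elementary_sum[OF this] show ?thesis
    unfolding simple_process_def simple_ito_def .
qed

text \<open>
  The Ito integral with elementary in place of simple integrands, which makes it stable under cutting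
  off and weighting the integrand (\<open>ito_increment\<close>).
\<close>

definition ito :: "real \<Rightarrow> (real \<Rightarrow> 'w \<Rightarrow> real) \<Rightarrow> ('w \<Rightarrow> real) \<Rightarrow> bool" where
  "ito T f I \<longleftrightarrow> sq_int (horizon M T) (\<lambda>(\<omega>, t). f t \<omega>) \<and> sq_int M I \<and>
     (\<exists>fl Xl. (\<forall>l. elementary T (fl l) (Xl l)) \<and>
        (\<lambda>l. \<integral>(\<omega>, t). (f t \<omega> - fl l t \<omega>)\<^sup>2 \<partial>horizon M T) \<longlonglongrightarrow> (0 :: real) \<and>
        (\<lambda>l. \<integral>\<omega>. (I \<omega> - Xl l \<omega>)\<^sup>2 \<partial>M) \<longlonglongrightarrow> 0)"

lemma has_ito_integral_imp_ito:
  assumes "has_ito_integral M W f T I"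
  shows "ito T f I"
proof -
  from assms obtain N \<tau> \<xi> where
    m: "(\<lambda>(\<omega>, t). f t \<omega>) \<in> borel_measurable (horizon M T)" "I \<in> borel_measurable M" and
    s: "\<And>l. simple_integrand M W T (N l) (\<tau> l) (\<xi> l)" and
    lf: "(\<lambda>l. \<integral>\<^sup>+(\<omega>, t). ennreal ((f t \<omega> - simple_process (N l) (\<tau> l) (\<xi> l) t \<omega>)\<^sup>2) \<partial>horizon M T)
          \<longlonglongrightarrow> 0" and
    lI: "(\<lambda>l. \<integral>\<^sup>+\<omega>. ennreal ((I \<omega> - simple_ito W (N l) (\<tau> l) (\<xi> l) \<omega>)\<^sup>2) \<partial>M) \<longlonglongrightarrow> 0"
    unfolding has_ito_integral_def by blast
  have e: "elementary T (simple_process (N l) (\<tau> l) (\<xi> l)) (simple_ito W (N l) (\<tau> l) (\<xi> l))" for l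
    by (rule simple_integrand_elementary[OF s])
  note 1 = sq_int_limit[OF m(1) elementary_sq_int(1)[OF e]]
  note 2 = sq_int_limit[OF m(2) elementary_sq_int(2)[OF e] lI]
  have "(\<lambda>l. \<integral>\<^sup>+p. ennreal (((case p of (\<omega>, t) \<Rightarrow> f t \<omega>)
      - (case p of (\<omega>, t) \<Rightarrow> simple_process (N l) (\<tau> l) (\<xi> l) t \<omega>))\<^sup>2) \<partial>horizon M T) \<longlonglongrightarrow> 0"
    using lf by (simp add: case_prod_beta')
  note 1 = 1[OF this]
  have "(\<forall>l. elementary T (simple_process (N l) (\<tau> l) (\<xi> l)) (simple_ito W (N l) (\<tau> l) (\<xi> l))) \<and>
      (\<lambda>l. \<integral>(\<omega>, t). (f t \<omega> - simple_process (N l) (\<tau> l) (\<xi> l) t \<omega>)\<^sup>2 \<partial>horizon M T) \<longlonglongrightarrow> (0 :: real) \<and>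
      (\<lambda>l. \<integral>\<omega>. (I \<omega> - simple_ito W (N l) (\<tau> l) (\<xi> l) \<omega>)\<^sup>2 \<partial>M) \<longlonglongrightarrow> 0"
    using e 1(2) 2(2) by (simp add: case_prod_beta')
  hence "\<exists>fl Xl. (\<forall>l. elementary T (fl l) (Xl l)) \<and>
      (\<lambda>l. \<integral>(\<omega>, t). (f t \<omega> - fl l t \<omega>)\<^sup>2 \<partial>horizon M T) \<longlonglongrightarrow> (0 :: real) \<and>
      (\<lambda>l. \<integral>\<omega>. (I \<omega> - Xl l \<omega>)\<^sup>2 \<partial>M) \<longlonglongrightarrow> 0"
    by (intro exI[of _ "\<lambda>l. simple_process (N l) (\<tau> l) (\<xi> l)"]
        exI[of _ "\<lambda>l. simple_ito W (N l) (\<tau> l) (\<xi> l)"])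
  with 1(1) 2(1) show ?thesis
    unfolding ito_def by simp
qed

lemma ito_mean_zero:
  assumes "ito T f I"
  shows "(\<integral>\<omega>. I \<omega> \<partial>M) = 0"
proof -
  obtain fl Xl where I: "sq_int M I" and e: "\<And>l. elementary T (fl l) (Xl l)"
    and lim: "(\<lambda>l. \<integral>\<omega>. (I \<omega> - Xl l \<omega>)\<^sup>2 \<partial>M) \<longlonglongrightarrow> 0"
    using assms unfolding ito_def by blast
  have one: "sq_int M (\<lambda>\<omega>. 1)" by (rule sq_int_bounded[of _ 1]) auto
  have "(\<lambda>l. \<integral>\<omega>. Xl l \<omega> * 1 \<partial>M) \<longlonglongrightarrow> (\<integral>\<omega>. I \<omega> * 1 \<partial>M)"
    by (rule L2_inner_tendsto[OF I elementary_sq_int(2)[OF e] lim one one]) simp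
  thus ?thesis using elementary_sq_int(3)[OF e] by (simp add: LIMSEQ_const_iff)
qed

lemma ito_isometry:
  assumes "ito T f I" "ito T g J"
  shows "(\<integral>\<omega>. I \<omega> * J \<omega> \<partial>M) = (\<integral>(\<omega>, t). f t \<omega> * g t \<omega> \<partial>horizon M T)"
proof -
  let ?c = "\<lambda>f :: real \<Rightarrow> 'w \<Rightarrow> real. \<lambda>(\<omega>, t). f t \<omega>"
  obtain fl Xl where f: "sq_int (horizon M T) (?c f)" "sq_int M I" and e: "\<And>l. elementary T (fl l) (Xl l)"
    and lf: "(\<lambda>l. \<integral>(\<omega>, t). (f t \<omega> - fl l t \<omega>)\<^sup>2 \<partial>horizon M T) \<longlonglongrightarrow> (0 :: real)"
    and lI: "(\<lambda>l. \<integral>\<omega>. (I \<omega> - Xl l \<omega>)\<^sup>2 \<partial>M) \<longlonglongrightarrow> 0"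
    using assms(1) unfolding ito_def by blast
  obtain gl Yl where g: "sq_int (horizon M T) (?c g)" "sq_int M J" and e': "\<And>l. elementary T (gl l) (Yl l)"
    and lg: "(\<lambda>l. \<integral>(\<omega>, t). (g t \<omega> - gl l t \<omega>)\<^sup>2 \<partial>horizon M T) \<longlonglongrightarrow> (0 :: real)"
    and lJ: "(\<lambda>l. \<integral>\<omega>. (J \<omega> - Yl l \<omega>)\<^sup>2 \<partial>M) \<longlonglongrightarrow> 0"
    using assms(2) unfolding ito_def by blast
  have "(\<lambda>l. \<integral>\<omega>. Xl l \<omega> * Yl l \<omega> \<partial>M) \<longlonglongrightarrow> (\<integral>\<omega>. I \<omega> * J \<omega> \<partial>M)"
    by (rule L2_inner_tendsto[OF f(2) elementary_sq_int(2)[OF e] lI g(2) elementary_sq_int(2)[OF e'] lJ])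
  moreover have "(\<lambda>l. \<integral>p. ?c (fl l) p * ?c (gl l) p \<partial>horizon M T) \<longlonglongrightarrow> (\<integral>p. ?c f p * ?c g p \<partial>horizon M T)"
    by (rule L2_inner_tendsto[OF f(1) elementary_sq_int(1)[OF e] _ g(1) elementary_sq_int(1)[OF e']])
       (use lf lg in \<open>simp_all add: case_prod_beta'\<close>)
  ultimately show ?thesis
    using elementary_isometry[OF e e'] by (simp add: case_prod_beta' LIMSEQ_unique)
qed

lemma horizon_subset:
  assumes "s \<le> T" "h \<in> borel_measurable (horizon M T)"
  shows "h \<in> borel_measurable (horizon M s)"
proof -
  have "(\<lambda>t. t) \<in> measurable (time_window s) (time_window T)"
    using assms(1) by (intro measurable_restrict_space2 measurable_restrict_space1) (auto simp: space_restrict_space)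
  hence "(\<lambda>(\<omega>, t). (\<omega>, t)) \<in> measurable (horizon M s) (horizon M T)"
    unfolding horizon_def by measurable
  from measurable_compose[OF this assms(2)] show ?thesis by simp
qed

text \<open>
  Integrating up to \<open>s\<close> amounts to cutting off the integrand at \<open>s\<close>; this compares integrals over
  different time horizons.
\<close>

lemma horizon_integral_truncate:
  fixes h :: "'w \<times> real \<Rightarrow> real"
  assumes s: "s \<le> T" and h: "h \<in> borel_measurable (horizon M T)"
  shows "integrable (horizon M s) h \<longleftrightarrow> integrable (horizon M T) (\<lambda>p. indicator {..s} (snd p) * h p)"
    and "(\<integral>p. h p \<partial>horizon M s) = (\<integral>p. indicator {..s} (snd p) * h p \<partial>horizon M T)"
proof -
  interpret S: sigma_finite_measure "time_window s"
    using finite_time_window by (rule finite_measure.axioms(1))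
  interpret T: sigma_finite_measure "time_window T"
    using finite_time_window by (rule finite_measure.axioms(1))
  have nn: "(\<integral>\<^sup>+p. k p \<partial>horizon M s) = (\<integral>\<^sup>+p. k p * indicator {..s} (snd p) \<partial>horizon M T)"
    if k: "k \<in> borel_measurable (horizon M T)" for k :: "'w \<times> real \<Rightarrow> ennreal"
  proof -
    have [measurable]: "(\<lambda>p. indicator {..s} (snd p) :: ennreal) \<in> borel_measurable (horizon M T)"
      using horizon_measurable_time[of "indicator {..s} :: real \<Rightarrow> ennreal"] by (simp add: case_prod_beta')
    have k': "(\<lambda>p. k p * indicator {..s} (snd p)) \<in> borel_measurable (horizon M T)"
      using k by simp
    have "(\<integral>\<^sup>+p. k p \<partial>horizon M s) = (\<integral>\<^sup>+\<omega>. \<integral>\<^sup>+t. k (\<omega>, t) \<partial>time_window s \<partial>M)"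
      using horizon_subset[OF s k] unfolding horizon_def by (rule S.nn_integral_fst[symmetric])
    also have "\<dots> = (\<integral>\<^sup>+\<omega>. \<integral>\<^sup>+t. k (\<omega>, t) * indicator {..s} t \<partial>time_window T \<partial>M)"
      using s by (auto simp: nn_integral_restrict_space intro!: nn_integral_cong split: split_indicator)
    also have "\<dots> = (\<integral>\<^sup>+p. k p * indicator {..s} (snd p) \<partial>horizon M T)"
      using T.nn_integral_fst[OF k'[unfolded horizon_def]] unfolding horizon_def by simp
    finally show ?thesis .
  qed
  have m: "(\<lambda>p. indicator {..s} (snd p) * h p) \<in> borel_measurable (horizon M T)"
    using horizon_measurable_time[of "indicator {..s} :: real \<Rightarrow> real"] h
    by (intro borel_measurable_times) (simp_all add: case_prod_beta')
  have part: "(\<integral>\<^sup>+p. ennreal (h' p) \<partial>horizon M s) = (\<integral>\<^sup>+p. ennreal (indicator {..s} (snd p) * h' p) \<partial>horizon M T)"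
    if "h' \<in> borel_measurable (horizon M T)" for h'
    using that by (subst nn) (auto intro!: nn_integral_cong split: split_indicator)
  show integrable: "integrable (horizon M s) h \<longleftrightarrow> integrable (horizon M T) (\<lambda>p. indicator {..s} (snd p) * h p)"
    unfolding integrable_iff_bounded using horizon_subset[OF s h] m part[of "\<lambda>p. norm (h p)"] h
    by (simp add: abs_mult)
  show "(\<integral>p. h p \<partial>horizon M s) = (\<integral>p. indicator {..s} (snd p) * h p \<partial>horizon M T)"
  proof (cases "integrable (horizon M s) h")
    case True
    thus ?thesis
      using integrable part[of h] part[of "\<lambda>p. - h p"] h by (simp add: real_lebesgue_integral_def)
  next
    case False
    thus ?thesis using integrable by (simp add: not_integrable_integral_eq)
  qed
qed

end

lemma L2_dominated_tendsto_0:
  assumes a: "\<And>l. sq_int M (a l)" "(\<lambda>l. \<integral>x. (a l x)\<^sup>2 \<partial>M) \<longlonglongrightarrow> 0"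
    and b: "\<And>l. b l \<in> borel_measurable M" "\<And>l x. x \<in> space M \<Longrightarrow> \<bar>b l x\<bar> \<le> K * \<bar>a l x\<bar>"
  shows "(\<lambda>l. \<integral>x. (b l x)\<^sup>2 \<partial>M) \<longlonglongrightarrow> 0"
proof (rule Lim_null_comparison[OF always_eventually])
  show "\<forall>l. norm (\<integral>x. (b l x)\<^sup>2 \<partial>M) \<le> K\<^sup>2 * (\<integral>x. (a l x)\<^sup>2 \<partial>M)"
  proof
    fix l
    have le: "(b l x)\<^sup>2 \<le> K\<^sup>2 * (a l x)\<^sup>2" if "x \<in> space M" for x
      using power_mono[OF b(2)[OF that, of l] abs_ge_zero, of 2] by (simp add: power_mult_distrib)
    have "sq_int M (b l)"
      by (rule sq_int_dominated[OF sq_int_cmult[OF a(1)[of l], of K] b(1)])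
         (use le in \<open>auto simp: abs_le_square_iff power_mult_distrib\<close>)
    hence "(\<integral>x. (b l x)\<^sup>2 \<partial>M) \<le> (\<integral>x. K\<^sup>2 * (a l x)\<^sup>2 \<partial>M)"
      using a(1)[of l] le by (intro integral_mono) (auto simp: sq_int_def)
    thus "norm (\<integral>x. (b l x)\<^sup>2 \<partial>M) \<le> K\<^sup>2 * (\<integral>x. (a l x)\<^sup>2 \<partial>M)" by simp
  qed
  show "(\<lambda>l. K\<^sup>2 * (\<integral>x. (a l x)\<^sup>2 \<partial>M)) \<longlonglongrightarrow> 0"
    using tendsto_mult[OF tendsto_const[of "K\<^sup>2"] a(2)] by simp
qed

context brownian
begin

lemma sq_int_horizon_mono:
  assumes "s \<le> T" "sq_int (horizon M T) h" shows "sq_int (horizon M s) h"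
proof -
  have h: "h \<in> borel_measurable (horizon M T)" "integrable (horizon M T) (\<lambda>p. (h p)\<^sup>2)"
    using assms(2) by (auto simp: sq_int_def)
  have "(\<lambda>p. indicator {..s} (snd p) :: real) \<in> borel_measurable (horizon M T)"
    using horizon_measurable_time[of "indicator {..s} :: real \<Rightarrow> real"] by (simp add: case_prod_beta')
  hence "integrable (horizon M T) (\<lambda>p. indicator {..s} (snd p) * (h p)\<^sup>2)"
    using h by (intro Bochner_Integration.integrable_bound[OF h(2)]) (auto split: split_indicator)
  thus ?thesis
    using horizon_subset[OF assms(1) h(1)] horizon_integral_truncate(1)[OF assms(1), of "\<lambda>p. (h p)\<^sup>2"] h(1)
    by (simp add: sq_int_def)
qed

lemma bdd_meas_const: "bdd_meas s (\<lambda>\<omega>. c)"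
  by (auto simp: bdd_meas_def)

lemma bdd_meas_indicator: "G \<in> sets (FF s) \<Longrightarrow> bdd_meas s (indicator G)"
  unfolding bdd_meas_def by (intro conjI borel_measurable_indicator exI[of _ 1]) auto

text \<open>
  The two integrals over \<open>[0,T]\<close> and \<open>[0,s]\<close> come with unrelated approximations. Their difference,
  weighted with a variable known at time \<open>s\<close>, is again an Ito integral, namely that of the weighted
  integrand on \<open>(s,T]\<close>. So the mean and isometry formulas apply to it, which gives the conditional
  statements below.
\<close>

lemma ito_increment:
  assumes I: "ito T f I" and J: "ito s f J" and s: "0 \<le> s" "s \<le> T" and Z: "bdd_meas s Z"
  shows "ito T (\<lambda>t \<omega>. Z \<omega> * (indicator {s<..} t * f t \<omega>)) (\<lambda>\<omega>. Z \<omega> * (I \<omega> - J \<omega>))"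
proof -
  let ?c = "\<lambda>f :: real \<Rightarrow> 'w \<Rightarrow> real. \<lambda>(\<omega>, t). f t \<omega>"
  obtain fl Xl where f: "sq_int (horizon M T) (?c f)" "sq_int M I" and e: "\<And>l. elementary T (fl l) (Xl l)"
    and lf: "(\<lambda>l. \<integral>(\<omega>, t). (f t \<omega> - fl l t \<omega>)\<^sup>2 \<partial>horizon M T) \<longlonglongrightarrow> (0 :: real)"
    and lI: "(\<lambda>l. \<integral>\<omega>. (I \<omega> - Xl l \<omega>)\<^sup>2 \<partial>M) \<longlonglongrightarrow> 0"
    using I unfolding ito_def by blast
  obtain gl Gl where J2: "sq_int M J" and e': "\<And>l. elementary s (gl l) (Gl l)"
    and lg: "(\<lambda>l. \<integral>(\<omega>, t). (f t \<omega> - gl l t \<omega>)\<^sup>2 \<partial>horizon M s) \<longlonglongrightarrow> (0 :: real)"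
    and lJ: "(\<lambda>l. \<integral>\<omega>. (J \<omega> - Gl l \<omega>)\<^sup>2 \<partial>M) \<longlonglongrightarrow> 0"
    using J unfolding ito_def by blast
  have "\<forall>l. \<exists>Y. \<forall>Z. bdd_meas s Z \<longrightarrow>
      elementary T (\<lambda>t \<omega>. Z \<omega> * (indicator {s<..} t * fl l t \<omega>)) (\<lambda>\<omega>. Z \<omega> * Y \<omega>)"
    using elementary_after[OF e s] by blast
  then obtain Yl where Yl: "\<And>l Z. bdd_meas s Z \<Longrightarrow>
      elementary T (\<lambda>t \<omega>. Z \<omega> * (indicator {s<..} t * fl l t \<omega>)) (\<lambda>\<omega>. Z \<omega> * Yl l \<omega>)"
    by (auto dest!: choice)
  define d where "d = (\<lambda>l \<omega>. Xl l \<omega> - Gl l \<omega> - Yl l \<omega>)"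
  have ed: "elementary T (\<lambda>t \<omega>. fl l t \<omega> - gl l t \<omega> - indicator {s<..} t * fl l t \<omega>) (d l)" for l
    using elementary_diff[OF elementary_diff[OF e elementary_mono[OF e' s(2)]] Yl[OF bdd_meas_const[of s 1]], of l l l]
    unfolding d_def by simp
  have sq: "sq_int (horizon M s) (?c f)" "sq_int (horizon M s) (?c (fl l))" "sq_int (horizon M s) (?c (gl l))" for l
    using sq_int_horizon_mono[OF s(2) f(1)] sq_int_horizon_mono[OF s(2) elementary_sq_int(1)[OF e]]
      elementary_sq_int(1)[OF e'] by auto
  (* The integral d l belongs to the restriction of fl l - gl l to times up to s, and there both
     approximate f. *)
  have ld: "(\<lambda>l. \<integral>\<omega>. (d l \<omega>)\<^sup>2 \<partial>M) \<longlonglongrightarrow> 0"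
  proof -
    have d2: "(\<integral>\<omega>. (d l \<omega>)\<^sup>2 \<partial>M) = (\<integral>p. (?c (fl l) p - ?c (gl l) p)\<^sup>2 \<partial>horizon M s)" for l
    proof -
      have m: "(\<lambda>p. (?c (fl l) p - ?c (gl l) p)\<^sup>2) \<in> borel_measurable (horizon M T)"
        using elementary_sq_int(1)[OF e, of l] elementary_sq_int(1)[OF elementary_mono[OF e' s(2)], of l]
        by (intro borel_measurable_power borel_measurable_diff) (auto simp: sq_int_def)
      have "(\<integral>\<omega>. (d l \<omega>)\<^sup>2 \<partial>M)
          = (\<integral>(\<omega>, t). (fl l t \<omega> - gl l t \<omega> - indicator {s<..} t * fl l t \<omega>)
              * (fl l t \<omega> - gl l t \<omega> - indicator {s<..} t * fl l t \<omega>) \<partial>horizon M T)"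
        unfolding power2_eq_square by (rule elementary_isometry[OF ed ed])
      also have "\<dots> = (\<integral>p. indicator {..s} (snd p) * (?c (fl l) p - ?c (gl l) p)\<^sup>2 \<partial>horizon M T)"
        using elementary_eq_0_after[OF e', of _ l]
        by (intro Bochner_Integration.integral_cong)
           (auto simp: power2_eq_square split: split_indicator)
      also have "\<dots> = (\<integral>p. (?c (fl l) p - ?c (gl l) p)\<^sup>2 \<partial>horizon M s)"
        by (rule horizon_integral_truncate(2)[OF s(2) m, symmetric])
      finally show ?thesis .
    qed
    have lf': "(\<lambda>l. \<integral>p. (?c (fl l) p - ?c f p)\<^sup>2 \<partial>horizon M s) \<longlonglongrightarrow> 0"
    proof (rule Lim_null_comparison[OF always_eventually])
      show "\<forall>l. norm (\<integral>p. (?c (fl l) p - ?c f p)\<^sup>2 \<partial>horizon M s)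
          \<le> (\<integral>(\<omega>, t). (f t \<omega> - fl l t \<omega>)\<^sup>2 \<partial>horizon M T)"
      proof
        fix l
        let ?h = "\<lambda>p. (?c (fl l) p - ?c f p)\<^sup>2"
        have h: "integrable (horizon M T) ?h"
          using sq_int_diff[OF elementary_sq_int(1)[OF e, of l] f(1)] by (simp add: sq_int_def)
        have "norm (\<integral>p. ?h p \<partial>horizon M s) = (\<integral>p. indicator {..s} (snd p) * ?h p \<partial>horizon M T)"
          using horizon_integral_truncate(2)[OF s(2) borel_measurable_integrable[OF h]]
          by (simp add: integral_nonneg_AE)
        also have "\<dots> \<le> (\<integral>p. ?h p \<partial>horizon M T)"
        proof (rule integral_mono[OF _ h])
          show "integrable (horizon M T) (\<lambda>p. indicator {..s} (snd p) * ?h p)"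
            using horizon_integral_truncate(1)[OF s(2) borel_measurable_integrable[OF h]]
              sq_int_diff[OF sq(2)[of l] sq(1)] by (simp add: sq_int_def)
        qed (auto split: split_indicator)
        also have "\<dots> = (\<integral>(\<omega>, t). (f t \<omega> - fl l t \<omega>)\<^sup>2 \<partial>horizon M T)"
          by (intro Bochner_Integration.integral_cong) (auto simp: power2_commute)
        finally show "norm (\<integral>p. ?h p \<partial>horizon M s) \<le> \<dots>" .
      qed
    qed (rule lf)
    have "(\<lambda>l. \<integral>p. ((?c (fl l) p - ?c f p) + (?c f p - ?c (gl l) p))\<^sup>2 \<partial>horizon M s) \<longlonglongrightarrow> 0"
      by (rule L2_sum_tendsto_0[OF _ lf']) (use lg sq in \<open>auto intro: sq_int_diff simp: case_prod_beta'\<close>)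
    thus ?thesis unfolding d2 by (simp add: case_prod_beta')
  qed
  obtain K where K: "\<And>\<omega>. \<omega> \<in> space M \<Longrightarrow> \<bar>Z \<omega>\<bar> \<le> K"
    using Z unfolding bdd_meas_def by blast
  have Zm: "Z \<in> borel_measurable M" using Z by (auto simp: bdd_meas_def intro: FF_M_measurable)
  define A where "A = (\<lambda>l \<omega>. ((I \<omega> - Xl l \<omega>) + (Gl l \<omega> - J \<omega>)) + d l \<omega>)"
  have sX: "sq_int M (\<lambda>\<omega>. I \<omega> - Xl l \<omega>)" "sq_int M (\<lambda>\<omega>. (Gl l \<omega> - J \<omega>))" "sq_int M (d l)" for l
    by (rule sq_int_diff[OF f(2) elementary_sq_int(2)[OF e]],
        rule sq_int_diff[OF elementary_sq_int(2)[OF e'] J2],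
        rule elementary_sq_int(2)[OF ed])
  have lA: "(\<lambda>l. \<integral>\<omega>. (A l \<omega>)\<^sup>2 \<partial>M) \<longlonglongrightarrow> 0"
    unfolding A_def
    by (rule L2_sum_tendsto_0[OF sq_int_add[OF sX(1,2)] L2_sum_tendsto_0[OF sX(1) lI sX(2)] sX(3) ld])
       (use lJ in \<open>simp add: power2_commute\<close>)
  have sA: "sq_int M (A l)" for l
    unfolding A_def by (rule sq_int_add[OF sq_int_add[OF sX(1,2)] sX(3)])
  have limI: "(\<lambda>l. \<integral>\<omega>. (Z \<omega> * (I \<omega> - J \<omega>) - Z \<omega> * Yl l \<omega>)\<^sup>2 \<partial>M) \<longlonglongrightarrow> 0"
  proof (rule L2_dominated_tendsto_0[OF sA lA])
    fix l
    have "(\<lambda>\<omega>. Z \<omega> * (I \<omega> - J \<omega>) - Z \<omega> * Yl l \<omega>) = (\<lambda>\<omega>. Z \<omega> * A l \<omega>)"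
      by (simp add: A_def d_def fun_eq_iff algebra_simps)
    moreover have "(\<lambda>\<omega>. Z \<omega> * A l \<omega>) \<in> borel_measurable M"
      using Zm sA by (auto simp: sq_int_def intro!: borel_measurable_times)
    ultimately show "(\<lambda>\<omega>. Z \<omega> * (I \<omega> - J \<omega>) - Z \<omega> * Yl l \<omega>) \<in> borel_measurable M" by simp
    fix \<omega> assume "\<omega> \<in> space M"
    have "Z \<omega> * (I \<omega> - J \<omega>) - Z \<omega> * Yl l \<omega> = Z \<omega> * A l \<omega>"
      by (simp add: A_def d_def algebra_simps)
    thus "\<bar>Z \<omega> * (I \<omega> - J \<omega>) - Z \<omega> * Yl l \<omega>\<bar> \<le> K * \<bar>A l \<omega>\<bar>"
      using K[OF \<open>\<omega> \<in> space M\<close>] by (simp add: abs_mult mult_right_mono)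
  qed
  have ind: "(\<lambda>p. indicator {s<..} (snd p) :: real) \<in> borel_measurable (horizon M T)"
    using horizon_measurable_time[of "indicator {s<..} :: real \<Rightarrow> real"] by (simp add: case_prod_beta')
  have Zh: "(\<lambda>p. Z (fst p)) \<in> borel_measurable (horizon M T)"
    using horizon_measurable_state[OF Zm] by (simp add: case_prod_beta')
  have sf: "sq_int (horizon M T) (\<lambda>(\<omega>, t). Z \<omega> * (indicator {s<..} t * f t \<omega>))"
  proof (rule sq_int_dominated[OF sq_int_cmult[OF f(1), of K]])
    show "(\<lambda>(\<omega>, t). Z \<omega> * (indicator {s<..} t * f t \<omega>)) \<in> borel_measurable (horizon M T)"
      using ind Zh f(1) unfolding case_prod_beta' sq_int_def by (intro borel_measurable_times) auto
    show "AE p in horizon M T. \<bar>case p of (\<omega>, t) \<Rightarrow> Z \<omega> * (indicator {s<..} t * f t \<omega>)\<bar> \<le> \<bar>K * ?c f p\<bar>"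
      using order_trans[OF K abs_ge_self]
      by (intro AE_I2) (auto simp: space_horizon abs_mult intro!: mult_right_mono split: split_indicator)
  qed
  have limf: "(\<lambda>l. \<integral>p. ((case p of (\<omega>, t) \<Rightarrow> Z \<omega> * (indicator {s<..} t * f t \<omega>))
      - (case p of (\<omega>, t) \<Rightarrow> Z \<omega> * (indicator {s<..} t * fl l t \<omega>)))\<^sup>2 \<partial>horizon M T) \<longlonglongrightarrow> 0"
  proof (rule L2_dominated_tendsto_0)
    show "sq_int (horizon M T) (\<lambda>p. ?c f p - ?c (fl l) p)" for l
      using f(1) elementary_sq_int(1)[OF e] by (rule sq_int_diff)
    show "(\<lambda>l. \<integral>p. (?c f p - ?c (fl l) p)\<^sup>2 \<partial>horizon M T) \<longlonglongrightarrow> 0"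
      using lf by (simp add: case_prod_beta')
    show "(\<lambda>p. (case p of (\<omega>, t) \<Rightarrow> Z \<omega> * (indicator {s<..} t * f t \<omega>))
      - (case p of (\<omega>, t) \<Rightarrow> Z \<omega> * (indicator {s<..} t * fl l t \<omega>))) \<in> borel_measurable (horizon M T)" for l
      using sf elementary_sq_int(1)[OF Yl[OF Z], of l] by (intro borel_measurable_diff) (auto simp: sq_int_def)
    fix l p assume "p \<in> space (horizon M T)"
    then obtain \<omega> t where p: "p = (\<omega>, t)" "\<omega> \<in> space M" by (auto simp: space_horizon)
    have "\<bar>Z \<omega> * (indicator {s<..} t * f t \<omega>) - Z \<omega> * (indicator {s<..} t * fl l t \<omega>)\<bar>
        = \<bar>Z \<omega>\<bar> * (indicator {s<..} t * \<bar>f t \<omega> - fl l t \<omega>\<bar>)"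
      by (auto simp: abs_mult right_diff_distrib[symmetric] split: split_indicator)
    also have "\<dots> \<le> K * \<bar>f t \<omega> - fl l t \<omega>\<bar>"
      using K[OF p(2)] by (intro mult_mono) (auto split: split_indicator intro: order_trans[OF abs_ge_zero])
    finally show "\<bar>(case p of (\<omega>, t) \<Rightarrow> Z \<omega> * (indicator {s<..} t * f t \<omega>))
      - (case p of (\<omega>, t) \<Rightarrow> Z \<omega> * (indicator {s<..} t * fl l t \<omega>))\<bar> \<le> K * \<bar>?c f p - ?c (fl l) p\<bar>"
      by (simp add: p)
  qed
  have sI: "sq_int M (\<lambda>\<omega>. Z \<omega> * (I \<omega> - J \<omega>))"
    by (rule bdd_meas_sq_int[OF Z sq_int_diff[OF f(2) J2]])
  have "(\<forall>l. elementary T (\<lambda>t \<omega>. Z \<omega> * (indicator {s<..} t * fl l t \<omega>)) (\<lambda>\<omega>. Z \<omega> * Yl l \<omega>)) \<and>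
      (\<lambda>l. \<integral>(\<omega>, t). (Z \<omega> * (indicator {s<..} t * f t \<omega>) - Z \<omega> * (indicator {s<..} t * fl l t \<omega>))\<^sup>2
        \<partial>horizon M T) \<longlonglongrightarrow> (0 :: real) \<and>
      (\<lambda>l. \<integral>\<omega>. (Z \<omega> * (I \<omega> - J \<omega>) - Z \<omega> * Yl l \<omega>)\<^sup>2 \<partial>M) \<longlonglongrightarrow> 0"
    using Yl[OF Z] limf limI by (simp add: case_prod_beta')
  hence "\<exists>fl Xl. (\<forall>l. elementary T (fl l) (Xl l)) \<and>
      (\<lambda>l. \<integral>(\<omega>, t). (Z \<omega> * (indicator {s<..} t * f t \<omega>) - fl l t \<omega>)\<^sup>2 \<partial>horizon M T) \<longlonglongrightarrow> (0 :: real) \<and>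
      (\<lambda>l. \<integral>\<omega>. (Z \<omega> * (I \<omega> - J \<omega>) - Xl l \<omega>)\<^sup>2 \<partial>M) \<longlonglongrightarrow> 0"
    by (intro exI[of _ "\<lambda>l t \<omega>. Z \<omega> * (indicator {s<..} t * fl l t \<omega>)"] exI[of _ "\<lambda>l \<omega>. Z \<omega> * Yl l \<omega>"])
  with sf sI show ?thesis unfolding ito_def by simp
qed

lemma sigma_finite_subalgebra_FF: "sigma_finite_subalgebra M (FF s)"
proof -
  interpret finite_measure_subalgebra M "FF s"
    by unfold_locales (rule subalgebra_FF)
  show ?thesis by unfold_locales
qed

text \<open>
  Taking indicators of events known at \<open>s\<close> as weights shows that the increment after \<open>s\<close> has
  conditional mean zero.
\<close>

lemma ito_increment_orthogonal:
  assumes I: "ito T f I" and J: "ito s f J" and s: "0 \<le> s" "s \<le> T"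
    and Y: "Y \<in> borel_measurable (FF s)" "integrable M (\<lambda>\<omega>. Y \<omega> * (I \<omega> - J \<omega>))"
  shows "(\<integral>\<omega>. Y \<omega> * (I \<omega> - J \<omega>) \<partial>M) = 0"
proof -
  interpret S: sigma_finite_subalgebra M "FF s" by (rule sigma_finite_subalgebra_FF)
  let ?N = "\<lambda>\<omega>. I \<omega> - J \<omega>"
  have N: "sq_int M ?N" using I J by (auto simp: ito_def intro: sq_int_diff)
  have "AE \<omega> in M. real_cond_exp M (FF s) ?N \<omega> = 0"
  proof (rule S.real_cond_exp_charact)
    fix G assume "G \<in> sets (FF s)"
    from ito_mean_zero[OF ito_increment[OF I J s bdd_meas_indicator[OF this]]]
    show "(\<integral>\<omega>\<in>G. ?N \<omega> \<partial>M) = (\<integral>\<omega>\<in>G. 0 \<partial>M)"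
      by (simp add: set_lebesgue_integral_def)
  qed (use sq_int_integrable[OF N] in auto)
  hence "(\<integral>\<omega>. Y \<omega> * real_cond_exp M (FF s) ?N \<omega> \<partial>M) = (\<integral>\<omega>. 0 \<partial>M)"
    using FF_M_measurable[OF Y(1)] by (intro integral_cong_AE) auto
  thus ?thesis
    using S.real_cond_exp_intg(2)[OF Y(2,1)] N by (simp add: sq_int_def)
qed

lemma ito_increment_covariance:
  assumes I: "ito T f I" "ito s f J" and I': "ito T g I'" "ito s g J'" and s: "0 \<le> s" "s \<le> T"
    and G: "G \<in> sets (FF s)"
  shows "(\<integral>\<omega>. indicator G \<omega> * ((I \<omega> - J \<omega>) * (I' \<omega> - J' \<omega>)) \<partial>M)
       = (\<integral>(\<omega>, t). indicator G \<omega> * (indicator {s<..} t * (f t \<omega> * g t \<omega>)) \<partial>horizon M T)"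
proof -
  have "(\<integral>\<omega>. (indicator G \<omega> * (I \<omega> - J \<omega>)) * (1 * (I' \<omega> - J' \<omega>)) \<partial>M)
      = (\<integral>(\<omega>, t). (indicator G \<omega> * (indicator {s<..} t * f t \<omega>)) * (1 * (indicator {s<..} t * g t \<omega>)) \<partial>horizon M T)"
    by (rule ito_isometry[OF ito_increment[OF I s bdd_meas_indicator[OF G]] ito_increment[OF I' s bdd_meas_const]])
  moreover have "(indicator G \<omega> * (indicator {s<..} t * f t \<omega>)) * (1 * (indicator {s<..} t * g t \<omega>))
      = indicator G \<omega> * (indicator {s<..} t * (f t \<omega> * g t \<omega>))" for \<omega> t
    by (auto split: split_indicator)
  ultimately show ?thesis by (simp only: mult_1_left mult.assoc)
qed

end

section \<open>The product rule in conditional mean\<close>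

lemma time_window_measurable: "f \<in> borel_measurable borel \<Longrightarrow> f \<in> borel_measurable (time_window T)"
  by (intro measurable_restrict_space1) simp

lemma AE_time_window_neq: "AE t in time_window T. t \<noteq> s"
  using AE_lborel_singleton[of s] by (subst AE_restrict_space_iff) auto

text \<open>
  Integration by parts for the running integrals: the square \<open>[0,T]\<^sup>2\<close> splits into the two triangles
  below and above its diagonal, which is a null set.
\<close>

lemma integral_mult_running:
  fixes \<phi> \<psi> :: "real \<Rightarrow> real"
  assumes \<phi>: "integrable (time_window T) \<phi>" and \<psi>: "integrable (time_window T) \<psi>"
  shows "(\<integral>t. \<phi> t \<partial>time_window T) * (\<integral>t. \<psi> t \<partial>time_window T)
       = (\<integral>s. (\<integral>t. indicator {..s} t * \<phi> t \<partial>time_window T) * \<psi> s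
           + (\<integral>t. indicator {..s} t * \<psi> t \<partial>time_window T) * \<phi> s \<partial>time_window T)"
proof -
  let ?K = "time_window T"
  interpret P: pair_sigma_finite ?K ?K
    by (intro pair_sigma_finite.intro finite_measure.axioms(1) finite_time_window)
  have m[measurable]: "\<phi> \<in> borel_measurable ?K" "\<psi> \<in> borel_measurable ?K"
    "(\<lambda>t. t) \<in> borel_measurable ?K"
    using \<phi> \<psi> by (auto intro: time_window_measurable)
  have fs: "fst \<in> borel_measurable (?K \<Otimes>\<^sub>M ?K)" "snd \<in> borel_measurable (?K \<Otimes>\<^sub>M ?K)"
    using measurable_compose[OF measurable_fst m(3)] measurable_compose[OF measurable_snd m(3)] by auto
  have prod: "integrable (?K \<Otimes>\<^sub>M ?K) (\<lambda>(t, s). \<phi> t * \<psi> s)"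
    using \<phi> \<psi> by (intro P.Fubini_integrable) (auto simp: abs_mult case_prod_beta')
  have le: "{p \<in> space (?K \<Otimes>\<^sub>M ?K). fst p \<le> snd p} \<in> sets (?K \<Otimes>\<^sub>M ?K)"
    using fs by (rule borel_measurable_le)
  have lt: "{p \<in> space (?K \<Otimes>\<^sub>M ?K). snd p < fst p} \<in> sets (?K \<Otimes>\<^sub>M ?K)"
    using fs(2,1) by (rule borel_measurable_less)
  have 1: "integrable (?K \<Otimes>\<^sub>M ?K) (\<lambda>(t, s). indicator {..s} t * \<phi> t * \<psi> s)"
    using integrable_mult_indicator[OF le prod]
    by (rule Bochner_Integration.integrable_cong[THEN iffD1, OF refl, rotated])
       (auto split: split_indicator)
  have 2: "integrable (?K \<Otimes>\<^sub>M ?K) (\<lambda>(t, s). indicator {..<t} s * \<psi> s * \<phi> t)"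
    using integrable_mult_indicator[OF lt prod]
    by (rule Bochner_Integration.integrable_cong[THEN iffD1, OF refl, rotated])
       (auto split: split_indicator)
  have strict: "(\<integral>s. indicator {..<t} s * \<psi> s \<partial>?K) = (\<integral>s. indicator {..t} s * \<psi> s \<partial>?K)" for t
  proof (rule integral_cong_AE)
    show "AE s in ?K. indicator {..<t} s * \<psi> s = indicator {..t} s * \<psi> s"
      using AE_time_window_neq[of t T] by eventually_elim (auto split: split_indicator)
    show "(\<lambda>s. indicator {..<t} s * \<psi> s) \<in> borel_measurable ?K" "(\<lambda>s. indicator {..t} s * \<psi> s) \<in> borel_measurable ?K"
      by (auto intro!: borel_measurable_times m time_window_measurable)
  qed
  have "(\<integral>t. \<phi> t \<partial>?K) * (\<integral>s. \<psi> s \<partial>?K) = (\<integral>t. (\<integral>s. \<phi> t * \<psi> s \<partial>?K) \<partial>?K)"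
    by simp
  also have "\<dots> = (\<integral>(t, s). \<phi> t * \<psi> s \<partial>(?K \<Otimes>\<^sub>M ?K))"
    by (rule P.integral_fst[OF prod])
  also have "\<dots> = (\<integral>p. (case p of (t, s) \<Rightarrow> indicator {..s} t * \<phi> t * \<psi> s)
      + (case p of (t, s) \<Rightarrow> indicator {..<t} s * \<psi> s * \<phi> t) \<partial>(?K \<Otimes>\<^sub>M ?K))"
    by (intro Bochner_Integration.integral_cong) (auto split: split_indicator)
  also have "\<dots> = (\<integral>(t, s). indicator {..s} t * \<phi> t * \<psi> s \<partial>(?K \<Otimes>\<^sub>M ?K))
      + (\<integral>(t, s). indicator {..<t} s * \<psi> s * \<phi> t \<partial>(?K \<Otimes>\<^sub>M ?K))"
    by (rule Bochner_Integration.integral_add[OF 1 2])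
  also have "(\<integral>(t, s). indicator {..s} t * \<phi> t * \<psi> s \<partial>(?K \<Otimes>\<^sub>M ?K))
      = (\<integral>s. (\<integral>t. indicator {..s} t * \<phi> t \<partial>?K) * \<psi> s \<partial>?K)"
    using P.integral_snd[OF 1] by simp
  also have "(\<integral>(t, s). indicator {..<t} s * \<psi> s * \<phi> t \<partial>(?K \<Otimes>\<^sub>M ?K))
      = (\<integral>t. (\<integral>s. indicator {..t} s * \<psi> s \<partial>?K) * \<phi> t \<partial>?K)"
    using P.integral_fst[OF 2] by (simp add: strict)
  also have "(\<integral>s. (\<integral>t. indicator {..s} t * \<phi> t \<partial>?K) * \<psi> s \<partial>?K)
      + (\<integral>t. (\<integral>s. indicator {..t} s * \<psi> s \<partial>?K) * \<phi> t \<partial>?K)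
      = (\<integral>s. (\<integral>t. indicator {..s} t * \<phi> t \<partial>?K) * \<psi> s
           + (\<integral>t. indicator {..s} t * \<psi> t \<partial>?K) * \<phi> s \<partial>?K)"
    using P.integrable_snd[OF 1] P.integrable_fst[OF 2]
    by (subst Bochner_Integration.integral_add) (simp_all add: strict)
  finally show ?thesis .
qed

context brownian
begin

definition running :: "real \<Rightarrow> ('w \<times> real \<Rightarrow> real) \<Rightarrow> 'w \<times> real \<Rightarrow> real" where
  "running T \<beta> = (\<lambda>(\<omega>, s). \<integral>t. indicator {..s} t * \<beta> (\<omega>, t) \<partial>time_window T)"

lemma running_at_T: "running T \<beta> (\<omega>, T) = (\<integral>t. \<beta> (\<omega>, t) \<partial>time_window T)"
  unfolding running_def by (auto simp: space_restrict_space intro!: Bochner_Integration.integral_cong)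

lemma section_measurable:
  assumes "\<beta> \<in> borel_measurable (horizon M T)" "\<omega> \<in> space M"
  shows "(\<lambda>t. \<beta> (\<omega>, t)) \<in> borel_measurable (time_window T)"
  using assms unfolding horizon_def by simp

lemma AE_section_sq_int:
  assumes "sq_int (horizon M T) \<beta>"
  shows "AE \<omega> in M. sq_int (time_window T) (\<lambda>t. \<beta> (\<omega>, t))"
proof -
  interpret P: pair_sigma_finite M "time_window T" by (rule pair_sigma_finite_horizon)
  have "AE \<omega> in M. integrable (time_window T) (\<lambda>t. (\<beta> (\<omega>, t))\<^sup>2)"
    using assms unfolding sq_int_def horizon_def by (intro P.AE_integrable_fst') simp
  with AE_space show ?thesis
    by eventually_elim (use assms section_measurable in \<open>auto simp: sq_int_def\<close>)
qed

lemma AE_state_sq_int: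
  assumes "sq_int (horizon M T) \<beta>"
  shows "AE t in time_window T. sq_int M (\<lambda>\<omega>. \<beta> (\<omega>, t))"
proof -
  interpret P: pair_sigma_finite M "time_window T" by (rule pair_sigma_finite_horizon)
  have m: "\<beta> \<in> borel_measurable (M \<Otimes>\<^sub>M time_window T)"
    "integrable (M \<Otimes>\<^sub>M time_window T) (\<lambda>p. (\<beta> p)\<^sup>2)"
    using assms by (auto simp: sq_int_def horizon_def)
  have "AE t in time_window T. integrable M (\<lambda>\<omega>. (\<beta> (\<omega>, t))\<^sup>2)"
    using m(2) by (intro P.AE_integrable_snd) (simp add: case_prod_beta')
  with AE_space show ?thesis
    by eventually_elim (use m in \<open>auto simp: sq_int_def\<close>)
qed

lemma running_measurable:
  assumes \<beta>: "\<beta> \<in> borel_measurable (horizon M T)"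
  shows "running T \<beta> \<in> borel_measurable (horizon M T)"
proof -
  interpret K: sigma_finite_measure "time_window T"
    using finite_time_window by (rule finite_measure.axioms(1))
  let ?H = "horizon M T" and ?K = "time_window T"
  have id: "(\<lambda>t. t) \<in> borel_measurable ?K" by (rule time_window_measurable) simp
  have sndH: "snd \<in> measurable ?H ?K" and fstH: "fst \<in> measurable ?H M" unfolding horizon_def by auto
  have s: "(\<lambda>x. snd (fst x)) \<in> borel_measurable (?H \<Otimes>\<^sub>M ?K)" "snd \<in> borel_measurable (?H \<Otimes>\<^sub>M ?K)"
    using measurable_compose[OF measurable_compose[OF measurable_fst sndH] id]
      measurable_compose[OF measurable_snd id] by auto
  have "(\<lambda>x. (fst (fst x), snd x)) \<in> measurable (?H \<Otimes>\<^sub>M ?K) ?H"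
    unfolding horizon_def[of M T, symmetric]
    by (subst (2) horizon_def, rule measurable_Pair[OF measurable_compose[OF measurable_fst fstH] measurable_snd])
  from measurable_compose[OF this \<beta>]
  have b: "(\<lambda>x. \<beta> (fst (fst x), snd x)) \<in> borel_measurable (?H \<Otimes>\<^sub>M ?K)" .
  have "(\<lambda>x. (if snd x \<le> snd (fst x) then 1 else 0) * \<beta> (fst (fst x), snd x)) \<in> borel_measurable (?H \<Otimes>\<^sub>M ?K)"
    by (intro borel_measurable_times b measurable_If borel_measurable_le s measurable_const) auto
  also have "(\<lambda>x. (if snd x \<le> snd (fst x) then 1 else 0) * \<beta> (fst (fst x), snd x))
      = (\<lambda>(p, t). indicator {..snd p} t * \<beta> (fst p, t))"
    by (auto simp: fun_eq_iff)
  finally have "(\<lambda>p. \<integral>t. indicator {..snd p} t * \<beta> (fst p, t) \<partial>?K) \<in> borel_measurable ?H"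
    by (rule K.borel_measurable_lebesgue_integral)
  thus ?thesis unfolding running_def by (simp add: case_prod_beta')
qed

text \<open>
  By the Cauchy-Schwarz inequality in time, the running integral is bounded, uniformly in its end
  point, by the mean square of \<open>\<beta>\<close> over the whole window.
\<close>

lemma running_sq_int:
  assumes \<beta>: "sq_int (horizon M T) \<beta>"
  shows "sq_int (horizon M T) (running T \<beta>)" "s \<in> {0..T} \<Longrightarrow> sq_int M (\<lambda>\<omega>. running T \<beta> (\<omega>, s))"
proof -
  interpret P: pair_sigma_finite M "time_window T" by (rule pair_sigma_finite_horizon)
  interpret K: finite_measure "time_window T" by (rule finite_time_window)
  let ?K = "time_window T" and ?H = "horizon M T"
  let ?S = "\<lambda>\<omega>. \<integral>t. (\<beta> (\<omega>, t))\<^sup>2 \<partial>?K"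
  let ?k = "measure ?K (space ?K)"
  have m: "running T \<beta> \<in> borel_measurable ?H"
    by (rule running_measurable) (use \<beta> in \<open>simp add: sq_int_def\<close>)
  have S: "integrable M ?S"
    using \<beta> unfolding sq_int_def horizon_def by (intro P.integrable_fst') simp
  have bound: "AE \<omega> in M. \<forall>s. (running T \<beta> (\<omega>, s))\<^sup>2 \<le> ?k * ?S \<omega>"
    using AE_section_sq_int[OF \<beta>]
  proof eventually_elim
    fix \<omega> assume sec: "sq_int ?K (\<lambda>t. \<beta> (\<omega>, t))"
    show "\<forall>s. (running T \<beta> (\<omega>, s))\<^sup>2 \<le> ?k * ?S \<omega>"
    proof
      fix s
      have i: "sq_int ?K (indicator {..s})"
        by (rule K.sq_int_bounded[of _ 1]) (auto intro: time_window_measurable split: split_indicator)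
      have "(running T \<beta> (\<omega>, s))\<^sup>2 \<le> (sqrt (\<integral>t. (indicator {..s} t)\<^sup>2 \<partial>?K) * sqrt (?S \<omega>))\<^sup>2"
        using L2_Cauchy_Schwarz[OF i sec] unfolding running_def by (simp add: abs_le_square_iff[symmetric])
      also have "\<dots> = (\<integral>t. (indicator {..s} t)\<^sup>2 \<partial>?K) * ?S \<omega>"
        by (simp add: power_mult_distrib integral_nonneg_AE)
      also have "\<dots> \<le> (\<integral>t. 1 \<partial>?K) * ?S \<omega>"
        using i by (intro mult_right_mono integral_mono) (auto simp: sq_int_def split: split_indicator)
      finally show "(running T \<beta> (\<omega>, s))\<^sup>2 \<le> ?k * ?S \<omega>" by simp
    qed
  qed
  show "sq_int M (\<lambda>\<omega>. running T \<beta> (\<omega>, s))" if s: "s \<in> {0..T}"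
    unfolding sq_int_def
  proof
    show ms: "(\<lambda>\<omega>. running T \<beta> (\<omega>, s)) \<in> borel_measurable M"
      using measurable_compose[OF measurable_Pair2'[of s] m[unfolded horizon_def]] s
      by (simp add: space_restrict_space)
    show "integrable M (\<lambda>\<omega>. (running T \<beta> (\<omega>, s))\<^sup>2)"
    proof (rule Bochner_Integration.integrable_bound)
      show "integrable M (\<lambda>\<omega>. ?k * ?S \<omega>)" using S by simp
      show "AE \<omega> in M. norm ((running T \<beta> (\<omega>, s))\<^sup>2) \<le> norm (?k * ?S \<omega>)"
        using bound by eventually_elim (auto intro: order_trans[OF _ abs_ge_self])
    qed (use ms in simp)
  qed
  have SH: "(\<lambda>p. ?k * ?S (fst p)) \<in> borel_measurable ?H" "integrable ?H (\<lambda>p. ?k * ?S (fst p))"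
  proof -
    show ms: "(\<lambda>p. ?k * ?S (fst p)) \<in> borel_measurable ?H"
      using horizon_measurable_state[of "\<lambda>\<omega>. ?k * ?S \<omega>" T] S by (simp add: case_prod_beta')
    show "integrable ?H (\<lambda>p. ?k * ?S (fst p))"
      unfolding horizon_def
      by (rule P.Fubini_integrable) (use ms S in \<open>auto simp: horizon_def abs_mult\<close>)
  qed
  have "AE p in ?H. (running T \<beta> p)\<^sup>2 \<le> ?k * ?S (fst p)"
    unfolding horizon_def
  proof (rule P.AE_pair_measure)
    show "{p \<in> space (M \<Otimes>\<^sub>M ?K). (running T \<beta> p)\<^sup>2 \<le> ?k * ?S (fst p)} \<in> sets (M \<Otimes>\<^sub>M ?K)"
      using m SH(1) unfolding horizon_def by (intro borel_measurable_le borel_measurable_power)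
    show "AE \<omega> in M. AE s in ?K. (running T \<beta> (\<omega>, s))\<^sup>2 \<le> ?k * ?S (fst (\<omega>, s))"
      using bound by eventually_elim simp
  qed
  hence "integrable ?H (\<lambda>p. (running T \<beta> p)\<^sup>2)"
    using SH(2) m by (intro Bochner_Integration.integrable_bound[OF SH(2)])
      (auto elim!: eventually_mono intro: order_trans[OF _ abs_ge_self])
  thus "sq_int ?H (running T \<beta>)" using m by (simp add: sq_int_def)
qed


lemma FF_indicator_measurable: "G \<in> sets (FF s) \<Longrightarrow> indicator G \<in> borel_measurable M"
  using subalgebra_FF unfolding subalgebra_def by (intro borel_measurable_indicator) auto

lemma sq_int_indicator_mult:
  assumes G: "G \<in> sets (FF s)" and f: "sq_int M f"
  shows "sq_int M (\<lambda>\<omega>. indicator G \<omega> * f \<omega>)"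
  using bdd_meas_sq_int[OF bdd_meas_indicator[OF G] f] .

lemma sq_int_horizon_state_mult:
  assumes G: "G \<in> sets (FF s)" and f: "sq_int (horizon M T) f"
  shows "sq_int (horizon M T) (\<lambda>p. indicator G (fst p) * f p)"
proof (rule sq_int_dominated[OF f])
  show "(\<lambda>p. indicator G (fst p) * f p) \<in> borel_measurable (horizon M T)"
    using horizon_measurable_state[OF FF_indicator_measurable[OF G], of T] f
    by (intro borel_measurable_times) (auto simp: case_prod_beta' sq_int_def)
qed (auto split: split_indicator)

lemma sq_int_horizon_time_mult:
  assumes f: "sq_int (horizon M T) f"
  shows "sq_int (horizon M T) (\<lambda>p. indicator {a<..} (snd p) * f p)"
proof (rule sq_int_dominated[OF f])
  show "(\<lambda>p. indicator {a<..} (snd p) * f p) \<in> borel_measurable (horizon M T)"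
    using horizon_measurable_time[of "indicator {a<..} :: real \<Rightarrow> real" T] f
    by (intro borel_measurable_times) (auto simp: case_prod_beta' sq_int_def)
qed (auto split: split_indicator)

lemma sq_int_horizon_state:
  assumes "sq_int M f" shows "sq_int (horizon M T) (\<lambda>p. f (fst p))"
  using horizon_integral_product(1)[OF assms, of "\<lambda>_. 1" 1] by (simp add: case_prod_beta')

lemma horizon_iterated:
  fixes h :: "'w \<times> real \<Rightarrow> real"
  assumes "integrable (horizon M T) h"
  shows "(\<integral>p. h p \<partial>horizon M T) = (\<integral>\<omega>. (\<integral>t. h (\<omega>, t) \<partial>time_window T) \<partial>M)"
    "(\<integral>p. h p \<partial>horizon M T) = (\<integral>t. (\<integral>\<omega>. h (\<omega>, t) \<partial>M) \<partial>time_window T)"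
    "integrable M (\<lambda>\<omega>. \<integral>t. h (\<omega>, t) \<partial>time_window T)"
    "(\<lambda>t. \<integral>\<omega>. h (\<omega>, t) \<partial>M) \<in> borel_measurable (time_window T)"
proof -
  interpret P: pair_sigma_finite M "time_window T" by (rule pair_sigma_finite_horizon)
  have h: "integrable (M \<Otimes>\<^sub>M time_window T) h" using assms by (simp add: horizon_def)
  have h': "integrable (M \<Otimes>\<^sub>M time_window T) (\<lambda>(\<omega>, t). h (\<omega>, t))" using h by simp
  show "(\<integral>p. h p \<partial>horizon M T) = (\<integral>\<omega>. (\<integral>t. h (\<omega>, t) \<partial>time_window T) \<partial>M)"
    using P.integral_fst'[OF h] by (simp add: horizon_def)
  show "(\<integral>p. h p \<partial>horizon M T) = (\<integral>t. (\<integral>\<omega>. h (\<omega>, t) \<partial>M) \<partial>time_window T)"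
    using P.integral_snd[OF h'] by (simp add: horizon_def)
  show "integrable M (\<lambda>\<omega>. \<integral>t. h (\<omega>, t) \<partial>time_window T)"
    by (rule P.integrable_fst'[OF h])
  show "(\<lambda>t. \<integral>\<omega>. h (\<omega>, t) \<partial>M) \<in> borel_measurable (time_window T)"
    using P.integrable_snd[OF h'] by simp
qed

text \<open>
  A real process on \<open>[0,T]\<close> with drift \<open>b\<close> and diffusion \<open>f\<close>. The equation is required at each time
  almost surely, with a version of the Ito integral that may change from time to time.
\<close>

definition ito_process ::
    "real \<Rightarrow> (real \<Rightarrow> 'w \<Rightarrow> real) \<Rightarrow> (real \<Rightarrow> 'w \<Rightarrow> real) \<Rightarrow> (real \<Rightarrow> 'w \<Rightarrow> real) \<Rightarrow> bool" where
  "ito_process T y b f \<longleftrightarrow>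
     (\<forall>t\<in>{0..T}. y t \<in> borel_measurable (FF t) \<and> b t \<in> borel_measurable (FF t)) \<and>
     sq_int (horizon M T) (\<lambda>(\<omega>, t). y t \<omega>) \<and> sq_int (horizon M T) (\<lambda>(\<omega>, t). b t \<omega>) \<and>
     (\<exists>y0. \<forall>t\<in>{0..T}. \<exists>J. ito t f J \<and>
        (AE \<omega> in M. y t \<omega> = y0 + running T (\<lambda>(\<omega>, t). b t \<omega>) (\<omega>, t) + J \<omega>))"

lemma ito_process_sq_int:
  assumes Y: "ito_process T y b f" and t: "t \<in> {0..T}"
  shows "sq_int M (y t)"
proof -
  from assms obtain y0 J where J: "ito t f J"
    and eq: "AE \<omega> in M. y t \<omega> = y0 + running T (\<lambda>(\<omega>, t). b t \<omega>) (\<omega>, t) + J \<omega>"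
    and m: "y t \<in> borel_measurable (FF t)" and b: "sq_int (horizon M T) (\<lambda>(\<omega>, t). b t \<omega>)"
    unfolding ito_process_def by blast
  have "sq_int M (\<lambda>\<omega>. y0 + running T (\<lambda>(\<omega>, t). b t \<omega>) (\<omega>, t) + J \<omega>)"
    using J bdd_meas_integrable(2)[OF bdd_meas_const] unfolding ito_def
    by (intro sq_int_add running_sq_int(2)[OF b t]) auto
  thus ?thesis
    by (rule sq_int_dominated) (use FF_M_measurable[OF m] eq in auto)
qed

lemma ito_process_increment:
  assumes Y: "ito_process T y b f" and a: "0 \<le> a" "a \<le> T"
  shows "\<exists>J. \<forall>s\<in>{a..T}. ito s f (J s) \<and> (AE \<omega> in M. y s \<omega> - y a \<omega> =
       running T (\<lambda>(\<omega>, t). indicator {a<..} t * b t \<omega>) (\<omega>, s) + (J s \<omega> - J a \<omega>))"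
proof -
  obtain y0 where "\<forall>t\<in>{0..T}. \<exists>J. ito t f J \<and>
        (AE \<omega> in M. y t \<omega> = y0 + running T (\<lambda>(\<omega>, t). b t \<omega>) (\<omega>, t) + J \<omega>)"
    and b: "sq_int (horizon M T) (\<lambda>(\<omega>, t). b t \<omega>)"
    using Y unfolding ito_process_def by blast
  from bchoice[OF this(1)] obtain J where "\<forall>t\<in>{0..T}. ito t f (J t) \<and>
        (AE \<omega> in M. y t \<omega> = y0 + running T (\<lambda>(\<omega>, t). b t \<omega>) (\<omega>, t) + J t \<omega>)" ..
  hence J: "\<And>t. t \<in> {0..T} \<Longrightarrow> ito t f (J t)"
    and eq: "\<And>t. t \<in> {0..T} \<Longrightarrow> AE \<omega> in M. y t \<omega> = y0 + running T (\<lambda>(\<omega>, t). b t \<omega>) (\<omega>, t) + J t \<omega>"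
    by blast+
  interpret K: finite_measure "time_window T" by (rule finite_time_window)
  show ?thesis
  proof (intro exI[of _ J] ballI conjI)
    fix s assume "s \<in> {a..T}"
    hence s: "a \<le> s" "s \<le> T" by auto
    show "ito s f (J s)" using J s a by auto
    have "AE \<omega> in M. y s \<omega> = y0 + running T (\<lambda>(\<omega>, t). b t \<omega>) (\<omega>, s) + J s \<omega>"
      "AE \<omega> in M. y a \<omega> = y0 + running T (\<lambda>(\<omega>, t). b t \<omega>) (\<omega>, a) + J a \<omega>"
      using eq s a by auto
    thus "AE \<omega> in M. y s \<omega> - y a \<omega> =
       running T (\<lambda>(\<omega>, t). indicator {a<..} t * b t \<omega>) (\<omega>, s) + (J s \<omega> - J a \<omega>)"
      using AE_section_sq_int[OF b]
    proof eventually_elim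
      fix \<omega> assume e: "y s \<omega> = y0 + running T (\<lambda>(\<omega>, t). b t \<omega>) (\<omega>, s) + J s \<omega>"
        "y a \<omega> = y0 + running T (\<lambda>(\<omega>, t). b t \<omega>) (\<omega>, a) + J a \<omega>"
        and "sq_int (time_window T) (\<lambda>t. case (\<omega>, t) of (\<omega>, t) \<Rightarrow> b t \<omega>)"
      hence i: "integrable (time_window T) (\<lambda>t. b t \<omega>)"
        by (auto intro: K.sq_int_integrable)
      have ii: "integrable (time_window T) (\<lambda>t. indicator {..r} t * b t \<omega>)" for r
        using i by (intro Bochner_Integration.integrable_bound[OF i])
          (auto intro!: borel_measurable_times time_window_measurable[of "indicator {..r}"]
            split: split_indicator)
      have "running T (\<lambda>(\<omega>, t). indicator {a<..} t * b t \<omega>) (\<omega>, s)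
          = (\<integral>t. indicator {..s} t * b t \<omega> - indicator {..a} t * b t \<omega> \<partial>time_window T)"
        unfolding running_def using s
        by (auto intro!: Bochner_Integration.integral_cong split: split_indicator)
      also have "\<dots> = running T (\<lambda>(\<omega>, t). b t \<omega>) (\<omega>, s) - running T (\<lambda>(\<omega>, t). b t \<omega>) (\<omega>, a)"
        unfolding running_def using ii by simp
      finally show "y s \<omega> - y a \<omega> =
          running T (\<lambda>(\<omega>, t). indicator {a<..} t * b t \<omega>) (\<omega>, s) + (J s \<omega> - J a \<omega>)"
        using e by simp
    qed
  qed
qed

text \<open>
  The martingale part of \<open>y\<close> over \<open>[a,T]\<close> paired with an integral over time: at each time \<open>s\<close> its
  increment after \<open>s\<close> is orthogonal to the integrand, which is known at \<open>s\<close>, so only the increment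
  up to \<open>s\<close> counts.
\<close>

lemma martingale_part_times_drift:
  assumes Y: "ito_process T y b f" and a: "0 \<le> a" "a \<le> T" and G: "G \<in> sets (FF a)"
    and c: "sq_int (horizon M T) (\<lambda>(\<omega>, t). c t \<omega>)" "\<And>t. t \<in> {0..T} \<Longrightarrow> c t \<in> borel_measurable (FF t)"
  defines "\<beta> \<equiv> \<lambda>(\<omega>, t). indicator {a<..} t * b t \<omega>" and "\<psi> \<equiv> \<lambda>(\<omega>, t). indicator {a<..} t * c t \<omega>"
  shows "(\<integral>\<omega>. indicator G \<omega> * (y T \<omega> - y a \<omega> - running T \<beta> (\<omega>, T)) * running T \<psi> (\<omega>, T) \<partial>M)
       = (\<integral>(\<omega>, s). indicator G \<omega> * (y s \<omega> - y a \<omega> - running T \<beta> (\<omega>, s)) * \<psi> (\<omega>, s) \<partial>horizon M T)"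
proof -
  let ?K = "time_window T" and ?H = "horizon M T"
  from ito_process_increment[OF Y a, folded \<beta>_def] obtain J where
    "\<forall>s\<in>{a..T}. ito s f (J s) \<and> (AE \<omega> in M. y s \<omega> - y a \<omega> = running T \<beta> (\<omega>, s) + (J s \<omega> - J a \<omega>))" ..
  hence J: "\<And>s. a \<le> s \<Longrightarrow> s \<le> T \<Longrightarrow> ito s f (J s)"
    and inc: "\<And>s. a \<le> s \<Longrightarrow> s \<le> T \<Longrightarrow> AE \<omega> in M. y s \<omega> - y a \<omega> = running T \<beta> (\<omega>, s) + (J s \<omega> - J a \<omega>)"
    by auto
  have b: "sq_int ?H (\<lambda>(\<omega>, t). b t \<omega>)" and yH: "sq_int ?H (\<lambda>(\<omega>, t). y t \<omega>)"
    using Y unfolding ito_process_def by blast+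
  have \<beta>: "sq_int ?H \<beta>" and \<psi>: "sq_int ?H \<psi>"
    using sq_int_horizon_time_mult[OF b, of a] sq_int_horizon_time_mult[OF c(1), of a]
    unfolding \<beta>_def \<psi>_def by (simp_all add: case_prod_beta')
  define N where "N = (\<lambda>p. y (snd p) (fst p) - y a (fst p) - running T \<beta> p)"
  have ya: "sq_int M (y a)" and yT: "sq_int M (y T)"
    using ito_process_sq_int[OF Y] a by auto
  have NH: "sq_int ?H N"
    unfolding N_def using yH sq_int_horizon_state[OF ya] running_sq_int(1)[OF \<beta>]
    by (intro sq_int_diff) (auto simp: case_prod_beta')
  have NT: "sq_int M (\<lambda>\<omega>. N (\<omega>, T))"
    unfolding N_def fst_conv snd_conv
    using a by (intro sq_int_diff ya yT running_sq_int(2)[OF \<beta>]) auto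
  have i1: "integrable ?H (\<lambda>p. (indicator G (fst p) * N (fst p, T)) * \<psi> p)"
    by (intro sq_int_mult_integrable \<psi> sq_int_horizon_state_mult[OF G] sq_int_horizon_state[OF NT])
  have i2: "integrable ?H (\<lambda>p. (indicator G (fst p) * N p) * \<psi> p)"
    by (intro sq_int_mult_integrable \<psi> sq_int_horizon_state_mult[OF G] NH)
  have "(\<integral>\<omega>. indicator G \<omega> * N (\<omega>, T) * running T \<psi> (\<omega>, T) \<partial>M)
      = (\<integral>\<omega>. (\<integral>t. (indicator G \<omega> * N (\<omega>, T)) * \<psi> (\<omega>, t) \<partial>?K) \<partial>M)"
    by (simp add: running_at_T)
  also have "\<dots> = (\<integral>t. (\<integral>\<omega>. (indicator G \<omega> * N (\<omega>, T)) * \<psi> (\<omega>, t) \<partial>M) \<partial>?K)"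
    using horizon_iterated(1,2)[OF i1] by simp
  also have "\<dots> = (\<integral>t. (\<integral>\<omega>. (indicator G \<omega> * N (\<omega>, t)) * \<psi> (\<omega>, t) \<partial>M) \<partial>?K)"
  proof (rule integral_cong_AE)
    show "(\<lambda>t. \<integral>\<omega>. (indicator G \<omega> * N (\<omega>, T)) * \<psi> (\<omega>, t) \<partial>M) \<in> borel_measurable ?K"
      "(\<lambda>t. \<integral>\<omega>. (indicator G \<omega> * N (\<omega>, t)) * \<psi> (\<omega>, t) \<partial>M) \<in> borel_measurable ?K"
      using horizon_iterated(4)[OF i1] horizon_iterated(4)[OF i2] by simp_all
    show "AE t in ?K. (\<integral>\<omega>. (indicator G \<omega> * N (\<omega>, T)) * \<psi> (\<omega>, t) \<partial>M)
        = (\<integral>\<omega>. (indicator G \<omega> * N (\<omega>, t)) * \<psi> (\<omega>, t) \<partial>M)"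
      using AE_state_sq_int[OF \<psi>] AE_state_sq_int[OF NH] AE_space
    proof eventually_elim
      fix t assume \<psi>t: "sq_int M (\<lambda>\<omega>. \<psi> (\<omega>, t))" and Nt: "sq_int M (\<lambda>\<omega>. N (\<omega>, t))"
        and "t \<in> space ?K"
      hence t: "0 \<le> t" "t \<le> T" by (auto simp: space_restrict_space)
      show "(\<integral>\<omega>. (indicator G \<omega> * N (\<omega>, T)) * \<psi> (\<omega>, t) \<partial>M)
        = (\<integral>\<omega>. (indicator G \<omega> * N (\<omega>, t)) * \<psi> (\<omega>, t) \<partial>M)"
      proof (cases "a < t")
        case False
        thus ?thesis by (simp add: \<psi>_def)
      next
        case True
        have Gt: "G \<in> sets (FF t)" using G sets_FF_mono[of a t] True by auto
        let ?Y = "\<lambda>\<omega>. indicator G \<omega> * \<psi> (\<omega>, t)"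
        have Ym: "?Y \<in> borel_measurable (FF t)"
          using c(2)[of t] t Gt unfolding \<psi>_def
          by (auto intro!: borel_measurable_times borel_measurable_indicator)
        have dJ: "sq_int M (\<lambda>\<omega>. J T \<omega> - J t \<omega>)"
          using J[of T] J[of t] True t a by (auto simp: ito_def intro: sq_int_diff)
        have i: "integrable M (\<lambda>\<omega>. ?Y \<omega> * (J T \<omega> - J t \<omega>))"
          by (intro sq_int_mult_integrable dJ sq_int_indicator_mult[OF G] \<psi>t)
        have zero: "(\<integral>\<omega>. ?Y \<omega> * (J T \<omega> - J t \<omega>) \<partial>M) = 0"
          by (rule ito_increment_orthogonal[where f = f, OF _ _ _ _ Ym i]) (use J True t a in auto)
        have it: "integrable M (\<lambda>\<omega>. (indicator G \<omega> * N (\<omega>, t)) * \<psi> (\<omega>, t))"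
          by (intro sq_int_mult_integrable \<psi>t sq_int_indicator_mult[OF G] Nt)
        have iT: "integrable M (\<lambda>\<omega>. (indicator G \<omega> * N (\<omega>, T)) * \<psi> (\<omega>, t))"
          by (intro sq_int_mult_integrable \<psi>t sq_int_indicator_mult[OF G] NT)
        have "AE \<omega> in M. N (\<omega>, T) = N (\<omega>, t) + (J T \<omega> - J t \<omega>)"
        proof -
          have "AE \<omega> in M. y T \<omega> - y a \<omega> = running T \<beta> (\<omega>, T) + (J T \<omega> - J a \<omega>)"
            "AE \<omega> in M. y t \<omega> - y a \<omega> = running T \<beta> (\<omega>, t) + (J t \<omega> - J a \<omega>)"
            using inc True t a by auto
          thus ?thesis by eventually_elim (simp add: N_def)
        qed
        hence "(\<integral>\<omega>. (indicator G \<omega> * N (\<omega>, T)) * \<psi> (\<omega>, t) \<partial>M)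
            = (\<integral>\<omega>. (indicator G \<omega> * N (\<omega>, t)) * \<psi> (\<omega>, t) + ?Y \<omega> * (J T \<omega> - J t \<omega>) \<partial>M)"
        proof (intro integral_cong_AE)
          assume "AE \<omega> in M. N (\<omega>, T) = N (\<omega>, t) + (J T \<omega> - J t \<omega>)"
          thus "AE \<omega> in M. (indicator G \<omega> * N (\<omega>, T)) * \<psi> (\<omega>, t)
              = (indicator G \<omega> * N (\<omega>, t)) * \<psi> (\<omega>, t) + ?Y \<omega> * (J T \<omega> - J t \<omega>)"
            by eventually_elim algebra
        qed (intro borel_measurable_integrable Bochner_Integration.integrable_add iT it i)+
        also have "\<dots> = (\<integral>\<omega>. (indicator G \<omega> * N (\<omega>, t)) * \<psi> (\<omega>, t) \<partial>M)"
          using it i zero by simp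
        finally show ?thesis .
      qed
    qed
  qed
  also have "\<dots> = (\<integral>p. (indicator G (fst p) * N p) * \<psi> p \<partial>?H)"
    using horizon_iterated(2)[OF i2] by simp
  finally show ?thesis unfolding N_def by (simp add: case_prod_beta')
qed


text \<open>
  Over \<open>(a,T]\<close> write each process as its value at \<open>a\<close> plus a drift integral plus a martingale part and
  multiply out. Values at \<open>a\<close> times martingale parts vanish in mean. The product of the martingale
  parts is given by the isometry, the product of the drift integrals by integration by parts, and the
  mixed products by \<open>martingale_part_times_drift\<close>; the running integrals of the last two cancel. Fubini's theorem
  replaces the usual limit over partitions.
\<close>

theorem ito_product_rule:
  assumes Y: "ito_process T y b f" and Z: "ito_process T z c g" and a: "0 \<le> a" "a \<le> T"
    and G: "G \<in> sets (FF a)"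
  shows "(\<integral>\<omega>. indicator G \<omega> * (y T \<omega> * z T \<omega> - y a \<omega> * z a \<omega>) \<partial>M)
       = (\<integral>(\<omega>, t). indicator G \<omega> * (indicator {a<..} t *
            (y t \<omega> * c t \<omega> + z t \<omega> * b t \<omega> + f t \<omega> * g t \<omega>)) \<partial>horizon M T)"
proof -
  let ?H = "horizon M T"
  define \<beta> where "\<beta> = (\<lambda>(\<omega>, t). indicator {a<..} t * b t \<omega> :: real)"
  define \<psi> where "\<psi> = (\<lambda>(\<omega>, t). indicator {a<..} t * c t \<omega> :: real)"
  from ito_process_increment[OF Y a, folded \<beta>_def] obtain J where J:
    "\<forall>s\<in>{a..T}. ito s f (J s) \<and> (AE \<omega> in M. y s \<omega> - y a \<omega> = running T \<beta> (\<omega>, s) + (J s \<omega> - J a \<omega>))" ..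
  from ito_process_increment[OF Z a, folded \<psi>_def] obtain J' where J':
    "\<forall>s\<in>{a..T}. ito s g (J' s) \<and> (AE \<omega> in M. z s \<omega> - z a \<omega> = running T \<psi> (\<omega>, s) + (J' s \<omega> - J' a \<omega>))" ..
  have yH: "sq_int ?H (\<lambda>(\<omega>, t). y t \<omega>)" and b: "sq_int ?H (\<lambda>(\<omega>, t). b t \<omega>)"
    and zH: "sq_int ?H (\<lambda>(\<omega>, t). z t \<omega>)" and c: "sq_int ?H (\<lambda>(\<omega>, t). c t \<omega>)"
    and bm: "\<And>t. t \<in> {0..T} \<Longrightarrow> b t \<in> borel_measurable (FF t)"
    and cm: "\<And>t. t \<in> {0..T} \<Longrightarrow> c t \<in> borel_measurable (FF t)"
    and yam: "y a \<in> borel_measurable (FF a)" and zam: "z a \<in> borel_measurable (FF a)"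
    using Y Z a unfolding ito_process_def by auto
  have fH: "sq_int ?H (\<lambda>(\<omega>, t). f t \<omega>)" and gH: "sq_int ?H (\<lambda>(\<omega>, t). g t \<omega>)"
    using J J' a unfolding ito_def by auto
  have \<beta>: "sq_int ?H \<beta>" and \<psi>: "sq_int ?H \<psi>"
    using sq_int_horizon_time_mult[OF b, of a] sq_int_horizon_time_mult[OF c, of a]
    unfolding \<beta>_def \<psi>_def by (simp_all add: case_prod_beta')
  have sq: "sq_int M (y a)" "sq_int M (z a)" "sq_int M (y T)" "sq_int M (z T)"
    using a by (auto intro: ito_process_sq_int[OF Y] ito_process_sq_int[OF Z])
  define B where "B = (\<lambda>\<omega>. running T \<beta> (\<omega>, T))"
  define C where "C = (\<lambda>\<omega>. running T \<psi> (\<omega>, T))"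
  define N where "N = (\<lambda>\<omega>. y T \<omega> - y a \<omega> - B \<omega>)"
  define N' where "N' = (\<lambda>\<omega>. z T \<omega> - z a \<omega> - C \<omega>)"
  have BC: "sq_int M B" "sq_int M C"
    unfolding B_def C_def using a by (auto intro: running_sq_int(2) \<beta> \<psi>)
  have NN: "sq_int M N" "sq_int M N'"
    unfolding N_def N'_def by (intro sq_int_diff sq BC)+
  have NJ: "AE \<omega> in M. N \<omega> = J T \<omega> - J a \<omega>" "AE \<omega> in M. N' \<omega> = J' T \<omega> - J' a \<omega>"
  proof -
    have e: "AE \<omega> in M. y T \<omega> - y a \<omega> = running T \<beta> (\<omega>, T) + (J T \<omega> - J a \<omega>)"
      "AE \<omega> in M. z T \<omega> - z a \<omega> = running T \<psi> (\<omega>, T) + (J' T \<omega> - J' a \<omega>)"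
      using J J' a by auto
    show "AE \<omega> in M. N \<omega> = J T \<omega> - J a \<omega>"
      using e(1) by eventually_elim (simp add: N_def B_def)
    show "AE \<omega> in M. N' \<omega> = J' T \<omega> - J' a \<omega>"
      using e(2) by eventually_elim (simp add: N'_def C_def)
  qed
  have itoJ: "ito T f (J T)" "ito a f (J a)" "ito T g (J' T)" "ito a g (J' a)"
    using J J' a by auto
  have dJ: "sq_int M (\<lambda>\<omega>. J T \<omega> - J a \<omega>)" "sq_int M (\<lambda>\<omega>. J' T \<omega> - J' a \<omega>)"
    using itoJ by (auto simp: ito_def intro: sq_int_diff)
  let ?I = "\<lambda>\<omega>. indicator G \<omega> :: real"
  have int: "integrable M (\<lambda>\<omega>. ?I \<omega> * h \<omega> * k \<omega>)" if "sq_int M h" "sq_int M k" for h k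
    using sq_int_mult_integrable[OF sq_int_indicator_mult[OF G that(1)] that(2)] .
  have intH: "integrable ?H (\<lambda>p. ?I (fst p) * h p * k p)" if "sq_int ?H h" "sq_int ?H k" for h k
    using sq_int_mult_integrable[OF sq_int_horizon_state_mult[OF G that(1)] that(2)] .
  have Gm: "?I \<in> borel_measurable (FF a)" using G by simp

  have start_zero: "(\<integral>\<omega>. ?I \<omega> * w \<omega> * K \<omega> \<partial>M) = 0"
    if w: "w \<in> borel_measurable (FF a)" "sq_int M w" and K: "sq_int M K" "AE \<omega> in M. K \<omega> = K1 \<omega> - K0 \<omega>"
      and ito: "ito T h K1" "ito a h K0" for w K K1 K0 h
  proof -
    have dK: "sq_int M (\<lambda>\<omega>. K1 \<omega> - K0 \<omega>)" using ito by (auto simp: ito_def intro: sq_int_diff)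
    have "(\<integral>\<omega>. ?I \<omega> * w \<omega> * K \<omega> \<partial>M) = (\<integral>\<omega>. (?I \<omega> * w \<omega>) * (K1 \<omega> - K0 \<omega>) \<partial>M)"
      using K(2) int[OF w(2) K(1)] int[OF w(2) dK] by (intro integral_cong_AE) auto
    also have "\<dots> = 0"
      using int[OF w(2) dK] w(1) Gm
      by (intro ito_increment_orthogonal[OF ito a] borel_measurable_times) auto
    finally show ?thesis .
  qed
  have e1: "(\<integral>\<omega>. ?I \<omega> * y a \<omega> * N' \<omega> \<partial>M) = 0" "(\<integral>\<omega>. ?I \<omega> * z a \<omega> * N \<omega> \<partial>M) = 0"
    using start_zero[OF yam sq(1) NN(2) NJ(2) itoJ(3,4)] start_zero[OF zam sq(2) NN(1) NJ(1) itoJ(1,2)] by auto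
  have e2: "(\<integral>\<omega>. ?I \<omega> * N \<omega> * N' \<omega> \<partial>M)
      = (\<integral>p. ?I (fst p) * (indicator {a<..} (snd p) * f (snd p) (fst p)) * g (snd p) (fst p) \<partial>?H)"
  proof -
    have "AE \<omega> in M. ?I \<omega> * N \<omega> * N' \<omega> = ?I \<omega> * (J T \<omega> - J a \<omega>) * (J' T \<omega> - J' a \<omega>)"
      using NJ by eventually_elim simp
    hence "(\<integral>\<omega>. ?I \<omega> * N \<omega> * N' \<omega> \<partial>M) = (\<integral>\<omega>. ?I \<omega> * (J T \<omega> - J a \<omega>) * (J' T \<omega> - J' a \<omega>) \<partial>M)"
      using int[OF NN] int[OF dJ] by (intro integral_cong_AE) auto
    thus ?thesis
      using ito_increment_covariance[OF itoJ a G] by (simp add: case_prod_beta' mult.assoc)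
  qed
  have e3: "(\<integral>\<omega>. ?I \<omega> * N \<omega> * C \<omega> \<partial>M)
      = (\<integral>p. ?I (fst p) * (y (snd p) (fst p) - y a (fst p) - running T \<beta> p) * \<psi> p \<partial>?H)"
    using martingale_part_times_drift[OF Y a G c cm] unfolding N_def B_def C_def \<beta>_def \<psi>_def
    by (simp add: case_prod_beta')
  have e4: "(\<integral>\<omega>. ?I \<omega> * N' \<omega> * B \<omega> \<partial>M)
      = (\<integral>p. ?I (fst p) * (z (snd p) (fst p) - z a (fst p) - running T \<psi> p) * \<beta> p \<partial>?H)"
    using martingale_part_times_drift[OF Z a G b bm] unfolding N'_def B_def C_def \<beta>_def \<psi>_def
    by (simp add: case_prod_beta')
  have e5: "(\<integral>\<omega>. ?I \<omega> * B \<omega> * C \<omega> \<partial>M)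
      = (\<integral>p. ?I (fst p) * running T \<beta> p * \<psi> p + ?I (fst p) * running T \<psi> p * \<beta> p \<partial>?H)"
  proof -
    interpret K: finite_measure "time_window T" by (rule finite_time_window)
    have r: "sq_int ?H (running T \<beta>)" "sq_int ?H (running T \<psi>)"
      by (intro running_sq_int \<beta> \<psi>)+
    have i: "integrable ?H (\<lambda>p. ?I (fst p) * running T \<beta> p * \<psi> p + ?I (fst p) * running T \<psi> p * \<beta> p)"
      by (intro Bochner_Integration.integrable_add intH r \<beta> \<psi>)
    have "AE \<omega> in M. ?I \<omega> * B \<omega> * C \<omega>
        = (\<integral>t. ?I \<omega> * running T \<beta> (\<omega>, t) * \<psi> (\<omega>, t) + ?I \<omega> * running T \<psi> (\<omega>, t) * \<beta> (\<omega>, t) \<partial>time_window T)"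
      using AE_section_sq_int[OF \<beta>] AE_section_sq_int[OF \<psi>]
    proof eventually_elim
      fix \<omega> assume "sq_int (time_window T) (\<lambda>t. \<beta> (\<omega>, t))" "sq_int (time_window T) (\<lambda>t. \<psi> (\<omega>, t))"
      from integral_mult_running[OF K.sq_int_integrable[OF this(1)] K.sq_int_integrable[OF this(2)]]
      have "B \<omega> * C \<omega> = (\<integral>t. running T \<beta> (\<omega>, t) * \<psi> (\<omega>, t) + running T \<psi> (\<omega>, t) * \<beta> (\<omega>, t) \<partial>time_window T)"
        unfolding B_def C_def running_at_T unfolding running_def by simp
      hence "?I \<omega> * (B \<omega> * C \<omega>)
          = (\<integral>t. ?I \<omega> * (running T \<beta> (\<omega>, t) * \<psi> (\<omega>, t) + running T \<psi> (\<omega>, t) * \<beta> (\<omega>, t)) \<partial>time_window T)"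
        by simp
      thus "?I \<omega> * B \<omega> * C \<omega>
        = (\<integral>t. ?I \<omega> * running T \<beta> (\<omega>, t) * \<psi> (\<omega>, t) + ?I \<omega> * running T \<psi> (\<omega>, t) * \<beta> (\<omega>, t) \<partial>time_window T)"
        by (simp add: mult.assoc distrib_left)
    qed
    hence "(\<integral>\<omega>. ?I \<omega> * B \<omega> * C \<omega> \<partial>M) = (\<integral>\<omega>. (\<integral>t. ?I \<omega> * running T \<beta> (\<omega>, t) * \<psi> (\<omega>, t)
        + ?I \<omega> * running T \<psi> (\<omega>, t) * \<beta> (\<omega>, t) \<partial>time_window T) \<partial>M)"
      using int[OF BC] borel_measurable_integrable[OF horizon_iterated(3)[OF i]]
      by (intro integral_cong_AE) auto
    thus ?thesis using horizon_iterated(1)[OF i] by simp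
  qed
  have e6: "(\<integral>\<omega>. ?I \<omega> * w \<omega> * running T \<phi> (\<omega>, T) \<partial>M) = (\<integral>p. ?I (fst p) * w (fst p) * \<phi> p \<partial>?H)"
    if "sq_int M w" "sq_int ?H \<phi>" for w \<phi>
    using horizon_iterated(1)[OF intH[OF sq_int_horizon_state[OF that(1)] that(2)]]
    by (simp add: running_at_T)
  have yH': "sq_int ?H (\<lambda>p. y (snd p) (fst p))" and zH': "sq_int ?H (\<lambda>p. z (snd p) (fst p))"
    and fH': "sq_int ?H (\<lambda>p. indicator {a<..} (snd p) * f (snd p) (fst p))"
    and gH': "sq_int ?H (\<lambda>p. g (snd p) (fst p))"
    using yH zH sq_int_horizon_time_mult[OF fH] gH by (simp_all add: case_prod_beta')
  have rH: "sq_int ?H (running T \<beta>)" "sq_int ?H (running T \<psi>)"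
    by (intro running_sq_int \<beta> \<psi>)+
  have yN: "sq_int ?H (\<lambda>p. y (snd p) (fst p) - y a (fst p) - running T \<beta> p)"
    and zN: "sq_int ?H (\<lambda>p. z (snd p) (fst p) - z a (fst p) - running T \<psi> p)"
    by (intro sq_int_diff yH' zH' sq_int_horizon_state sq rH)+

  (* All integrals over M are now integrals over the horizon; the running integrals cancel there. *)
  have "(\<integral>\<omega>. ?I \<omega> * (y T \<omega> * z T \<omega> - y a \<omega> * z a \<omega>) \<partial>M)
      = (\<integral>\<omega>. ?I \<omega> * y a \<omega> * N' \<omega> + ?I \<omega> * z a \<omega> * N \<omega> + ?I \<omega> * y a \<omega> * C \<omega> + ?I \<omega> * z a \<omega> * B \<omega>
          + ?I \<omega> * B \<omega> * C \<omega> + ?I \<omega> * N \<omega> * C \<omega> + ?I \<omega> * N' \<omega> * B \<omega> + ?I \<omega> * N \<omega> * N' \<omega> \<partial>M)"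
    by (intro Bochner_Integration.integral_cong) (auto simp: N_def N'_def algebra_simps)
  also have "\<dots> = (\<integral>\<omega>. ?I \<omega> * y a \<omega> * N' \<omega> \<partial>M) + (\<integral>\<omega>. ?I \<omega> * z a \<omega> * N \<omega> \<partial>M)
      + (\<integral>\<omega>. ?I \<omega> * y a \<omega> * C \<omega> \<partial>M) + (\<integral>\<omega>. ?I \<omega> * z a \<omega> * B \<omega> \<partial>M) + (\<integral>\<omega>. ?I \<omega> * B \<omega> * C \<omega> \<partial>M)
      + (\<integral>\<omega>. ?I \<omega> * N \<omega> * C \<omega> \<partial>M) + (\<integral>\<omega>. ?I \<omega> * N' \<omega> * B \<omega> \<partial>M) + (\<integral>\<omega>. ?I \<omega> * N \<omega> * N' \<omega> \<partial>M)"
    using int sq BC NN by simp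
  also have "\<dots> = (\<integral>p. ?I (fst p) * y a (fst p) * \<psi> p \<partial>?H) + (\<integral>p. ?I (fst p) * z a (fst p) * \<beta> p \<partial>?H)
      + (\<integral>p. ?I (fst p) * running T \<beta> p * \<psi> p + ?I (fst p) * running T \<psi> p * \<beta> p \<partial>?H)
      + (\<integral>p. ?I (fst p) * (y (snd p) (fst p) - y a (fst p) - running T \<beta> p) * \<psi> p \<partial>?H)
      + (\<integral>p. ?I (fst p) * (z (snd p) (fst p) - z a (fst p) - running T \<psi> p) * \<beta> p \<partial>?H)
      + (\<integral>p. ?I (fst p) * (indicator {a<..} (snd p) * f (snd p) (fst p)) * g (snd p) (fst p) \<partial>?H)"
    unfolding e1 e2 e3 e4 e5 unfolding B_def C_def e6[OF sq(1) \<psi>] e6[OF sq(2) \<beta>] by simp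
  also have "\<dots> = (\<integral>p. ?I (fst p) * y a (fst p) * \<psi> p + ?I (fst p) * z a (fst p) * \<beta> p
      + (?I (fst p) * running T \<beta> p * \<psi> p + ?I (fst p) * running T \<psi> p * \<beta> p)
      + ?I (fst p) * (y (snd p) (fst p) - y a (fst p) - running T \<beta> p) * \<psi> p
      + ?I (fst p) * (z (snd p) (fst p) - z a (fst p) - running T \<psi> p) * \<beta> p
      + ?I (fst p) * (indicator {a<..} (snd p) * f (snd p) (fst p)) * g (snd p) (fst p) \<partial>?H)"
    using intH[OF sq_int_horizon_state[OF sq(1)] \<psi>] intH[OF sq_int_horizon_state[OF sq(2)] \<beta>]
      intH[OF rH(1) \<psi>] intH[OF rH(2) \<beta>] intH[OF yN \<psi>] intH[OF zN \<beta>] intH[OF fH' gH']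
    by (simp only: Bochner_Integration.integral_add Bochner_Integration.integrable_add)
  also have "\<dots> = (\<integral>(\<omega>, t). ?I \<omega> * (indicator {a<..} t *
            (y t \<omega> * c t \<omega> + z t \<omega> * b t \<omega> + f t \<omega> * g t \<omega>)) \<partial>?H)"
    by (intro Bochner_Integration.integral_cong) (auto simp: \<beta>_def \<psi>_def algebra_simps)
  finally show ?thesis .
qed

definition window_mean :: "real \<Rightarrow> real \<Rightarrow> ('w \<times> real \<Rightarrow> real) \<Rightarrow> 'w \<Rightarrow> real" where
  "window_mean a T h =
     real_cond_exp M (FF a) (\<lambda>\<omega>. \<integral>t. indicator {a<..} t * h (\<omega>, t) \<partial>time_window T)"

lemma integrable_horizon_after:
  fixes h :: "'w \<times> real \<Rightarrow> real"
  assumes "integrable (horizon M T) h"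
  shows "integrable (horizon M T) (\<lambda>p. indicator {a<..} (snd p) * h p)"
proof (rule Bochner_Integration.integrable_bound[OF assms])
  show "(\<lambda>p. indicator {a<..} (snd p) * h p) \<in> borel_measurable (horizon M T)"
    using horizon_measurable_time[of "indicator {a<..} :: real \<Rightarrow> real" T] assms
    by (intro borel_measurable_times) (auto simp: case_prod_beta')
qed (auto split: split_indicator)

theorem ito_product_conditional_mean:
  assumes Y: "ito_process T y b f" and Z: "ito_process T z c g" and a: "0 \<le> a" "a \<le> T"
  shows "AE \<omega> in M. real_cond_exp M (FF a) (\<lambda>\<omega>. y T \<omega> * z T \<omega>) \<omega> = y a \<omega> * z a \<omega>
    + window_mean a T (\<lambda>(\<omega>, t). y t \<omega> * c t \<omega> + z t \<omega> * b t \<omega> + f t \<omega> * g t \<omega>) \<omega>"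
proof -
  interpret S: sigma_finite_subalgebra M "FF a" by (rule sigma_finite_subalgebra_FF)
  let ?H = "horizon M T"
  define h where "h = (\<lambda>(\<omega>, t). y t \<omega> * c t \<omega> + z t \<omega> * b t \<omega> + f t \<omega> * g t \<omega>)"
  define \<Lambda> where "\<Lambda> = (\<lambda>\<omega>. \<integral>t. indicator {a<..} t * h (\<omega>, t) \<partial>time_window T)"
  have sqH: "sq_int ?H (\<lambda>p. y (snd p) (fst p))" "sq_int ?H (\<lambda>p. b (snd p) (fst p))"
    "sq_int ?H (\<lambda>p. z (snd p) (fst p))" "sq_int ?H (\<lambda>p. c (snd p) (fst p))"
    and m: "y a \<in> borel_measurable (FF a)" "z a \<in> borel_measurable (FF a)"
    using Y Z a unfolding ito_process_def by (auto simp: case_prod_beta')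
  have "sq_int ?H (\<lambda>p. f (snd p) (fst p))" "sq_int ?H (\<lambda>p. g (snd p) (fst p))"
    using Y Z a unfolding ito_process_def ito_def by (auto simp: case_prod_beta')
  with sqH have h: "integrable ?H h"
    unfolding h_def case_prod_beta' by (intro Bochner_Integration.integrable_add sq_int_mult_integrable) auto
  have hG: "integrable ?H (\<lambda>p. indicator G (fst p) * (indicator {a<..} (snd p) * h p))" if "G \<in> sets (FF a)" for G
  proof (rule Bochner_Integration.integrable_bound[OF integrable_horizon_after[OF h]])
    show "(\<lambda>p. indicator G (fst p) * (indicator {a<..} (snd p) * h p)) \<in> borel_measurable ?H"
      using horizon_measurable_state[OF FF_indicator_measurable[OF that], of T]
      by (intro borel_measurable_times[OF _ borel_measurable_integrable[OF integrable_horizon_after[OF h]]])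
        (simp add: case_prod_beta')
  qed (auto split: split_indicator)
  have \<Lambda>: "integrable M \<Lambda>"
    unfolding \<Lambda>_def using horizon_iterated(3)[OF integrable_horizon_after[OF h]] by simp
  have sq: "sq_int M (y a)" "sq_int M (z a)" "sq_int M (y T)" "sq_int M (z T)"
    using a by (auto intro: ito_process_sq_int[OF Y] ito_process_sq_int[OF Z])
  have i: "integrable M (\<lambda>\<omega>. y T \<omega> * z T \<omega>)" "integrable M (\<lambda>\<omega>. y a \<omega> * z a \<omega>)"
    by (intro sq_int_mult_integrable sq)+
  have "AE \<omega> in M. real_cond_exp M (FF a) (\<lambda>\<omega>. y T \<omega> * z T \<omega>) \<omega>
      = y a \<omega> * z a \<omega> + real_cond_exp M (FF a) \<Lambda> \<omega>"
  proof (rule S.real_cond_exp_charact)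
    fix G assume G: "G \<in> sets (FF a)"
    hence GM: "G \<in> sets M" using subalgebra_FF unfolding subalgebra_def by blast
    have iG: "integrable M (\<lambda>\<omega>. indicator G \<omega> * k \<omega>)" if "integrable M k" for k :: "'w \<Rightarrow> real"
      using integrable_mult_indicator[OF GM that] by simp
    have "(\<integral>\<omega>\<in>G. y T \<omega> * z T \<omega> \<partial>M) - (\<integral>\<omega>\<in>G. y a \<omega> * z a \<omega> \<partial>M)
        = (\<integral>\<omega>. indicator G \<omega> * (y T \<omega> * z T \<omega> - y a \<omega> * z a \<omega>) \<partial>M)"
      using iG[OF i(1)] iG[OF i(2)] by (simp add: set_lebesgue_integral_def right_diff_distrib)
    also have "\<dots> = (\<integral>p. indicator G (fst p) * (indicator {a<..} (snd p) * h p) \<partial>?H)"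
      using ito_product_rule[OF Y Z a G] unfolding h_def by (simp add: case_prod_beta')
    also have "\<dots> = (\<integral>\<omega>\<in>G. \<Lambda> \<omega> \<partial>M)"
      unfolding horizon_iterated(1)[OF hG[OF G]] \<Lambda>_def by (simp add: set_lebesgue_integral_def)
    also have "\<dots> = (\<integral>\<omega>\<in>G. real_cond_exp M (FF a) \<Lambda> \<omega> \<partial>M)"
      by (rule S.real_cond_exp_intA[OF \<Lambda> G])
    finally have "(\<integral>\<omega>\<in>G. y T \<omega> * z T \<omega> \<partial>M)
        = (\<integral>\<omega>\<in>G. y a \<omega> * z a \<omega> \<partial>M) + (\<integral>\<omega>\<in>G. real_cond_exp M (FF a) \<Lambda> \<omega> \<partial>M)"
      by simp
    also have "(\<integral>\<omega>\<in>G. y a \<omega> * z a \<omega> \<partial>M) + (\<integral>\<omega>\<in>G. real_cond_exp M (FF a) \<Lambda> \<omega> \<partial>M)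
        = (\<integral>\<omega>\<in>G. y a \<omega> * z a \<omega> + real_cond_exp M (FF a) \<Lambda> \<omega> \<partial>M)"
      using iG[OF i(2)] iG[OF S.real_cond_exp_int(1)[OF \<Lambda>]]
      by (simp add: set_lebesgue_integral_def distrib_left)
    finally show "(\<integral>\<omega>\<in>G. y T \<omega> * z T \<omega> \<partial>M)
        = (\<integral>\<omega>\<in>G. y a \<omega> * z a \<omega> + real_cond_exp M (FF a) \<Lambda> \<omega> \<partial>M)" .
  qed (use i \<Lambda> m in \<open>auto intro!: S.real_cond_exp_int(1) borel_measurable_add borel_measurable_times\<close>)
  thus ?thesis unfolding window_mean_def \<Lambda>_def h_def .
qed

end

section \<open>The data of the controlled system\<close>

lemma borel_measurable_vec_nth:
  fixes f :: "'a \<Rightarrow> real^'c"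
  assumes "f \<in> borel_measurable N"
  shows "(\<lambda>x. f x $ e) \<in> borel_measurable N"
  by (rule measurable_compose[OF assms borel_measurable_continuous_onI]) (intro continuous_intros)

lemma integrable_vec_components:
  fixes f :: "'a \<Rightarrow> real^'c"
  assumes "\<And>e. integrable N (\<lambda>x. f x $ e)"
  shows "integrable N f"
proof -
  have "f = (\<lambda>x. \<Sum>e\<in>UNIV. (f x $ e) *\<^sub>R axis e 1)"
    by (simp add: fun_eq_iff basis_expansion scalar_mult_eq_scaleR[symmetric])
  moreover have "integrable N (\<lambda>x. \<Sum>e\<in>UNIV. (f x $ e) *\<^sub>R (axis e 1 :: real^'c))"
    using assms by (intro Bochner_Integration.integrable_sum integrable_scaleR_left) auto
  ultimately show ?thesis by simp
qed

context brownian
begin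

lemma window_mean_integrable:
  fixes h :: "'w \<times> real \<Rightarrow> real"
  assumes "integrable (horizon M T) h"
  shows "integrable M (\<lambda>\<omega>. \<integral>t. indicator {a<..} t * h (\<omega>, t) \<partial>time_window T)"
  using horizon_iterated(3)[OF integrable_horizon_after[OF assms, of a]] by simp

lemma AE_section_integrable:
  fixes h :: "'w \<times> real \<Rightarrow> 'b :: {banach, second_countable_topology}"
  assumes "integrable (horizon M T) h"
  shows "AE \<omega> in M. integrable (time_window T) (\<lambda>t. h (\<omega>, t))"
proof -
  interpret P: pair_sigma_finite M "time_window T" by (rule pair_sigma_finite_horizon)
  show ?thesis using P.AE_integrable_fst'[of h] assms by (simp add: horizon_def)
qed

lemma window_mean_add:
  fixes h k :: "'w \<times> real \<Rightarrow> real"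
  assumes h: "integrable (horizon M T) h" and k: "integrable (horizon M T) k"
  shows "AE \<omega> in M. window_mean a T (\<lambda>p. h p + k p) \<omega> = window_mean a T h \<omega> + window_mean a T k \<omega>"
proof -
  interpret S: sigma_finite_subalgebra M "FF a" by (rule sigma_finite_subalgebra_FF)
  let ?L = "\<lambda>h \<omega>. \<integral>t. indicator {a<..} t * h (\<omega>, t) \<partial>time_window T"
  note i = window_mean_integrable[OF h, of a] window_mean_integrable[OF k, of a]
    window_mean_integrable[OF Bochner_Integration.integrable_add[OF h k], of a]
  have "AE \<omega> in M. ?L (\<lambda>p. h p + k p) \<omega> = ?L h \<omega> + ?L k \<omega>"
    using AE_section_integrable[OF integrable_horizon_after[OF h, of a]]
      AE_section_integrable[OF integrable_horizon_after[OF k, of a]]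
    by eventually_elim (simp add: distrib_left)
  hence "AE \<omega> in M. window_mean a T (\<lambda>p. h p + k p) \<omega> = real_cond_exp M (FF a) (\<lambda>\<omega>. ?L h \<omega> + ?L k \<omega>) \<omega>"
    unfolding window_mean_def using i by (intro S.real_cond_exp_cong) auto
  with S.real_cond_exp_add[OF i(1,2)] show ?thesis
    unfolding window_mean_def by eventually_elim simp
qed

lemma window_mean_cmult:
  fixes h :: "'w \<times> real \<Rightarrow> real"
  assumes h: "integrable (horizon M T) h"
  shows "AE \<omega> in M. window_mean a T (\<lambda>p. c * h p) \<omega> = c * window_mean a T h \<omega>"
proof -
  interpret S: sigma_finite_subalgebra M "FF a" by (rule sigma_finite_subalgebra_FF)
  have "(\<lambda>\<omega>. \<integral>t. indicator {a<..} t * (c * h (\<omega>, t)) \<partial>time_window T)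
      = (\<lambda>\<omega>. c * (\<integral>t. indicator {a<..} t * h (\<omega>, t) \<partial>time_window T))"
    by (simp add: mult.left_commute[of _ c])
  thus ?thesis
    unfolding window_mean_def using S.real_cond_exp_cmult[OF window_mean_integrable[OF h, of a], of c] by simp
qed

lemma window_mean_sum:
  fixes h :: "'k \<Rightarrow> 'w \<times> real \<Rightarrow> real"
  assumes I: "finite I" and h: "\<And>k. k \<in> I \<Longrightarrow> integrable (horizon M T) (h k)"
  shows "AE \<omega> in M. window_mean a T (\<lambda>p. \<Sum>k\<in>I. c k * h k p) \<omega> = (\<Sum>k\<in>I. c k * window_mean a T (h k) \<omega>)"
  using I h
proof (induction I rule: finite_induct)
  case empty
  have "AE \<omega> in M. window_mean a T (\<lambda>p. 0 * 0) \<omega> = 0 * window_mean a T (\<lambda>p. 0) \<omega>"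
    by (rule window_mean_cmult) simp
  thus ?case by simp
next
  case (insert j I)
  have i: "integrable (horizon M T) (\<lambda>p. c j * h j p)" "integrable (horizon M T) (\<lambda>p. \<Sum>k\<in>I. c k * h k p)"
    using insert.prems by auto
  have "AE \<omega> in M. window_mean a T (\<lambda>p. \<Sum>k\<in>I. c k * h k p) \<omega> = (\<Sum>k\<in>I. c k * window_mean a T (h k) \<omega>)"
    using insert by auto
  moreover note window_mean_add[OF i, of a] window_mean_cmult[OF insert.prems[of j], of a "c j"]
  ultimately have "AE \<omega> in M. window_mean a T (\<lambda>p. c j * h j p + (\<Sum>k\<in>I. c k * h k p)) \<omega>
      = c j * window_mean a T (h j) \<omega> + (\<Sum>k\<in>I. c k * window_mean a T (h k) \<omega>)"
    by (auto elim!: eventually_mono[OF eventually_conj[OF eventually_conj]])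
  thus ?case using insert.hyps by simp
qed

lemma set_integral_eq_time_window:
  fixes w :: "real \<Rightarrow> 'b :: {banach, second_countable_topology}"
  assumes "0 \<le> r" "s \<le> T"
  shows "(LINT \<tau>:{r..s}|lborel. w \<tau>) = (\<integral>\<tau>. indicator {r..s} \<tau> *\<^sub>R w \<tau> \<partial>time_window T)"
proof -
  have "(\<integral>\<tau>. indicator {r..s} \<tau> *\<^sub>R w \<tau> \<partial>time_window T)
      = (\<integral>\<tau>. indicator {0..T} \<tau> *\<^sub>R (indicator {r..s} \<tau> *\<^sub>R w \<tau>) \<partial>lborel)"
    by (rule integral_restrict_space) simp
  also have "\<dots> = (LINT \<tau>:{r..s}|lborel. w \<tau>)"
    unfolding set_lebesgue_integral_def using assms
    by (intro Bochner_Integration.integral_cong) (auto split: split_indicator)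
  finally show ?thesis ..
qed

lemma set_integral_component:
  fixes w :: "real \<Rightarrow> real^'c"
  assumes w: "integrable (time_window T) w" and "0 \<le> r" "s \<le> T"
  shows "(LINT \<tau>:{r..s}|lborel. w \<tau>) $ e = (\<integral>\<tau>. indicator {r..s} \<tau> * w \<tau> $ e \<partial>time_window T)"
proof -
  have "{r..s} \<inter> {0..T} \<in> sets (time_window T)"
    by (simp add: sets_restrict_space_iff)
  hence "integrable (time_window T) (\<lambda>\<tau>. indicator ({r..s} \<inter> {0..T}) \<tau> *\<^sub>R w \<tau>)"
    using w by (rule integrable_mult_indicator)
  moreover have "{r..s} \<inter> {0..T} = {r..s}" using assms by auto
  ultimately have "integrable (time_window T) (\<lambda>\<tau>. indicator {r..s} \<tau> *\<^sub>R w \<tau>)" by (simp only:)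
  from integral_bounded_linear[OF bounded_linear_vec_nth this, of e]
  show ?thesis
    unfolding set_integral_eq_time_window[OF assms(2,3)] by simp
qed

text \<open>
  A row of integral data is computed on vectors and over the closed interval. Almost surely the vector
  is integrable, hence integrated entry by entry, and the left end point carries no mass.
\<close>

lemma integral_row_component:
  fixes z :: "real \<Rightarrow> 'w \<Rightarrow> real^'c"
  assumes z: "\<And>e. integrable (horizon M (tm j + dt)) (\<lambda>(\<omega>, t). z t \<omega> $ e)"
    and tm: "0 \<le> tm j" "0 < dt"
  shows "AE \<omega> in M. \<forall>e. integral_row M W tm dt z \<omega> j $ e
      = window_mean (tm j) (tm j + dt) (\<lambda>(\<omega>, t). z t \<omega> $ e) \<omega>"
proof -
  define a where "a = tm j"
  define T where "T = tm j + dt"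
  interpret S: sigma_finite_subalgebra M "FF a" by (rule sigma_finite_subalgebra_FF)
  interpret K: sigma_finite_measure "time_window T"
    using finite_time_window by (rule finite_measure.axioms(1))
  have aT: "0 \<le> a" "a \<le> T" using tm by (auto simp: a_def T_def)
  have zv: "integrable (horizon M T) (\<lambda>(\<omega>, t). z t \<omega>)"
    using integrable_vec_components[of "horizon M T" "\<lambda>(\<omega>, t). z t \<omega>"] z
    by (simp add: T_def case_prod_beta')
  have "AE \<omega> in M. real_cond_exp M (FF a) (\<lambda>\<omega>. (LINT \<tau>:{a..T}|lborel. z \<tau> \<omega>) $ e) \<omega>
      = real_cond_exp M (FF a) (\<lambda>\<omega>. \<integral>t. indicator {a<..} t * (z t \<omega> $ e) \<partial>time_window T) \<omega>" for e
  proof (rule S.real_cond_exp_cong)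
    show "AE \<omega> in M. (LINT \<tau>:{a..T}|lborel. z \<tau> \<omega>) $ e
        = (\<integral>t. indicator {a<..} t * (z t \<omega> $ e) \<partial>time_window T)"
      using AE_section_integrable[OF zv]
    proof eventually_elim
      fix \<omega> assume "integrable (time_window T) (\<lambda>t. case (\<omega>, t) of (\<omega>, t) \<Rightarrow> z t \<omega>)"
      hence i: "integrable (time_window T) (\<lambda>t. z t \<omega>)" by simp
      have ze: "(\<lambda>t. z t \<omega> $ e) \<in> borel_measurable (time_window T)"
        using integrable_bounded_linear[OF bounded_linear_vec_nth i] by auto
      have "AE t in time_window T. indicator {a..T} t * (z t \<omega> $ e) = indicator {a<..} t * (z t \<omega> $ e)"
        using AE_time_window_neq[of a T] AE_space
        by eventually_elim (auto simp: space_restrict_space split: split_indicator)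
      hence "(\<integral>t. indicator {a..T} t * (z t \<omega> $ e) \<partial>time_window T)
          = (\<integral>t. indicator {a<..} t * (z t \<omega> $ e) \<partial>time_window T)"
        using ze by (intro integral_cong_AE)
          (auto intro!: borel_measurable_times time_window_measurable[of "indicator {a..T}"]
             time_window_measurable[of "indicator {a<..}"])
      thus "(LINT \<tau>:{a..T}|lborel. z \<tau> \<omega>) $ e = (\<integral>t. indicator {a<..} t * (z t \<omega> $ e) \<partial>time_window T)"
        using set_integral_component[OF i aT(1), of T e] by simp
    qed
    show "(\<lambda>\<omega>. \<integral>t. indicator {a<..} t * (z t \<omega> $ e) \<partial>time_window T) \<in> borel_measurable M"
      using borel_measurable_integrable[OF window_mean_integrable[OF z[of e, folded T_def], of a]] by simp
    have "(\<lambda>p. indicator {a..T} (snd p) *\<^sub>R z (snd p) (fst p)) \<in> borel_measurable (horizon M T)"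
      using horizon_measurable_time[of "indicator {a..T} :: real \<Rightarrow> real" T] borel_measurable_integrable[OF zv]
      by (intro borel_measurable_scaleR) (simp_all add: case_prod_beta')
    hence "(\<lambda>\<omega>. \<integral>t. indicator {a..T} t *\<^sub>R z t \<omega> \<partial>time_window T) \<in> borel_measurable M"
      unfolding horizon_def by (intro K.borel_measurable_lebesgue_integral) (simp add: case_prod_beta')
    from borel_measurable_vec_nth[OF this, of e]
    show "(\<lambda>\<omega>. (LINT \<tau>:{a..T}|lborel. z \<tau> \<omega>) $ e) \<in> borel_measurable M"
      by (simp add: set_integral_eq_time_window[OF aT(1) order_refl])
  qed
  hence "AE \<omega> in M. \<forall>e. real_cond_exp M (FF a) (\<lambda>\<omega>. (LINT \<tau>:{a..T}|lborel. z \<tau> \<omega>) $ e) \<omega>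
      = real_cond_exp M (FF a) (\<lambda>\<omega>. \<integral>t. indicator {a<..} t * (z t \<omega> $ e) \<partial>time_window T) \<omega>"
    by (simp add: AE_all_countable)
  thus ?thesis
    unfolding integral_row_def cond_exp_vec_def window_mean_def a_def T_def by simp
qed

lemma l2_adapted_component:
  fixes f :: "real \<Rightarrow> 'w \<Rightarrow> real^'d"
  assumes f: "l2_adapted M W f"
  shows "0 \<le> t \<Longrightarrow> (\<lambda>\<omega>. f t \<omega> $ e) \<in> borel_measurable (FF t)"
    "0 \<le> T \<Longrightarrow> sq_int (horizon M T) (\<lambda>(\<omega>, t). f t \<omega> $ e)"
proof -
  show "0 \<le> t \<Longrightarrow> (\<lambda>\<omega>. f t \<omega> $ e) \<in> borel_measurable (FF t)"
    using f unfolding l2_adapted_def by (auto intro!: borel_measurable_vec_nth)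
  assume "0 \<le> T"
  hence m: "(\<lambda>(\<omega>, t). f t \<omega>) \<in> borel_measurable (horizon M T)"
    and i: "integrable (horizon M T) (\<lambda>(\<omega>, t). (norm (f t \<omega>))\<^sup>2)"
    using f unfolding l2_adapted_def by auto
  have "sq_int (horizon M T) (\<lambda>p. norm ((\<lambda>(\<omega>, t). f t \<omega>) p))"
    using m i by (simp add: sq_int_def case_prod_beta')
  thus "sq_int (horizon M T) (\<lambda>(\<omega>, t). f t \<omega> $ e)"
  proof (rule sq_int_dominated)
    show "(\<lambda>(\<omega>, t). f t \<omega> $ e) \<in> borel_measurable (horizon M T)"
      using borel_measurable_vec_nth[OF m, of e] by (simp add: case_prod_beta')
  qed (auto simp: component_le_norm_cart)
qed

lemma sde_solution_ito_process:
  fixes x :: "real \<Rightarrow> 'w \<Rightarrow> real^'n"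
  assumes x: "sde_solution M W b g x0 x" and T: "0 \<le> T"
    and bm: "\<And>t. 0 \<le> t \<Longrightarrow> (\<lambda>\<omega>. b t \<omega> $ i) \<in> borel_measurable (FF t)"
    and bi: "\<And>i. sq_int (horizon M T) (\<lambda>(\<omega>, t). b t \<omega> $ i)"
  shows "ito_process T (\<lambda>t \<omega>. x t \<omega> $ i) (\<lambda>t \<omega>. b t \<omega> $ i) (\<lambda>t \<omega>. g t \<omega> $ i)"
proof -
  interpret H: finite_measure "horizon M T" by (rule finite_horizon)
  have l2: "l2_adapted M W x" using x by (simp add: sde_solution_def)
  have bv: "integrable (horizon M T) (\<lambda>(\<omega>, t). b t \<omega>)"
    using integrable_vec_components[of "horizon M T" "\<lambda>(\<omega>, t). b t \<omega>"] H.sq_int_integrable[OF bi]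
    by (simp add: case_prod_beta')
  have "\<exists>J. ito t (\<lambda>t \<omega>. g t \<omega> $ i) J \<and>
        (AE \<omega> in M. x t \<omega> $ i = x0 $ i + running T (\<lambda>(\<omega>, t). b t \<omega> $ i) (\<omega>, t) + J \<omega>)"
    if t: "t \<in> {0..T}" for t
  proof -
    obtain J where J: "\<forall>i. has_ito_integral M W (\<lambda>\<tau> \<omega>. g \<tau> \<omega> $ i) t (\<lambda>\<omega>. J \<omega> $ i)"
      and eq: "AE \<omega> in M. x t \<omega> = x0 + (LINT \<tau>:{0..t}|lborel. b \<tau> \<omega>) + J \<omega>"
      using x t unfolding sde_solution_def by auto
    have "AE \<omega> in M. x t \<omega> $ i = x0 $ i + running T (\<lambda>(\<omega>, t). b t \<omega> $ i) (\<omega>, t) + J \<omega> $ i"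
      using eq AE_section_integrable[OF bv]
    proof eventually_elim
      fix \<omega> assume e: "x t \<omega> = x0 + (LINT \<tau>:{0..t}|lborel. b \<tau> \<omega>) + J \<omega>"
        and "integrable (time_window T) (\<lambda>t. case (\<omega>, t) of (\<omega>, t) \<Rightarrow> b t \<omega>)"
      hence "integrable (time_window T) (\<lambda>t. b t \<omega>)" by simp
      from set_integral_component[OF this, of 0 t i] t
      have "(LINT \<tau>:{0..t}|lborel. b \<tau> \<omega>) $ i = (\<integral>\<tau>. indicator {0..t} \<tau> * b \<tau> \<omega> $ i \<partial>time_window T)"
        by simp
      also have "\<dots> = running T (\<lambda>(\<omega>, t). b t \<omega> $ i) (\<omega>, t)"
        unfolding running_def
        by (auto intro!: Bochner_Integration.integral_cong simp: space_restrict_space split: split_indicator)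
      finally show "x t \<omega> $ i = x0 $ i + running T (\<lambda>(\<omega>, t). b t \<omega> $ i) (\<omega>, t) + J \<omega> $ i"
        using e by simp
    qed
    thus ?thesis using has_ito_integral_imp_ito J by blast
  qed
  hence "\<exists>y0. \<forall>t\<in>{0..T}. \<exists>J. ito t (\<lambda>t \<omega>. g t \<omega> $ i) J \<and>
        (AE \<omega> in M. x t \<omega> $ i = y0 + running T (\<lambda>(\<omega>, t). b t \<omega> $ i) (\<omega>, t) + J \<omega>)"
    by (intro exI[of _ "x0 $ i"] ballI)
  thus ?thesis
    unfolding ito_process_def
    using l2_adapted_component[OF l2] T bm bi[of i] by auto
qed


text \<open>
  The moments of one data interval, in the shape in which \<^const>\<open>moment_increment\<close> relates them.
\<close>

definition moment ::
    "real \<Rightarrow> real \<Rightarrow> (real \<Rightarrow> 'w \<Rightarrow> real^'a) \<Rightarrow> (real \<Rightarrow> 'w \<Rightarrow> real^'n) \<Rightarrow> 'w \<Rightarrow> real^'n^'a" where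
  "moment a T w x \<omega> = (\<chi> i k. window_mean a T (\<lambda>(\<omega>, t). w t \<omega> $ i * x t \<omega> $ k) \<omega>)"

lemma l2_adapted_product_integrable:
  assumes "l2_adapted M W w" "l2_adapted M W x" "0 \<le> T"
  shows "integrable (horizon M T) (\<lambda>(\<omega>, t). w t \<omega> $ i * x t \<omega> $ k)"
  using sq_int_mult_integrable[OF l2_adapted_component(2)[OF assms(1,3), of i]
      l2_adapted_component(2)[OF assms(2,3), of k]]
  by (simp add: case_prod_beta')

lemma window_mean_linear:
  fixes N :: "real^'a^'b"
  assumes "l2_adapted M W w" "l2_adapted M W x" "0 \<le> T"
  shows "AE \<omega> in M. window_mean a T (\<lambda>(\<omega>, t). (N *v w t \<omega>) $ i * x t \<omega> $ k) \<omega> = (N ** moment a T w x \<omega>) $ i $ k"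
proof -
  have "AE \<omega> in M. window_mean a T (\<lambda>p. \<Sum>l\<in>UNIV. N $ i $ l * (case p of (\<omega>, t) \<Rightarrow> w t \<omega> $ l * x t \<omega> $ k)) \<omega>
      = (\<Sum>l\<in>UNIV. N $ i $ l * window_mean a T (\<lambda>(\<omega>, t). w t \<omega> $ l * x t \<omega> $ k) \<omega>)"
    by (rule window_mean_sum) (auto intro: l2_adapted_product_integrable[OF assms])
  moreover have "(\<lambda>p. \<Sum>l\<in>UNIV. N $ i $ l * (case p of (\<omega>, t) \<Rightarrow> w t \<omega> $ l * x t \<omega> $ k))
      = (\<lambda>(\<omega>, t). (N *v w t \<omega>) $ i * x t \<omega> $ k)"
    by (auto simp: fun_eq_iff matrix_vector_mult_def sum_distrib_right mult.assoc)
  ultimately show ?thesis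
    by (simp add: matrix_matrix_mult_def moment_def)
qed

lemma moment_transpose: "moment a T w x \<omega> $ i $ k = moment a T x w \<omega> $ k $ i"
  by (simp add: moment_def mult.commute)

lemma moment_sym: "moment a T x x \<omega> \<in> sym_mats"
  unfolding sym_mats_def by (simp add: vec_eq_iff transpose_def moment_transpose[of a T x x])

lemma l2_adapted_linear:
  fixes N :: "real^'a^'b" and w :: "real \<Rightarrow> 'w \<Rightarrow> real^'a"
  assumes w: "l2_adapted M W w"
  shows "l2_adapted M W (\<lambda>t \<omega>. N *v w t \<omega>)"
proof -
  obtain K where K: "\<And>v. norm (N *v v) \<le> norm v * K"
    using bounded_linear.bounded[OF matrix_vector_mul_bounded_linear[of N]] by blast
  have cont: "(\<lambda>v. N *v v) \<in> borel_measurable borel"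
    by (intro borel_measurable_continuous_onI linear_continuous_on matrix_vector_mul_bounded_linear)
  have "integrable (horizon M T) (\<lambda>(\<omega>, t). (norm (N *v w t \<omega>))\<^sup>2)"
    and "(\<lambda>(\<omega>, t). N *v w t \<omega>) \<in> borel_measurable (horizon M T)" if "0 \<le> T" for T
  proof -
    have m: "(\<lambda>(\<omega>, t). w t \<omega>) \<in> borel_measurable (horizon M T)"
      and i: "integrable (horizon M T) (\<lambda>(\<omega>, t). (norm (w t \<omega>))\<^sup>2)"
      using w that unfolding l2_adapted_def by auto
    show m': "(\<lambda>(\<omega>, t). N *v w t \<omega>) \<in> borel_measurable (horizon M T)"
      using measurable_compose[OF m cont] by (simp add: case_prod_beta')
    show "integrable (horizon M T) (\<lambda>(\<omega>, t). (norm (N *v w t \<omega>))\<^sup>2)"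
    proof (rule Bochner_Integration.integrable_bound)
      show "integrable (horizon M T) (\<lambda>p. K\<^sup>2 * (case p of (\<omega>, t) \<Rightarrow> (norm (w t \<omega>))\<^sup>2))"
        using i by simp
      show "(\<lambda>(\<omega>, t). (norm (N *v w t \<omega>))\<^sup>2) \<in> borel_measurable (horizon M T)"
        using borel_measurable_power[OF measurable_compose[OF m' borel_measurable_norm], of 2] by (simp add: case_prod_beta')
      show "AE p in horizon M T. norm (case p of (\<omega>, t) \<Rightarrow> (norm (N *v w t \<omega>))\<^sup>2)
          \<le> norm (K\<^sup>2 * (case p of (\<omega>, t) \<Rightarrow> (norm (w t \<omega>))\<^sup>2))"
        using power_mono[OF K norm_ge_zero, of _ 2]
        by (intro AE_I2) (auto simp: power_mult_distrib mult.commute)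
    qed
  qed
  moreover have "(\<lambda>\<omega>. N *v w t \<omega>) \<in> borel_measurable (FF t)" if "0 \<le> t" for t
  proof (rule measurable_compose[OF _ cont])
    show "w t \<in> borel_measurable (FF t)" using w that unfolding l2_adapted_def by blast
  qed
  ultimately show ?thesis unfolding l2_adapted_def by blast
qed

lemma controlled_state_ito_process:
  fixes A A1 :: "real^'n^'n" and B :: "real^'m^'n" and E :: "real^'p^'n"
  assumes x: "sde_solution M W (\<lambda>t \<omega>. A *v x t \<omega> + B *v u t \<omega> + E *v v t \<omega>) (\<lambda>t \<omega>. A1 *v x t \<omega>) x0 x"
    and u: "l2_adapted M W u" and v: "l2_adapted M W v" and T: "0 \<le> T"
  shows "ito_process T (\<lambda>t \<omega>. x t \<omega> $ i) (\<lambda>t \<omega>. (A *v x t \<omega> + B *v u t \<omega> + E *v v t \<omega>) $ i)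
    (\<lambda>t \<omega>. (A1 *v x t \<omega>) $ i)"
proof -
  have lx: "l2_adapted M W x" using x by (simp add: sde_solution_def)
  let ?b = "\<lambda>t \<omega>. A *v x t \<omega> + B *v u t \<omega> + E *v v t \<omega>"
  have b: "(\<lambda>\<omega>. ?b t \<omega> $ i) \<in> borel_measurable (FF t)" if "0 \<le> t" for t i
    using that l2_adapted_component(1)[OF l2_adapted_linear[OF lx]] l2_adapted_component(1)[OF l2_adapted_linear[OF u]]
      l2_adapted_component(1)[OF l2_adapted_linear[OF v]] by (auto intro!: borel_measurable_add)
  have bH: "sq_int (horizon M T) (\<lambda>(\<omega>, t). ?b t \<omega> $ i)" for i
    using sq_int_add[OF sq_int_add[OF l2_adapted_component(2)[OF l2_adapted_linear[OF lx] T]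
        l2_adapted_component(2)[OF l2_adapted_linear[OF u] T]] l2_adapted_component(2)[OF l2_adapted_linear[OF v] T],
        of A i B i E i]
    by (simp add: case_prod_beta')
  show ?thesis
    by (rule sde_solution_ito_process[OF x T]) (rule b, assumption, rule bH)
qed

text \<open>
  The second-moment balance of the system: by the product rule the increment of \<open>x x\<^sup>T\<close> has the
  drift \<open>b x\<^sup>T + x b\<^sup>T + (A1 x) (A1 x)\<^sup>T\<close> with \<open>b = A x + B u + E v\<close>, which is bilinear.
\<close>

lemma conditional_moment_increment:
  fixes A A1 :: "real^('n::{finite,linorder})^('n::{finite,linorder})"
    and B :: "real^'m^('n::{finite,linorder})" and E :: "real^'p^('n::{finite,linorder})"
  assumes x: "sde_solution M W (\<lambda>t \<omega>. A *v x t \<omega> + B *v u t \<omega> + E *v v t \<omega>) (\<lambda>t \<omega>. A1 *v x t \<omega>) x0 x"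
    and u: "l2_adapted M W u" and v: "l2_adapted M W v" and a: "0 \<le> a" "a \<le> T"
  shows "AE \<omega> in M. \<forall>i k. real_cond_exp M (FF a) (\<lambda>\<omega>. x T \<omega> $ i * x T \<omega> $ k) \<omega> - x a \<omega> $ i * x a \<omega> $ k
    = moment_increment A A1 B E (moment a T x x \<omega>) (moment a T u x \<omega>) (moment a T v x \<omega>) $ i $ k"
proof -
  have T: "0 \<le> T" using a by simp
  have lx: "l2_adapted M W x" using x by (simp add: sde_solution_def)
  let ?b = "\<lambda>t \<omega>. A *v x t \<omega> + B *v u t \<omega> + E *v v t \<omega>"
  note proc = controlled_state_ito_process[OF x u v T]
  let ?X = "moment a T x x" and ?U = "moment a T u x" and ?V = "moment a T v x"
  have drift: "AE \<omega> in M. window_mean a T (\<lambda>(\<omega>, t). ?b t \<omega> $ i * x t \<omega> $ k) \<omega>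
      = (A ** ?X \<omega> + B ** ?U \<omega> + E ** ?V \<omega>) $ i $ k" for i k
  proof -
    note i = l2_adapted_product_integrable[OF l2_adapted_linear[OF lx] lx T, of A i k]
      l2_adapted_product_integrable[OF l2_adapted_linear[OF u] lx T, of B i k]
      l2_adapted_product_integrable[OF l2_adapted_linear[OF v] lx T, of E i k]
    have split: "(\<lambda>(\<omega>, t). ?b t \<omega> $ i * x t \<omega> $ k)
        = (\<lambda>p. ((case p of (\<omega>, t) \<Rightarrow> (A *v x t \<omega>) $ i * x t \<omega> $ k) + (case p of (\<omega>, t) \<Rightarrow> (B *v u t \<omega>) $ i * x t \<omega> $ k))
          + (case p of (\<omega>, t) \<Rightarrow> (E *v v t \<omega>) $ i * x t \<omega> $ k))"
      by (auto simp: fun_eq_iff distrib_right)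
    show ?thesis
      unfolding split
      using window_mean_add[OF Bochner_Integration.integrable_add[OF i(1,2)] i(3), of a] window_mean_add[OF i(1,2), of a]
        window_mean_linear[OF lx lx T, of a A i k] window_mean_linear[OF u lx T, of a B i k]
        window_mean_linear[OF v lx T, of a E i k]
      by eventually_elim simp
  qed
  have noise: "AE \<omega> in M. window_mean a T (\<lambda>(\<omega>, t). (A1 *v x t \<omega>) $ i * (A1 *v x t \<omega>) $ k) \<omega>
      = (A1 ** ?X \<omega> ** transpose A1) $ i $ k" for i k
  proof -
    have "AE \<omega> in M. window_mean a T (\<lambda>(\<omega>, t). (A1 *v x t \<omega>) $ i * (A1 *v x t \<omega>) $ k) \<omega>
        = (A1 ** moment a T x (\<lambda>t \<omega>. A1 *v x t \<omega>) \<omega>) $ i $ k"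
      by (rule window_mean_linear[OF lx l2_adapted_linear[OF lx] T])
    moreover have "AE \<omega> in M. \<forall>k l. window_mean a T (\<lambda>(\<omega>, t). (A1 *v x t \<omega>) $ k * x t \<omega> $ l) \<omega> = (A1 ** ?X \<omega>) $ k $ l"
      using window_mean_linear[OF lx lx T, of a A1] by (simp add: AE_all_countable)
    ultimately show ?thesis
    proof eventually_elim
      fix \<omega> assume e: "window_mean a T (\<lambda>(\<omega>, t). (A1 *v x t \<omega>) $ i * (A1 *v x t \<omega>) $ k) \<omega>
          = (A1 ** moment a T x (\<lambda>t \<omega>. A1 *v x t \<omega>) \<omega>) $ i $ k"
        and "\<forall>k l. window_mean a T (\<lambda>(\<omega>, t). (A1 *v x t \<omega>) $ k * x t \<omega> $ l) \<omega> = (A1 ** ?X \<omega>) $ k $ l"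
      hence "moment a T (\<lambda>t \<omega>. A1 *v x t \<omega>) x \<omega> = A1 ** ?X \<omega>"
        by (simp add: vec_eq_iff moment_def)
      hence "moment a T x (\<lambda>t \<omega>. A1 *v x t \<omega>) \<omega> = transpose (A1 ** ?X \<omega>)"
        using moment_transpose[of a T x "\<lambda>t \<omega>. A1 *v x t \<omega>" \<omega>] by (simp add: vec_eq_iff transpose_def)
      also have "\<dots> = ?X \<omega> ** transpose A1"
        using moment_sym[of a T x \<omega>] by (simp add: matrix_transpose_mul sym_mats_def)
      finally show "window_mean a T (\<lambda>(\<omega>, t). (A1 *v x t \<omega>) $ i * (A1 *v x t \<omega>) $ k) \<omega>
          = (A1 ** ?X \<omega> ** transpose A1) $ i $ k"
        using e by (simp add: matrix_mul_assoc)
    qed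
  qed
  have "AE \<omega> in M. real_cond_exp M (FF a) (\<lambda>\<omega>. x T \<omega> $ i * x T \<omega> $ k) \<omega> - x a \<omega> $ i * x a \<omega> $ k
    = moment_increment A A1 B E (?X \<omega>) (?U \<omega>) (?V \<omega>) $ i $ k" for i k
  proof -
    have xk: "sq_int (horizon M T) (\<lambda>p. x (snd p) (fst p) $ k)" for k
      using l2_adapted_component(2)[OF lx T, of k] by (simp add: case_prod_beta')
    have bk: "sq_int (horizon M T) (\<lambda>p. ?b (snd p) (fst p) $ k)" for k
      using proc[of k] unfolding ito_process_def by (simp add: case_prod_beta')
    have ibx: "integrable (horizon M T) (\<lambda>(\<omega>, t). ?b t \<omega> $ i * x t \<omega> $ k)" for i k
      using sq_int_mult_integrable[OF bk[of i] xk[of k]] by (simp add: case_prod_beta')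
    note ig = l2_adapted_product_integrable[OF l2_adapted_linear[OF lx] l2_adapted_linear[OF lx] T, of A1 i A1 k]
    have split: "(\<lambda>(\<omega>, t). x t \<omega> $ i * ?b t \<omega> $ k + x t \<omega> $ k * ?b t \<omega> $ i + (A1 *v x t \<omega>) $ i * (A1 *v x t \<omega>) $ k)
        = (\<lambda>p. ((case p of (\<omega>, t) \<Rightarrow> ?b t \<omega> $ i * x t \<omega> $ k) + (case p of (\<omega>, t) \<Rightarrow> ?b t \<omega> $ k * x t \<omega> $ i))
          + (case p of (\<omega>, t) \<Rightarrow> (A1 *v x t \<omega>) $ i * (A1 *v x t \<omega>) $ k))"
      by (auto simp: fun_eq_iff algebra_simps)
    show ?thesis
      using ito_product_conditional_mean[OF proc[of i] proc[of k] a, unfolded split]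
        window_mean_add[OF Bochner_Integration.integrable_add[OF ibx[of i k] ibx[of k i]] ig, of a]
        window_mean_add[OF ibx[of i k] ibx[of k i], of a] drift[of i k] drift[of k i] noise[of i k]
    proof eventually_elim
      case (elim \<omega>)
      thus ?case by (simp add: moment_increment_def transpose_def)
    qed
  qed
  thus ?thesis by (simp add: AE_all_countable)
qed

text \<open>
  Half-vectorization and column stacking only rearrange and rescale the entries of the moment
  matrices, and conditional expectation commutes with this.
\<close>

lemma data_rows:
  fixes A A1 :: "real^('n::{finite,linorder})^('n::{finite,linorder})"
    and B :: "real^'m^('n::{finite,linorder})" and E :: "real^'p^('n::{finite,linorder})"
  assumes x: "sde_solution M W (\<lambda>t \<omega>. A *v x t \<omega> + B *v u t \<omega> + E *v v t \<omega>) (\<lambda>t \<omega>. A1 *v x t \<omega>) x0 x"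
    and u: "l2_adapted M W u" and v: "l2_adapted M W v" and tm: "0 \<le> tm j" "0 < dt"
  defines "X \<equiv> moment (tm j) (tm j + dt) x x" and "U \<equiv> moment (tm j) (tm j + dt) u x"
    and "V \<equiv> moment (tm j) (tm j + dt) v x"
  shows "AE \<omega> in M. integral_row M W tm dt (\<lambda>\<tau> \<omega>. xtilde (x \<tau> \<omega>)) \<omega> j = vecs (X \<omega>)"
    "AE \<omega> in M. integral_row M W tm dt (\<lambda>\<tau> \<omega>. kron_vec (x \<tau> \<omega>) (x \<tau> \<omega>)) \<omega> j = vec_mat (X \<omega>)"
    "AE \<omega> in M. integral_row M W tm dt (\<lambda>\<tau> \<omega>. kron_vec (x \<tau> \<omega>) (u \<tau> \<omega>)) \<omega> j = vec_mat (U \<omega>)"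
    "AE \<omega> in M. integral_row M W tm dt (\<lambda>\<tau> \<omega>. kron_vec (x \<tau> \<omega>) (v \<tau> \<omega>)) \<omega> j = vec_mat (V \<omega>)"
    "AE \<omega> in M. increment_row M W tm dt (\<lambda>\<tau> \<omega>. xtilde (x \<tau> \<omega>)) \<omega> j
       = vecs (moment_increment A A1 B E (X \<omega>) (U \<omega>) (V \<omega>))"
proof -
  define a where "a = tm j"
  define T where "T = tm j + dt"
  have aT: "0 \<le> a" "a \<le> T" "0 \<le> T" using tm by (auto simp: a_def T_def)
  have lx: "l2_adapted M W x" using x by (simp add: sde_solution_def)
  have kron: "AE \<omega> in M. integral_row M W tm dt (\<lambda>\<tau> \<omega>. kron_vec (x \<tau> \<omega>) (w \<tau> \<omega>)) \<omega> j = vec_mat (moment a T w x \<omega>)"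
    if w: "l2_adapted M W w" for w :: "real \<Rightarrow> 'w \<Rightarrow> real^'k"
  proof -
    have eq: "(\<lambda>(\<omega>, t). kron_vec (x t \<omega>) (w t \<omega>) $ e) = (\<lambda>(\<omega>, t). w t \<omega> $ snd e * x t \<omega> $ fst e)" for e
      by (auto simp: fun_eq_iff kron_vec_def split: prod.split)
    have "AE \<omega> in M. \<forall>e. integral_row M W tm dt (\<lambda>\<tau> \<omega>. kron_vec (x \<tau> \<omega>) (w \<tau> \<omega>)) \<omega> j $ e
        = window_mean (tm j) (tm j + dt) (\<lambda>(\<omega>, t). kron_vec (x t \<omega>) (w t \<omega>) $ e) \<omega>"
      by (rule integral_row_component[where tm = tm and j = j, OF _ tm])
        (use l2_adapted_product_integrable[OF w lx aT(3)[unfolded T_def]] in \<open>simp add: eq\<close>)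
    thus ?thesis
      by eventually_elim (simp add: vec_eq_iff eq vec_mat_def moment_def a_def T_def)
  qed
  show "AE \<omega> in M. integral_row M W tm dt (\<lambda>\<tau> \<omega>. kron_vec (x \<tau> \<omega>) (x \<tau> \<omega>)) \<omega> j = vec_mat (X \<omega>)"
    "AE \<omega> in M. integral_row M W tm dt (\<lambda>\<tau> \<omega>. kron_vec (x \<tau> \<omega>) (u \<tau> \<omega>)) \<omega> j = vec_mat (U \<omega>)"
    "AE \<omega> in M. integral_row M W tm dt (\<lambda>\<tau> \<omega>. kron_vec (x \<tau> \<omega>) (v \<tau> \<omega>)) \<omega> j = vec_mat (V \<omega>)"
    using kron[OF lx] kron[OF u] kron[OF v] unfolding X_def U_def V_def a_def T_def by auto
  define q where "q = (\<lambda>e :: 'n upper_pair. if fst (Rep_upper_pair e) = snd (Rep_upper_pair e) then 1 else sqrt 2)"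
  have xt: "xtilde y $ e = q e * (y $ fst (Rep_upper_pair e) * y $ snd (Rep_upper_pair e))" for y :: "real^('n::{finite,linorder})" and e
    by (simp add: xtilde_def vecs_def outer_def q_def split: prod.split)
  have vq: "vecs H $ e = q e * H $ fst (Rep_upper_pair e) $ snd (Rep_upper_pair e)" for H :: "real^('n::{finite,linorder})^('n::{finite,linorder})" and e
    by (simp add: vecs_def q_def split: prod.split)
  show "AE \<omega> in M. integral_row M W tm dt (\<lambda>\<tau> \<omega>. xtilde (x \<tau> \<omega>)) \<omega> j = vecs (X \<omega>)"
  proof -
    have i: "integrable (horizon M T) (\<lambda>(\<omega>, t). x t \<omega> $ i * x t \<omega> $ k)" for i k
      by (rule l2_adapted_product_integrable[OF lx lx aT(3)])
    have eq: "(\<lambda>(\<omega>, t). xtilde (x t \<omega>) $ e) = (\<lambda>p. q e * (case p of (\<omega>, t) \<Rightarrow>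
        x t \<omega> $ fst (Rep_upper_pair e) * x t \<omega> $ snd (Rep_upper_pair e)))" for e
      by (auto simp: fun_eq_iff xt)
    have "AE \<omega> in M. \<forall>e. integral_row M W tm dt (\<lambda>\<tau> \<omega>. xtilde (x \<tau> \<omega>)) \<omega> j $ e
        = window_mean (tm j) (tm j + dt) (\<lambda>(\<omega>, t). xtilde (x t \<omega>) $ e) \<omega>"
      by (rule integral_row_component[where tm = tm and j = j, OF _ tm]) (use i in \<open>simp add: eq T_def\<close>)
    moreover have "AE \<omega> in M. \<forall>e. window_mean a T (\<lambda>(\<omega>, t). xtilde (x t \<omega>) $ e) \<omega>
        = q e * window_mean a T (\<lambda>(\<omega>, t). x t \<omega> $ fst (Rep_upper_pair e) * x t \<omega> $ snd (Rep_upper_pair e)) \<omega>"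
      unfolding AE_all_countable eq using window_mean_cmult[OF i] by blast
    ultimately show ?thesis
      by eventually_elim (simp add: vec_eq_iff vq X_def moment_def a_def T_def)
  qed
  show "AE \<omega> in M. increment_row M W tm dt (\<lambda>\<tau> \<omega>. xtilde (x \<tau> \<omega>)) \<omega> j
       = vecs (moment_increment A A1 B E (X \<omega>) (U \<omega>) (V \<omega>))"
  proof -
    interpret S: sigma_finite_subalgebra M "FF a" by (rule sigma_finite_subalgebra_FF)
    have "sq_int M (\<lambda>\<omega>. x T \<omega> $ i)" for i
      by (rule ito_process_sq_int[OF controlled_state_ito_process[OF x u v aT(3)]]) (use aT in simp)
    hence "integrable M (\<lambda>\<omega>. x T \<omega> $ i * x T \<omega> $ k)" for i k
      by (intro sq_int_mult_integrable)
    hence "AE \<omega> in M. \<forall>e. real_cond_exp M (FF a) (\<lambda>\<omega>. xtilde (x T \<omega>) $ e) \<omega>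
        = q e * real_cond_exp M (FF a) (\<lambda>\<omega>. x T \<omega> $ fst (Rep_upper_pair e) * x T \<omega> $ snd (Rep_upper_pair e)) \<omega>"
      unfolding AE_all_countable xt using S.real_cond_exp_cmult by blast
    with conditional_moment_increment[OF x u v aT(1,2)]
    show ?thesis
    proof eventually_elim
      case (elim \<omega>)
      have "increment_row M W tm dt (\<lambda>\<tau> \<omega>. xtilde (x \<tau> \<omega>)) \<omega> j $ e
          = vecs (moment_increment A A1 B E (X \<omega>) (U \<omega>) (V \<omega>)) $ e" for e
      proof -
        let ?i = "fst (Rep_upper_pair e)" and ?k = "snd (Rep_upper_pair e)"
        have "increment_row M W tm dt (\<lambda>\<tau> \<omega>. xtilde (x \<tau> \<omega>)) \<omega> j $ e
            = q e * (real_cond_exp M (FF a) (\<lambda>\<omega>. x T \<omega> $ ?i * x T \<omega> $ ?k) \<omega> - x a \<omega> $ ?i * x a \<omega> $ ?k)"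
          using elim(2) unfolding increment_row_def cond_exp_vec_def unfolding T_def[symmetric] unfolding a_def[symmetric]
          by (simp add: xt right_diff_distrib)
        also have "\<dots> = q e * moment_increment A A1 B E (X \<omega>) (U \<omega>) (V \<omega>) $ ?i $ ?k"
          using elim(1) unfolding X_def U_def V_def a_def T_def by metis
        finally show ?thesis by (simp add: vq)
      qed
      thus ?case by (simp add: vec_eq_iff)
    qed
  qed
qed

end

section \<open>Convergence of the off-policy algorithm\<close>

theorem theorem3:
  fixes M :: "'w measure" and W :: "real \<Rightarrow> 'w \<Rightarrow> real"
    and A A1 Q Pstar P0 :: "real^('n::{finite, linorder})^('n::{finite, linorder})"
    and B :: "real^('m::finite)^('n::{finite, linorder})"
    and E :: "real^('p::finite)^('n::{finite, linorder})"
    and C :: "real^('n::{finite, linorder})^('q::finite)"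
    and D :: "real^'m^('r::finite)"
    and R :: "real^'m^'m"
    and Lb :: "real^('n::{finite, linorder})^'m" and Fb :: "real^('n::{finite, linorder})^'p"
    and \<gamma> c0 a0 dt :: real and x0 :: "real^('n::{finite, linorder})"
    and x :: "real \<Rightarrow> 'w \<Rightarrow> real^('n::{finite, linorder})"
    and u eu :: "real \<Rightarrow> 'w \<Rightarrow> real^'m"
    and v ev :: "real \<Rightarrow> 'w \<Rightarrow> real^'p"
    and tm :: "nat \<Rightarrow> real" and S s :: nat
    and P :: "nat \<Rightarrow> 'w \<Rightarrow> real^('n::{finite, linorder})^('n::{finite, linorder})"
    and L :: "nat \<Rightarrow> 'w \<Rightarrow> real^('n::{finite, linorder})^'m"
    and F :: "nat \<Rightarrow> 'w \<Rightarrow> real^('n::{finite, linorder})^'p"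
  assumes W: "brownian_motion M W"
    and D: "rank D = CARD('m)"
    and Q: "Q = transpose C ** C"
    and R: "R = transpose D ** D"
    and \<gamma>: "0 < \<gamma>"
    and Pstar: "stabilizing_solution M W A A1 B E Q R \<gamma> Pstar"
    and Pstar_unique: "\<And>P'. stabilizing_solution M W A A1 B E Q R \<gamma> P' \<Longrightarrow> P' = Pstar"
    and detect: "exactly_detectable M W A A1 C"
    and detect': "exactly_detectable M W (A + (1 / \<gamma>\<^sup>2) *\<^sub>R (E ** transpose E ** Pstar)) A1 C"
    and stabilizable: "internally_stabilizable M W A B A1"
    and c0: "0 < c0" "deriv_lipschitz A A1 B E R \<gamma> c0"
    and a0: "0 < a0" "deriv_inverse_bound A A1 B E R \<gamma> Pstar a0"
    and P0: "P0 \<in> initial_set Pstar c0 a0"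
    and noise: "l2_adapted M W eu" "l2_adapted M W ev"
    and inputs: "l2_adapted M W u" "l2_adapted M W v"
    and u: "\<And>t \<omega>. 0 \<le> t \<Longrightarrow> \<omega> \<in> space M \<Longrightarrow> u t \<omega> = - (Lb *v x t \<omega>) + eu t \<omega>"
    and v: "\<And>t \<omega>. 0 \<le> t \<Longrightarrow> \<omega> \<in> space M \<Longrightarrow> v t \<omega> = - (Fb *v x t \<omega>) + ev t \<omega>"
    and x: "sde_solution M W (\<lambda>t \<omega>. A *v x t \<omega> + B *v u t \<omega> + E *v v t \<omega>)
              (\<lambda>t \<omega>. A1 *v x t \<omega>) x0 x"
    and times: "0 \<le> tm 1" "0 < dt" "\<And>j. 1 \<le> j \<Longrightarrow> tm j + dt \<le> tm (Suc j)"
    and rank: "0 < S" "\<And>s'. S \<le> s' \<Longrightarrow> AE \<omega> in M.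
        row_data_rank s' (\<lambda>j. block3
            (integral_row M W tm dt (\<lambda>\<tau> \<omega>. xtilde (x \<tau> \<omega>)) \<omega> j)
            (integral_row M W tm dt (\<lambda>\<tau> \<omega>. kron_vec (x \<tau> \<omega>) (u \<tau> \<omega>)) \<omega> j)
            (integral_row M W tm dt (\<lambda>\<tau> \<omega>. kron_vec (x \<tau> \<omega>) (v \<tau> \<omega>)) \<omega> j))
          = CARD('n) * (CARD('n) + 1) div 2 + CARD('n) * CARD('m) + CARD('n) * CARD('p)"
    and s: "S \<le> s"
    and algorithm: "AE \<omega> in M. off_policy_iterates s
        (increment_row M W tm dt (\<lambda>\<tau> \<omega>. xtilde (x \<tau> \<omega>)) \<omega>)
        (integral_row M W tm dt (\<lambda>\<tau> \<omega>. xtilde (x \<tau> \<omega>)) \<omega>)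
        (integral_row M W tm dt (\<lambda>\<tau> \<omega>. kron_vec (x \<tau> \<omega>) (x \<tau> \<omega>)) \<omega>)
        (integral_row M W tm dt (\<lambda>\<tau> \<omega>. kron_vec (x \<tau> \<omega>) (u \<tau> \<omega>)) \<omega>)
        (integral_row M W tm dt (\<lambda>\<tau> \<omega>. kron_vec (x \<tau> \<omega>) (v \<tau> \<omega>)) \<omega>)
        B E Q R \<gamma> P0 (\<lambda>i. P i \<omega>) (\<lambda>i. L i \<omega>) (\<lambda>i. F i \<omega>)"
  shows "AE \<omega> in M. (\<lambda>i. P i \<omega>) \<longlonglongrightarrow> Pstar"
proof -
  interpret brownian M W by unfold_locales (rule W)
  note gram = gram_matrix_inverse[OF D R]
  have Pst: "Pstar \<in> sym_mats" "riccati A A1 B E Q R \<gamma> Pstar = 0"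
    using Pstar unfolding stabilizing_solution_def psd_mats_def by auto
  interpret N: riccati_newton A A1 Q Pstar B E R \<gamma> c0 a0
    by unfold_locales (use gram Q c0 a0 Pst in \<open>auto simp: sym_mats_def matrix_transpose_mul\<close>)
  have tm: "0 \<le> tm j" if "1 \<le> j" for j
    using that
  proof (induction j rule: nat_induct_at_least)
    case (Suc j)
    thus ?case using times(2) times(3)[of j] by simp
  qed (rule times(1))
  have P0': "P0 \<in> sym_mats" "norm (P0 - Pstar) \<le> (2 - sqrt 2) / (2 * c0 * a0)"
    using P0 unfolding initial_set_def psd_mats_def by auto
  let ?X = "\<lambda>\<omega> j. moment (tm j) (tm j + dt) x x \<omega>" and ?U = "\<lambda>\<omega> j. moment (tm j) (tm j + dt) u x \<omega>"
    and ?V = "\<lambda>\<omega> j. moment (tm j) (tm j + dt) v x \<omega>"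
  have rows: "AE \<omega> in M. \<forall>j\<in>{1..s}.
      integral_row M W tm dt (\<lambda>\<tau> \<omega>. xtilde (x \<tau> \<omega>)) \<omega> j = vecs (?X \<omega> j) \<and>
      integral_row M W tm dt (\<lambda>\<tau> \<omega>. kron_vec (x \<tau> \<omega>) (x \<tau> \<omega>)) \<omega> j = vec_mat (?X \<omega> j) \<and>
      integral_row M W tm dt (\<lambda>\<tau> \<omega>. kron_vec (x \<tau> \<omega>) (u \<tau> \<omega>)) \<omega> j = vec_mat (?U \<omega> j) \<and>
      integral_row M W tm dt (\<lambda>\<tau> \<omega>. kron_vec (x \<tau> \<omega>) (v \<tau> \<omega>)) \<omega> j = vec_mat (?V \<omega> j) \<and>
      increment_row M W tm dt (\<lambda>\<tau> \<omega>. xtilde (x \<tau> \<omega>)) \<omega> j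
        = vecs (moment_increment A A1 B E (?X \<omega> j) (?U \<omega> j) (?V \<omega> j))" (is "AE \<omega> in M. \<forall>j\<in>_. ?rows \<omega> j")
  proof (rule AE_finite_allI)
    fix j assume "j \<in> {1..s}"
    hence "0 \<le> tm j" by (intro tm) simp
    from data_rows[where tm = tm and j = j, OF x inputs this times(2)]
    show "AE \<omega> in M. ?rows \<omega> j" by eventually_elim blast
  qed simp
  from algorithm rank(2)[OF s] rows show ?thesis
  proof eventually_elim
    case (elim \<omega>)
    show ?case
      by (rule N.off_policy_iterates_converge[OF gram(1,2) _ moment_sym _ _ _ _ _ elim(2) P0' elim(1)])
        (use elim(3) \<gamma> in auto)
  qed
qed

end
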